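(* Let $(M,g,J)$ be a locally conformal Kaehler manifold with Lee form $\omega$ and Lee vector field $B_1$, let $(B,g_B)$ be a Riemannian manifold, and let $\pi:M\rightarrow B$ be a Lagrangian Riemannian submersion of $M$ onto $B$. Assume $B_1\in\Gamma(\ker\pi_* )$. Then the following are equivalent: (a) the distribution $(\ker\pi_* )^\bot$ is integrable; (b) for all $X,Y\in\Gamma((\ker\pi_* )^\bot)$, $$(\nabla\pi_* )(X,JY)=(\nabla\pi_* )(Y,JX)-\tfrac12 g(BY,B_1)\,\pi_*X+\tfrac12 g(BX,B_1)\,\pi_*Y;$$ (c) for all $X,Y\in\Gamma((\ker\pi_* )^\bot)$, $$\pi_*(\mathcal{A}_XJY-\mathcal{A}_YJX)=\tfrac12 g(BY,B_1)\,\pi_*X-\tfrac12 g(BX,B_1)\,\pi_*Y.$$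
   Context: Locally conformal Kaehler (l.c.K.) manifold: a Hermitian manifold $(M,J,g)$, with $\Omega(X,Y)=g(X,JY)$, for which there is a globally defined closed $1$-form $\omega$ (the Lee form) with $d\Omega=\omega\wedge\Omega$. The Lee vector field $B_1$ is defined by $g(X,B_1)=\omega(X)$; set $\theta=\omega\circ J$ and $A=-JB_1$. The Levi-Civita connection $\nabla$ of $g$ then satisfies $(\nabla_XJ)Y=\frac12\{\theta(Y)X-\omega(Y)JX-g(X,Y)A-\Omega(X,Y)B_1\}$. Riemannian submersion $\pi:(M,g)\to(B,g_B)$ (with $\dim M>\dim B$): a surjective smooth map of maximal rank whose differential $\pi_*$ preserves lengths of horizontal vectors. $\ker\pi_*$ is the vertical distribution, $(\ker\pi_* )^\bot$ the horizontal one; $\mathcal V,\mathcal H$ are the orthogonal projections onto them. The O'Neill tensor is $\mathcal{A}_EF=\mathcal{H}\nabla_{\mathcal{H}E}\mathcal{V}F+\mathcal{V}\nabla_{\mathcal{H}E}\mathcal{H}F$. $\pi$ is anti-invariant if $J(\ker\pi_* )\subseteq(\ker\pi_* )^\bot$, and Lagrangian if $J(\ker\pi_* )=(\ker\pi_* )^\bot$. For horizontal $X$, $BX$ denotes the vertical part of $JX$; in the Lagrangian case $BX=JX$ (the operator $B$ is not to be confused with the base manifold $B$ or the vector field $B_1$). Second fundamental form of $\pi$: $(\nabla\pi_* )(E,F)=\nabla^{\pi}_E\pi_*(F)-\pi_*(\nabla_EF)$, with $\nabla^\pi$ the pullback connection of the Levi-Civita connection of $B$. *)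

theory Defs
  imports "HOL-Analysis.Analysis" "HOL-Library.Function_Algebras"
begin

text \<open>Tangent vectors and vector fields are functions; they are added and scaled pointwise.\<close>

instantiation "fun" :: (type, real_vector) real_vector
begin

definition scaleR_fun :: "real \<Rightarrow> ('a \<Rightarrow> 'b) \<Rightarrow> 'a \<Rightarrow> 'b" where
  "scaleR_fun c f = (\<lambda>x. c *\<^sub>R f x)"

instance
  by standard (auto simp: scaleR_fun_def fun_eq_iff scaleR_add_right scaleR_add_left)

end

definition linear_on :: "'a::real_vector set \<Rightarrow> ('a \<Rightarrow> 'b::real_vector) \<Rightarrow> bool" where
  "linear_on S h \<longleftrightarrow>
     (\<forall>v\<in>S. \<forall>w\<in>S. \<forall>a b. h (a *\<^sub>R v + b *\<^sub>R w) = a *\<^sub>R h v + b *\<^sub>R h w)"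


section \<open>Smooth manifolds\<close>

text \<open>\<open>C\<^sup>k\<close> and smooth maps between Euclidean spaces; only used for open \<open>S\<close>.\<close>

fun Ck_on :: "nat \<Rightarrow> 'a::euclidean_space set \<Rightarrow> ('a \<Rightarrow> 'b::real_normed_vector) \<Rightarrow> bool" where
  "Ck_on 0 S f \<longleftrightarrow> continuous_on S f"
| "Ck_on (Suc k) S f \<longleftrightarrow>
     (\<forall>x\<in>S. f differentiable (at x)) \<and>
     (\<forall>v. Ck_on k S (\<lambda>x. frechet_derivative f (at x) v))"

definition smooth_on :: "'a::euclidean_space set \<Rightarrow> ('a \<Rightarrow> 'b::real_normed_vector) \<Rightarrow> bool" where
  "smooth_on S f \<longleftrightarrow> (\<forall>k. Ck_on k S f)"

type_synonym ('m, 'e) chart = "'m set \<times> ('m \<Rightarrow> 'e)"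
type_synonym ('m, 'e) atlas = "('m, 'e) chart set"

definition is_chart :: "('m::topological_space, 'e::euclidean_space) chart \<Rightarrow> bool" where
  "is_chart = (\<lambda>(U, \<phi>). open U \<and> open (\<phi> ` U) \<and> (\<exists>\<psi>. homeomorphism U (\<phi> ` U) \<phi> \<psi>))"

definition smooth_compatible ::
  "('m, 'e::euclidean_space) chart \<Rightarrow> ('m, 'e) chart \<Rightarrow> bool" where
  "smooth_compatible = (\<lambda>(U, \<phi>) (V, \<psi>).
     smooth_on (\<phi> ` (U \<inter> V)) (\<psi> \<circ> inv_into U \<phi>) \<and>
     smooth_on (\<psi> ` (U \<inter> V)) (\<phi> \<circ> inv_into V \<psi>))"

text \<open>The points of the manifold are all elements of the type \<open>'m\<close>, whose sort provides the
  Hausdorff property and second countability. Its dimension is \<open>DIM('e)\<close>.\<close>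

definition smooth_manifold ::
  "('m::{t2_space,second_countable_topology}, 'e::euclidean_space) atlas \<Rightarrow> bool" where
  "smooth_manifold M \<longleftrightarrow>
     (\<Union>(U, \<phi>)\<in>M. U) = UNIV \<and> (\<forall>c\<in>M. is_chart c) \<and> (\<forall>c\<in>M. \<forall>d\<in>M. smooth_compatible c d)"

definition max_atlas ::
  "('m::topological_space, 'e::euclidean_space) atlas \<Rightarrow> ('m, 'e) atlas" where
  "max_atlas M = {c. is_chart c \<and> (\<forall>d\<in>M. smooth_compatible c d)}"

definition smooth_fun_on ::
  "('m, 'e::euclidean_space) atlas \<Rightarrow> 'm set \<Rightarrow> ('m \<Rightarrow> real) \<Rightarrow> bool" where
  "smooth_fun_on M W f \<longleftrightarrow> (\<forall>(U, \<phi>)\<in>M. smooth_on (\<phi> ` (U \<inter> W)) (f \<circ> inv_into U \<phi>))"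

definition smooth_near ::
  "('m::topological_space, 'e::euclidean_space) atlas \<Rightarrow> 'm \<Rightarrow> ('m \<Rightarrow> real) \<Rightarrow> bool" where
  "smooth_near M p f \<longleftrightarrow> (\<exists>W. open W \<and> p \<in> W \<and> smooth_fun_on M W f)"

definition smooth_map ::
  "('m::topological_space, 'e::euclidean_space) atlas \<Rightarrow>
   ('n::topological_space, 'f::euclidean_space) atlas \<Rightarrow> ('m \<Rightarrow> 'n) \<Rightarrow> bool" where
  "smooth_map M N F \<longleftrightarrow> continuous_on UNIV F \<and>
     (\<forall>(U, \<phi>)\<in>M. \<forall>(V, \<psi>)\<in>N. smooth_on (\<phi> ` (U \<inter> F -` V)) (\<psi> \<circ> F \<circ> inv_into U \<phi>))"


section \<open>Tangent vectors, vector fields, forms\<close>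

type_synonym 'm tvec = "('m \<Rightarrow> real) \<Rightarrow> real"
type_synonym 'm vfield = "'m \<Rightarrow> 'm tvec"

text \<open>Tangent vectors at \<open>p\<close> are the derivations on germs at \<open>p\<close> of smooth functions. As functions
  are total in HOL, a tangent vector gets the dummy value 0 on functions not smooth near \<open>p\<close>.\<close>

definition tangent_space ::
  "('m::topological_space, 'e::euclidean_space) atlas \<Rightarrow> 'm \<Rightarrow> 'm tvec set" where
  "tangent_space M p = {v.
     linear_on {f. smooth_near M p f} v \<and>
     (\<forall>f h. smooth_near M p f \<longrightarrow> smooth_near M p h \<longrightarrow> v (f * h) = f p * v h + h p * v f) \<and>
     (\<forall>f h. smooth_near M p f \<longrightarrow> smooth_near M p h \<longrightarrow>
        (\<forall>\<^sub>F q in nhds p. f q = h q) \<longrightarrow> v f = v h) \<and>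
     (\<forall>f. \<not> smooth_near M p f \<longrightarrow> v f = 0)}"

definition differential ::
  "('n::topological_space, 'f::euclidean_space) atlas \<Rightarrow> ('m \<Rightarrow> 'n) \<Rightarrow> 'm \<Rightarrow> 'm tvec \<Rightarrow> 'n tvec" where
  "differential N F p v = (\<lambda>f. if smooth_near N (F p) f then v (f \<circ> F) else 0)"

text \<open>The coordinate vector of a tangent vector in a chart, i.e. \<open>d\<phi>(v)\<close>.\<close>

definition coord_vec :: "('m \<Rightarrow> 'e::euclidean_space) \<Rightarrow> 'm tvec \<Rightarrow> 'e" where
  "coord_vec \<phi> v = (\<Sum>b\<in>Basis. v (\<lambda>q. \<phi> q \<bullet> b) *\<^sub>R b)"

text \<open>Smooth sections of the pullback bundle \<open>F\<^sup>*TN\<close> (vector fields along \<open>F\<close>).\<close>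

definition section_along ::
  "('m::topological_space, 'e::euclidean_space) atlas \<Rightarrow>
   ('n::topological_space, 'f::euclidean_space) atlas \<Rightarrow> ('m \<Rightarrow> 'n) \<Rightarrow> ('m \<Rightarrow> 'n tvec) \<Rightarrow> bool" where
  "section_along M N F s \<longleftrightarrow>
     (\<forall>p. s p \<in> tangent_space N (F p)) \<and>
     (\<forall>W f. open W \<longrightarrow> smooth_fun_on N W f \<longrightarrow> smooth_fun_on M (F -` W) (\<lambda>p. s p f))"

definition vector_field ::
  "('m::topological_space, 'e::euclidean_space) atlas \<Rightarrow> 'm vfield \<Rightarrow> bool" where
  "vector_field M X \<longleftrightarrow> section_along M M id X"

definition lie_bracket ::
  "('m::topological_space, 'e::euclidean_space) atlas \<Rightarrow> 'm vfield \<Rightarrow> 'm vfield \<Rightarrow> 'm vfield" where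
  "lie_bracket M X Y = (\<lambda>p f.
     if smooth_near M p f then X p (\<lambda>q. Y q f) - Y p (\<lambda>q. X q f) else 0)"

definition one_form ::
  "('m::topological_space, 'e::euclidean_space) atlas \<Rightarrow> ('m \<Rightarrow> 'm tvec \<Rightarrow> real) \<Rightarrow> bool" where
  "one_form M \<omega> \<longleftrightarrow>
     (\<forall>p. linear_on (tangent_space M p) (\<omega> p)) \<and>
     (\<forall>X. vector_field M X \<longrightarrow> smooth_fun_on M UNIV (\<lambda>p. \<omega> p (X p)))"

text \<open>Exterior derivative and wedge product are normalised such that
  \<open>d\<omega>(X,Y) = X(\<omega>(Y)) - Y(\<omega>(X)) - \<omega>([X,Y])\<close> and \<open>\<alpha> \<and> \<beta> = \<alpha> \<otimes> \<beta> - \<beta> \<otimes> \<alpha>\<close> for 1-forms. The other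
  common convention divides both \<open>d\<Omega>\<close> and \<open>\<omega> \<and> \<Omega>\<close> by 3.\<close>

definition ext_deriv1 ::
  "('m::topological_space, 'e::euclidean_space) atlas \<Rightarrow> ('m \<Rightarrow> 'm tvec \<Rightarrow> real) \<Rightarrow>
   'm vfield \<Rightarrow> 'm vfield \<Rightarrow> 'm \<Rightarrow> real" where
  "ext_deriv1 M \<omega> X Y p =
     X p (\<lambda>q. \<omega> q (Y q)) - Y p (\<lambda>q. \<omega> q (X q)) - \<omega> p (lie_bracket M X Y p)"

definition ext_deriv2 ::
  "('m::topological_space, 'e::euclidean_space) atlas \<Rightarrow> ('m \<Rightarrow> 'm tvec \<Rightarrow> 'm tvec \<Rightarrow> real) \<Rightarrow>
   'm vfield \<Rightarrow> 'm vfield \<Rightarrow> 'm vfield \<Rightarrow> 'm \<Rightarrow> real" where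
  "ext_deriv2 M \<Omega> X Y Z p =
     X p (\<lambda>q. \<Omega> q (Y q) (Z q)) + Y p (\<lambda>q. \<Omega> q (Z q) (X q)) + Z p (\<lambda>q. \<Omega> q (X q) (Y q))
     - \<Omega> p (lie_bracket M X Y p) (Z p) - \<Omega> p (lie_bracket M Y Z p) (X p)
     - \<Omega> p (lie_bracket M Z X p) (Y p)"

definition wedge12 ::
  "('m \<Rightarrow> 'm tvec \<Rightarrow> real) \<Rightarrow> ('m \<Rightarrow> 'm tvec \<Rightarrow> 'm tvec \<Rightarrow> real) \<Rightarrow>
   'm vfield \<Rightarrow> 'm vfield \<Rightarrow> 'm vfield \<Rightarrow> 'm \<Rightarrow> real" where
  "wedge12 \<omega> \<Omega> X Y Z p =
     \<omega> p (X p) * \<Omega> p (Y p) (Z p) + \<omega> p (Y p) * \<Omega> p (Z p) (X p) + \<omega> p (Z p) * \<Omega> p (X p) (Y p)"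


section \<open>Distributions\<close>

text \<open>The smooth sections \<open>\<Gamma>(D)\<close>.\<close>

definition sections ::
  "('m::topological_space, 'e::euclidean_space) atlas \<Rightarrow> ('m \<Rightarrow> 'm tvec set) \<Rightarrow> 'm vfield set" where
  "sections M D = {X. vector_field M X \<and> (\<forall>p. X p \<in> D p)}"

text \<open>\<open>L\<close> is an embedded submanifold (given by slice charts, in which \<open>L\<close> is a piece of a linear
  subspace \<open>E\<close> and thus \<open>T\<^sub>rL = {v. d\<phi>(v) \<in> E}\<close>) such that \<open>T\<^sub>rL = D\<^sub>r\<close> for all \<open>r \<in> L\<close>.\<close>

definition integral_manifold ::
  "('m::topological_space, 'e::euclidean_space) atlas \<Rightarrow> ('m \<Rightarrow> 'm tvec set) \<Rightarrow> 'm set \<Rightarrow> bool" where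
  "integral_manifold M D L \<longleftrightarrow>
     (\<forall>q\<in>L. \<exists>(U, \<phi>)\<in>max_atlas M. \<exists>E. q \<in> U \<and> subspace E \<and> \<phi> ` (L \<inter> U) = \<phi> ` U \<inter> E \<and>
        (\<forall>r\<in>L \<inter> U. D r = {v \<in> tangent_space M r. coord_vec \<phi> v \<in> E}))"

text \<open>Immersed integral manifolds are locally embedded, so embedded ones suffice here.\<close>

definition integrable_distribution ::
  "('m::topological_space, 'e::euclidean_space) atlas \<Rightarrow> ('m \<Rightarrow> 'm tvec set) \<Rightarrow> bool" where
  "integrable_distribution M D \<longleftrightarrow> (\<forall>p. \<exists>L. p \<in> L \<and> integral_manifold M D L)"


section \<open>Riemannian metrics and connections\<close>

type_synonym 'm metric = "'m \<Rightarrow> 'm tvec \<Rightarrow> 'm tvec \<Rightarrow> real"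

definition riemannian_metric ::
  "('m::topological_space, 'e::euclidean_space) atlas \<Rightarrow> 'm metric \<Rightarrow> bool" where
  "riemannian_metric M g \<longleftrightarrow>
     (\<forall>p. \<forall>v\<in>tangent_space M p.
        linear_on (tangent_space M p) (g p v) \<and>
        (\<forall>w\<in>tangent_space M p. g p v w = g p w v) \<and>
        (v \<noteq> 0 \<longrightarrow> g p v v > 0)) \<and>
     (\<forall>X Y. vector_field M X \<longrightarrow> vector_field M Y \<longrightarrow> smooth_fun_on M UNIV (\<lambda>p. g p (X p) (Y p)))"

definition riemannian_manifold ::
  "('m::{t2_space,second_countable_topology}, 'e::euclidean_space) atlas \<Rightarrow> 'm metric \<Rightarrow> bool" where
  "riemannian_manifold M g \<longleftrightarrow> smooth_manifold M \<and> riemannian_metric M g"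

text \<open>A connection on \<open>F\<^sup>*TN\<close>: \<open>D p v s\<close> is the covariant derivative of the section \<open>s\<close> along
  \<open>v \<in> T\<^sub>pM\<close>. For \<open>F = id\<close> this is an affine connection on \<open>M\<close>.\<close>

type_synonym ('m, 'n) connection = "'m \<Rightarrow> 'm tvec \<Rightarrow> ('m \<Rightarrow> 'n tvec) \<Rightarrow> 'n tvec"

definition connection_along ::
  "('m::topological_space, 'e::euclidean_space) atlas \<Rightarrow>
   ('n::topological_space, 'f::euclidean_space) atlas \<Rightarrow> ('m \<Rightarrow> 'n) \<Rightarrow> ('m, 'n) connection \<Rightarrow> bool" where
  "connection_along M N F D \<longleftrightarrow>
     (\<forall>p s. section_along M N F s \<longrightarrow> linear_on (tangent_space M p) (\<lambda>v. D p v s)) \<and>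
     (\<forall>p. \<forall>v\<in>tangent_space M p. \<forall>s t. section_along M N F s \<longrightarrow> section_along M N F t \<longrightarrow>
        D p v (s + t) = D p v s + D p v t) \<and>
     (\<forall>p. \<forall>v\<in>tangent_space M p. \<forall>f s. smooth_fun_on M UNIV f \<longrightarrow> section_along M N F s \<longrightarrow>
        D p v (\<lambda>q. f q *\<^sub>R s q) = v f *\<^sub>R s p + f p *\<^sub>R D p v s) \<and>
     (\<forall>X s. vector_field M X \<longrightarrow> section_along M N F s \<longrightarrow> section_along M N F (\<lambda>p. D p (X p) s))"

definition levi_civita ::
  "('m::topological_space, 'e::euclidean_space) atlas \<Rightarrow> 'm metric \<Rightarrow> ('m, 'm) connection \<Rightarrow> bool" where
  "levi_civita M g D \<longleftrightarrow> connection_along M M id D \<and>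
     (\<forall>p X Y. vector_field M X \<longrightarrow> vector_field M Y \<longrightarrow>
        D p (X p) Y - D p (Y p) X = lie_bracket M X Y p) \<and>
     (\<forall>p. \<forall>v\<in>tangent_space M p. \<forall>Y Z. vector_field M Y \<longrightarrow> vector_field M Z \<longrightarrow>
        v (\<lambda>q. g q (Y q) (Z q)) = g p (D p v Y) (Z p) + g p (Y p) (D p v Z))"

text \<open>The pullback along \<open>F\<close> of an affine connection \<open>D'\<close> on \<open>N\<close> is the connection on \<open>F\<^sup>*TN\<close>
  determined by its values on the sections \<open>W \<circ> F\<close>.\<close>

definition pullback_connection ::
  "('m::topological_space, 'e::euclidean_space) atlas \<Rightarrow>
   ('n::topological_space, 'f::euclidean_space) atlas \<Rightarrow> ('m \<Rightarrow> 'n) \<Rightarrow>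
   ('n, 'n) connection \<Rightarrow> ('m, 'n) connection \<Rightarrow> bool" where
  "pullback_connection M N F D' D \<longleftrightarrow> connection_along M N F D \<and>
     (\<forall>p. \<forall>v\<in>tangent_space M p. \<forall>W. vector_field N W \<longrightarrow>
        D p v (W \<circ> F) = D' (F p) (differential N F p v) W)"

definition second_fundamental_form ::
  "('n::topological_space, 'f::euclidean_space) atlas \<Rightarrow> ('m \<Rightarrow> 'n) \<Rightarrow>
   ('m, 'm) connection \<Rightarrow> ('m, 'n) connection \<Rightarrow> 'm vfield \<Rightarrow> 'm vfield \<Rightarrow> 'm \<Rightarrow> 'n tvec" where
  "second_fundamental_form N \<pi> nabla nabla_\<pi> X Y p =
     nabla_\<pi> p (X p) (\<lambda>q. differential N \<pi> q (Y q)) - differential N \<pi> p (nabla p (X p) Y)"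


section \<open>Locally conformal Kaehler manifolds\<close>

definition almost_complex_structure ::
  "('m::topological_space, 'e::euclidean_space) atlas \<Rightarrow> ('m \<Rightarrow> 'm tvec \<Rightarrow> 'm tvec) \<Rightarrow> bool" where
  "almost_complex_structure M J \<longleftrightarrow>
     (\<forall>p. linear_on (tangent_space M p) (J p)) \<and>
     (\<forall>p. \<forall>v\<in>tangent_space M p. J p v \<in> tangent_space M p \<and> J p (J p v) = - v) \<and>
     (\<forall>X. vector_field M X \<longrightarrow> vector_field M (\<lambda>p. J p (X p)))"

text \<open>\<open>J\<close> comes from a holomorphic atlas: near every point there is a chart into the model space
  equipped with a constant complex structure \<open>J0\<close> (a copy of the multiplication by \<open>i\<close> on \<open>\<complex>\<^sup>n\<close>)
  which intertwines \<open>J\<close> and \<open>J0\<close>.\<close>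

definition complex_structure ::
  "('m::topological_space, 'e::euclidean_space) atlas \<Rightarrow> ('m \<Rightarrow> 'm tvec \<Rightarrow> 'm tvec) \<Rightarrow> bool" where
  "complex_structure M J \<longleftrightarrow> almost_complex_structure M J \<and>
     (\<forall>p. \<exists>(U, \<phi>)\<in>max_atlas M. \<exists>J0. p \<in> U \<and> linear J0 \<and> (\<forall>x. J0 (J0 x) = - x) \<and>
        (\<forall>q\<in>U. \<forall>v\<in>tangent_space M q. coord_vec \<phi> (J q v) = J0 (coord_vec \<phi> v)))"

definition hermitian_manifold ::
  "('m::{t2_space,second_countable_topology}, 'e::euclidean_space) atlas \<Rightarrow> 'm metric \<Rightarrow>
   ('m \<Rightarrow> 'm tvec \<Rightarrow> 'm tvec) \<Rightarrow> bool" where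
  "hermitian_manifold M g J \<longleftrightarrow> riemannian_manifold M g \<and> complex_structure M J \<and>
     (\<forall>p. \<forall>v\<in>tangent_space M p. \<forall>w\<in>tangent_space M p. g p (J p v) (J p w) = g p v w)"

definition fundamental_form ::
  "'m metric \<Rightarrow> ('m \<Rightarrow> 'm tvec \<Rightarrow> 'm tvec) \<Rightarrow> 'm \<Rightarrow> 'm tvec \<Rightarrow> 'm tvec \<Rightarrow> real" where
  "fundamental_form g J p v w = g p v (J p w)"

definition lck_manifold ::
  "('m::{t2_space,second_countable_topology}, 'e::euclidean_space) atlas \<Rightarrow> 'm metric \<Rightarrow>
   ('m \<Rightarrow> 'm tvec \<Rightarrow> 'm tvec) \<Rightarrow> ('m \<Rightarrow> 'm tvec \<Rightarrow> real) \<Rightarrow> bool" where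
  "lck_manifold M g J \<omega> \<longleftrightarrow> hermitian_manifold M g J \<and> one_form M \<omega> \<and>
     (\<forall>X Y. vector_field M X \<longrightarrow> vector_field M Y \<longrightarrow> (\<forall>p. ext_deriv1 M \<omega> X Y p = 0)) \<and>
     (\<forall>X Y Z. vector_field M X \<longrightarrow> vector_field M Y \<longrightarrow> vector_field M Z \<longrightarrow>
        (\<forall>p. ext_deriv2 M (fundamental_form g J) X Y Z p
             = wedge12 \<omega> (fundamental_form g J) X Y Z p))"

definition lee_vector_field ::
  "('m::topological_space, 'e::euclidean_space) atlas \<Rightarrow> 'm metric \<Rightarrow>
   ('m \<Rightarrow> 'm tvec \<Rightarrow> real) \<Rightarrow> 'm vfield \<Rightarrow> bool" where
  "lee_vector_field M g \<omega> B1 \<longleftrightarrow>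
     vector_field M B1 \<and> (\<forall>p. \<forall>v\<in>tangent_space M p. g p v (B1 p) = \<omega> p v)"


section \<open>Lagrangian Riemannian submersions\<close>

definition vertical_space ::
  "('m::topological_space, 'e::euclidean_space) atlas \<Rightarrow>
   ('n::topological_space, 'f::euclidean_space) atlas \<Rightarrow> ('m \<Rightarrow> 'n) \<Rightarrow> 'm \<Rightarrow> 'm tvec set" where
  "vertical_space M N \<pi> p = {v \<in> tangent_space M p. differential N \<pi> p v = 0}"

definition horizontal_space ::
  "('m::topological_space, 'e::euclidean_space) atlas \<Rightarrow> 'm metric \<Rightarrow>
   ('n::topological_space, 'f::euclidean_space) atlas \<Rightarrow> ('m \<Rightarrow> 'n) \<Rightarrow> 'm \<Rightarrow> 'm tvec set" where
  "horizontal_space M g N \<pi> p =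
     {v \<in> tangent_space M p. \<forall>w\<in>vertical_space M N \<pi> p. g p v w = 0}"

text \<open>Orthogonal projection of \<open>T\<^sub>pM\<close> onto a linear subspace \<open>S\<close>.\<close>

definition orth_proj :: "'m metric \<Rightarrow> 'm \<Rightarrow> 'm tvec set \<Rightarrow> 'm tvec \<Rightarrow> 'm tvec" where
  "orth_proj g p S v = (THE w. w \<in> S \<and> (\<forall>u\<in>S. g p (v - w) u = 0))"

definition vertical_part ::
  "('m::topological_space, 'e::euclidean_space) atlas \<Rightarrow> 'm metric \<Rightarrow>
   ('n::topological_space, 'f::euclidean_space) atlas \<Rightarrow> ('m \<Rightarrow> 'n) \<Rightarrow> 'm \<Rightarrow> 'm tvec \<Rightarrow> 'm tvec" where
  "vertical_part M g N \<pi> p = orth_proj g p (vertical_space M N \<pi> p)"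

definition horizontal_part ::
  "('m::topological_space, 'e::euclidean_space) atlas \<Rightarrow> 'm metric \<Rightarrow>
   ('n::topological_space, 'f::euclidean_space) atlas \<Rightarrow> ('m \<Rightarrow> 'n) \<Rightarrow> 'm \<Rightarrow> 'm tvec \<Rightarrow> 'm tvec" where
  "horizontal_part M g N \<pi> p = orth_proj g p (horizontal_space M g N \<pi> p)"

definition riemannian_submersion ::
  "('m::topological_space, 'e::euclidean_space) atlas \<Rightarrow> 'm metric \<Rightarrow>
   ('n::topological_space, 'f::euclidean_space) atlas \<Rightarrow> 'n metric \<Rightarrow> ('m \<Rightarrow> 'n) \<Rightarrow> bool" where
  "riemannian_submersion M g N gN \<pi> \<longleftrightarrow>
     DIM('e) > DIM('f) \<and> smooth_map M N \<pi> \<and> surj \<pi> \<and>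
     (\<forall>p. differential N \<pi> p ` tangent_space M p = tangent_space N (\<pi> p)) \<and>
     (\<forall>p. \<forall>v\<in>horizontal_space M g N \<pi> p.
        gN (\<pi> p) (differential N \<pi> p v) (differential N \<pi> p v) = g p v v)"

definition lagrangian_submersion ::
  "('m::topological_space, 'e::euclidean_space) atlas \<Rightarrow> 'm metric \<Rightarrow> ('m \<Rightarrow> 'm tvec \<Rightarrow> 'm tvec) \<Rightarrow>
   ('n::topological_space, 'f::euclidean_space) atlas \<Rightarrow> 'n metric \<Rightarrow> ('m \<Rightarrow> 'n) \<Rightarrow> bool" where
  "lagrangian_submersion M g J N gN \<pi> \<longleftrightarrow> riemannian_submersion M g N gN \<pi> \<and>
     (\<forall>p. J p ` vertical_space M N \<pi> p = horizontal_space M g N \<pi> p)"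

text \<open>The O'Neill tensor \<open>\<A>\<close>.\<close>

definition oneill_A ::
  "('m::topological_space, 'e::euclidean_space) atlas \<Rightarrow> 'm metric \<Rightarrow>
   ('n::topological_space, 'f::euclidean_space) atlas \<Rightarrow> ('m \<Rightarrow> 'n) \<Rightarrow> ('m, 'm) connection \<Rightarrow>
   'm vfield \<Rightarrow> 'm vfield \<Rightarrow> 'm vfield" where
  "oneill_A M g N \<pi> nabla E F p =
     (let V = vertical_part M g N \<pi>; H = horizontal_part M g N \<pi> in
      H p (nabla p (H p (E p)) (\<lambda>q. V q (F q))) + V p (nabla p (H p (E p)) (\<lambda>q. H q (F q))))"

text \<open>The operator \<open>BX\<close>, the vertical part of \<open>JX\<close>.\<close>

definition B_op ::
  "('m::topological_space, 'e::euclidean_space) atlas \<Rightarrow> 'm metric \<Rightarrow> ('m \<Rightarrow> 'm tvec \<Rightarrow> 'm tvec) \<Rightarrow>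
   ('n::topological_space, 'f::euclidean_space) atlas \<Rightarrow> ('m \<Rightarrow> 'n) \<Rightarrow> 'm vfield \<Rightarrow> 'm vfield" where
  "B_op M g J N \<pi> X p = vertical_part M g N \<pi> p (J p (X p))"

end

theory Submission
  imports Defs
begin

text \<open>
  All conditions are compared with involutivity: brackets of horizontal fields are horizontal.

  For horizontal \<open>X\<close> and \<open>Y\<close> the field \<open>JY\<close> is vertical, so that both \<open>(\<nabla>\<pi>\<^sub>*)(X,JY)\<close> and
  \<open>\<pi>\<^sub>*(\<A>\<^sub>X JY)\<close> are, up to sign, the image of \<open>\<nabla>\<^sub>X JY\<close> under the differential
  (\<open>second_fundamental_form_JF\<close>, \<open>d\<pi>_oneill_A\<close>). The two displayed identities are therefore the same
  statement about \<open>\<nabla>\<^sub>X JY - \<nabla>\<^sub>Y JX\<close>. This vector field is \<open>(\<nabla>\<^sub>X J)Y - (\<nabla>\<^sub>Y J)X + J[X,Y]\<close>. On a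
  locally conformal Kaehler manifold \<open>\<nabla>J\<close> is determined by \<open>d\<Omega> = \<omega> \<and> \<Omega>\<close> and the vanishing of the
  Nijenhuis tensor (\<open>nabla_J\<close>), and if \<open>B\<^sub>1\<close> is vertical then \<open>\<pi>\<^sub>*\<close> maps \<open>(\<nabla>\<^sub>X J)Y - (\<nabla>\<^sub>Y J)X\<close> to
  the right-hand side of the identity for \<open>\<A>\<close>. Hence both identities hold iff \<open>J[X,Y]\<close> is vertical,
  that is, iff \<open>[X,Y]\<close> is horizontal (\<open>bracket_horizontal_iff\<close>).

  It remains to prove the Frobenius theorem, that the horizontal distribution is integrable iff it
  is involutive (\<open>integrable_iff_involutive\<close>). One direction differentiates vector fields along a
  slice. For the other one, \<open>J\<close> helps: in a holomorphic chart the horizontal distribution is the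
  kernel of a smooth family of linear maps obtained from the differential of \<open>\<pi>\<close> and a constant
  matrix. Such a kernel has a smooth frame \<open>F\<close> projecting to a constant one (\<open>kernel_frame\<close>).
  Involutivity makes the frame commute, and a commuting frame is integrated by solving one ordinary
  differential equation along each ray (\<open>frobenius\<close>).

  Since tangent vectors are derivations and brackets are taken of globally defined fields, this
  analysis is tied to the manifold by two facts: a tangent vector acts as the directional derivative
  along its coordinate vector (\<open>tangent_vector_eq_dder\<close>), and a field given in a chart can be cut
  off to a global one (\<open>vector_field_cutoff_field\<close>).
\<close>

section \<open>Calculus of smooth maps between Euclidean spaces\<close>

abbreviation dder :: "('a::real_normed_vector \<Rightarrow> 'b::real_normed_vector) \<Rightarrow> 'a \<Rightarrow> 'a \<Rightarrow> 'b" where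
  "dder f x \<equiv> frechet_derivative f (at x)"

lemma dder_unique: "(f has_derivative f') (at x) \<Longrightarrow> dder f x v = f' v"
  using frechet_derivative_at by metis

lemma Ck_on_cong:
  assumes "open S" "\<And>x. x \<in> S \<Longrightarrow> f x = g x"
  shows "Ck_on k S f \<longleftrightarrow> Ck_on k S g"
proof -
  have "Ck_on k S g" if "Ck_on k S f" "\<And>x. x \<in> S \<Longrightarrow> f x = g x" for f g :: "'a \<Rightarrow> 'b"
    using that
  proof (induction k arbitrary: f g)
    case 0
    then show ?case by (simp add: continuous_on_eq)
  next
    case (Suc k)
    have der: "dder f x v = dder g x v" if "x \<in> S" for x v
      using frechet_derivative_transform_within_open[of f x S g] Suc.prems that \<open>open S\<close> by simp
    show ?case
      unfolding Ck_on.simps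
    proof safe
      fix x assume x: "x \<in> S"
      with Suc.prems have "(f has_derivative dder f x) (at x)"
        by (simp add: frechet_derivative_works)
      with has_derivative_transform_within_open[OF this \<open>open S\<close> x] Suc.prems(2)
      show "g differentiable at x" unfolding differentiable_def by blast
    next
      fix v
      show "Ck_on k S (\<lambda>x. dder g x v)"
        by (rule Suc.IH[of "\<lambda>x. dder f x v"]) (use Suc.prems der in auto)
    qed
  qed
  with assms show ?thesis by (metis (no_types))
qed

lemma Ck_on_eqI:
  "Ck_on k S g \<Longrightarrow> open S \<Longrightarrow> (\<And>x. x \<in> S \<Longrightarrow> f x = g x) \<Longrightarrow> Ck_on k S f"
  using Ck_on_cong[of S f g] by simp

lemma Ck_on_subset: "Ck_on k S f \<Longrightarrow> T \<subseteq> S \<Longrightarrow> Ck_on k T f"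
  by (induction k arbitrary: f) (auto intro: continuous_on_subset)

lemma Ck_on_local:
  assumes "\<And>x. x \<in> S \<Longrightarrow> \<exists>T. open T \<and> x \<in> T \<and> Ck_on k T f"
  shows "Ck_on k S f"
  using assms
proof (induction k arbitrary: f)
  case 0
  show ?case
    by (simp, rule continuous_at_imp_continuous_on)
      (metis 0 Ck_on.simps(1) continuous_on_eq_continuous_at)
next
  case (Suc k)
  show ?case unfolding Ck_on.simps
  proof safe
    fix x assume "x \<in> S"
    then show "f differentiable at x" using Suc.prems by auto
  next
    fix v
    show "Ck_on k S (\<lambda>x. dder f x v)"
      by (rule Suc.IH) (use Suc.prems in fastforce)
  qed
qed

lemma Ck_on_imp_continuous: "Ck_on k S f \<Longrightarrow> continuous_on S f"
  by (cases k) (auto intro: continuous_at_imp_continuous_on differentiable_imp_continuous_within)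

lemma Ck_on_Suc_imp: "Ck_on (Suc k) S f \<Longrightarrow> Ck_on k S f"
proof (induction k arbitrary: f)
  case 0
  then show ?case using Ck_on_imp_continuous[of "Suc 0"] by simp
next
  case (Suc k)
  then show ?case by (metis Ck_on.simps(2))
qed

lemma Ck_on_const [simp]: "Ck_on k S (\<lambda>x. c)"
  by (induction k arbitrary: c) auto

lemma Ck_on_add:
  "Ck_on k S f \<Longrightarrow> Ck_on k S g \<Longrightarrow> open S \<Longrightarrow> Ck_on k S (\<lambda>x. f x + g x)"
proof (induction k arbitrary: f g)
  case 0
  then show ?case by (auto intro: continuous_intros)
next
  case (Suc k)
  have d: "((\<lambda>x. f x + g x) has_derivative (\<lambda>v. dder f x v + dder g x v)) (at x)" if "x \<in> S" for x
    using Suc.prems that by (auto intro!: has_derivative_add simp: frechet_derivative_works[symmetric])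
  have "Ck_on k S (\<lambda>x. dder (\<lambda>x. f x + g x) x v)" for v
    by (rule Ck_on_eqI[of _ _ "\<lambda>x. dder f x v + dder g x v"])
      (use Suc.prems dder_unique[OF d] in \<open>auto intro: Suc.IH\<close>)
  with d show ?case by (auto simp: differentiable_def)
qed

lemma Ck_on_linear:
  assumes L: "bounded_linear L" and "Ck_on k S f" "open S"
  shows "Ck_on k S (\<lambda>x. L (f x))"
  using assms(2)
proof (induction k arbitrary: f)
  case 0
  then show ?case by (auto intro: bounded_linear.continuous_on[OF L])
next
  case (Suc k)
  have d: "((\<lambda>x. L (f x)) has_derivative (\<lambda>v. L (dder f x v))) (at x)" if "x \<in> S" for x
    using Suc.prems that by (auto intro!: bounded_linear.has_derivative[OF L] simp: frechet_derivative_works[symmetric])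
  then have "dder (\<lambda>x. L (f x)) x v = L (dder f x v)" if "x \<in> S" for x v
    using dder_unique[OF d[OF that]] by simp
  then have "Ck_on k S (\<lambda>x. dder (\<lambda>x. L (f x)) x v)" for v
    using Suc.IH[of "\<lambda>x. dder f x v"] Suc.prems
    by (subst Ck_on_cong[OF \<open>open S\<close>, of _ "\<lambda>x. L (dder f x v)"]) auto
  with d show ?case by (auto simp: differentiable_def)
qed

lemma Ck_on_bilinear:
  assumes B: "bounded_bilinear B" and "Ck_on k S f" "Ck_on k S g" "open S"
  shows "Ck_on k S (\<lambda>x. B (f x) (g x))"
  using assms(2,3)
proof (induction k arbitrary: f g)
  case 0
  then show ?case by (auto intro: bounded_bilinear.continuous_on[OF B])
next
  case (Suc k)
  have d: "((\<lambda>x. B (f x) (g x)) has_derivative (\<lambda>v. B (f x) (dder g x v) + B (dder f x v) (g x))) (at x)"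
    if "x \<in> S" for x
    using Suc.prems that
    by (auto intro!: bounded_bilinear.FDERIV[OF B] simp: frechet_derivative_works[symmetric])
  have "Ck_on k S f" "Ck_on k S g" using Suc.prems[THEN Ck_on_Suc_imp] by auto
  then have "Ck_on k S (\<lambda>x. B (f x) (dder g x v) + B (dder f x v) (g x))" for v
    using Suc.prems by (intro Ck_on_add Suc.IH \<open>open S\<close>) auto
  then have "Ck_on k S (\<lambda>x. dder (\<lambda>x. B (f x) (g x)) x v)" for v
    by (rule Ck_on_eqI[OF _ \<open>open S\<close>]) (rule dder_unique[OF d])
  with d show ?case by (auto simp: differentiable_def)
qed

lemma Ck_on_sum:
  assumes "open S" "\<And>i. i \<in> I \<Longrightarrow> Ck_on k S (f i)"
  shows "Ck_on k S (\<lambda>x. \<Sum>i\<in>I. f i x)"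
  using assms(2) by (induction I rule: infinite_finite_induct) (auto intro!: Ck_on_add \<open>open S\<close>)

lemma dder_linear:
  assumes "f differentiable at x"
  shows "linear (dder f x)" "bounded_linear (dder f x)"
  using linear_frechet_derivative[OF assms] has_derivative_bounded_linear assms
  by (auto simp: frechet_derivative_works)

lemma linear_eq_sum_Basis:
  fixes L :: "'a::euclidean_space \<Rightarrow> 'b::real_vector"
  assumes "linear L"
  shows "L v = (\<Sum>b\<in>Basis. (v \<bullet> b) *\<^sub>R L b)"
  by (subst euclidean_representation[symmetric, of v])
    (simp add: linear_sum[OF assms] linear_cmul[OF assms])

text \<open>Differentiation turns the composition into a sum of products of derivatives of \<open>g\<close> with
  compositions of derivatives of \<open>f\<close>, which are one degree less smooth; so the induction on the
  degree needs closure under products first.\<close>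

lemma Ck_on_compose:
  fixes f :: "'b::euclidean_space \<Rightarrow> 'c::real_normed_vector" and g :: "'a::euclidean_space \<Rightarrow> 'b"
  assumes "Ck_on k T f" "Ck_on k S g" "g ` S \<subseteq> T" "open S" "open T"
  shows "Ck_on k S (\<lambda>x. f (g x))"
  using assms(1,2)
proof (induction k arbitrary: f)
  case 0
  then show ?case using assms(3) by (auto intro: continuous_on_compose2)
next
  case (Suc k)
  have d: "((\<lambda>x. f (g x)) has_derivative (\<lambda>v. dder f (g x) (dder g x v))) (at x)" if "x \<in> S" for x
    using Suc.prems that assms(3)
    by (intro diff_chain_at[of g _ x f, unfolded o_def])
      (auto simp: frechet_derivative_works[symmetric])
  have e: "dder (\<lambda>x. f (g x)) x v = (\<Sum>b\<in>Basis. (dder g x v \<bullet> b) *\<^sub>R dder f (g x) b)" if "x \<in> S" for x v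
  proof -
    have "linear (dder f (g x))"
      using Suc.prems that assms(3) by (intro dder_linear) auto
    then show ?thesis using dder_unique[OF d[OF that]] linear_eq_sum_Basis by metis
  qed
  have "Ck_on k S g" using Suc.prems Ck_on_Suc_imp by blast
  then have "Ck_on k S (\<lambda>x. dder (\<lambda>x. f (g x)) x v)" for v
    using Suc.prems
    by (intro Ck_on_eqI[OF _ \<open>open S\<close> e] Ck_on_sum Ck_on_bilinear[OF bounded_bilinear_scaleR]
        Ck_on_linear[OF bounded_linear_inner_left] Suc.IH \<open>open S\<close>) auto
  with d show ?case by (auto simp: differentiable_def)
qed

lemma Ck_on_ident [simp]: "Ck_on k S (\<lambda>x. x)"
  by (cases k) (auto intro: continuous_intros)

lemma smooth_onD: "smooth_on S f \<Longrightarrow> Ck_on k S f" by (simp add: smooth_on_def)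

lemma smooth_on_cong:
  "open S \<Longrightarrow> (\<And>x. x \<in> S \<Longrightarrow> f x = g x) \<Longrightarrow> smooth_on S f \<longleftrightarrow> smooth_on S g"
  unfolding smooth_on_def using Ck_on_cong[of S f g] by blast

lemma smooth_on_eqI: "open S \<Longrightarrow> smooth_on S g \<Longrightarrow> (\<And>x. x \<in> S \<Longrightarrow> f x = g x) \<Longrightarrow> smooth_on S f"
  using smooth_on_cong[of S f g] by simp

lemma smooth_on_subset: "smooth_on S f \<Longrightarrow> T \<subseteq> S \<Longrightarrow> smooth_on T f"
  unfolding smooth_on_def using Ck_on_subset by blast

lemma smooth_on_local:
  "(\<And>x. x \<in> S \<Longrightarrow> \<exists>T. open T \<and> x \<in> T \<and> smooth_on T f) \<Longrightarrow> smooth_on S f"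
  unfolding smooth_on_def by (meson Ck_on_local)

lemma smooth_on_imp_continuous: "smooth_on S f \<Longrightarrow> continuous_on S f"
  using Ck_on_imp_continuous smooth_onD by blast

lemma smooth_on_imp_differentiable: "smooth_on S f \<Longrightarrow> x \<in> S \<Longrightarrow> f differentiable at x"
  using smooth_onD[of S f "Suc 0"] by simp

lemma smooth_on_imp_has_derivative:
  "smooth_on S f \<Longrightarrow> x \<in> S \<Longrightarrow> (f has_derivative dder f x) (at x)"
  using smooth_on_imp_differentiable by (auto simp: frechet_derivative_works[symmetric])

lemma smooth_on_dder: "smooth_on S f \<Longrightarrow> smooth_on S (\<lambda>x. dder f x v)"
  unfolding smooth_on_def by (metis Ck_on.simps(2))

lemma smooth_on_const [simp]: "smooth_on S (\<lambda>x. c)" by (simp add: smooth_on_def)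
lemma smooth_on_ident [simp]: "smooth_on S (\<lambda>x. x)" by (simp add: smooth_on_def)

lemma smooth_on_add: "open S \<Longrightarrow> smooth_on S f \<Longrightarrow> smooth_on S g \<Longrightarrow> smooth_on S (\<lambda>x. f x + g x)"
  by (simp add: smooth_on_def Ck_on_add)

lemma smooth_on_linear:
  "bounded_linear L \<Longrightarrow> open S \<Longrightarrow> smooth_on S f \<Longrightarrow> smooth_on S (\<lambda>x. L (f x))"
  by (simp add: smooth_on_def Ck_on_linear)

lemma smooth_on_bilinear:
  "bounded_bilinear B \<Longrightarrow> open S \<Longrightarrow> smooth_on S f \<Longrightarrow> smooth_on S g \<Longrightarrow> smooth_on S (\<lambda>x. B (f x) (g x))"
  by (simp add: smooth_on_def Ck_on_bilinear)

lemmas smooth_on_scaleR = smooth_on_bilinear[OF bounded_bilinear_scaleR]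
lemmas smooth_on_mult = smooth_on_bilinear[OF bounded_bilinear_mult]
lemmas smooth_on_inner_left = smooth_on_linear[OF bounded_linear_inner_left]

lemma smooth_on_minus: "open S \<Longrightarrow> smooth_on S f \<Longrightarrow> smooth_on S (\<lambda>x. - f x)"
  by (rule smooth_on_linear[OF bounded_linear_minus[OF bounded_linear_ident]])

lemma smooth_on_diff: "open S \<Longrightarrow> smooth_on S f \<Longrightarrow> smooth_on S g \<Longrightarrow> smooth_on S (\<lambda>x. f x - g x)"
  using smooth_on_add[of S f "\<lambda>x. - g x"] smooth_on_minus by auto

lemma smooth_on_sum:
  "open S \<Longrightarrow> (\<And>i. i \<in> I \<Longrightarrow> smooth_on S (f i)) \<Longrightarrow> smooth_on S (\<lambda>x. \<Sum>i\<in>I. f i x)"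
  by (simp add: smooth_on_def Ck_on_sum)

lemma smooth_on_compose:
  "smooth_on T f \<Longrightarrow> smooth_on S g \<Longrightarrow> g ` S \<subseteq> T \<Longrightarrow> open S \<Longrightarrow> open T \<Longrightarrow> smooth_on S (\<lambda>x. f (g x))"
  unfolding smooth_on_def using Ck_on_compose by blast

lemma smooth_on_components:
  fixes f :: "'a::euclidean_space \<Rightarrow> 'b::euclidean_space"
  assumes "open S" "\<And>b. b \<in> Basis \<Longrightarrow> smooth_on S (\<lambda>x. f x \<bullet> b)"
  shows "smooth_on S f"
proof -
  have "smooth_on S (\<lambda>x. \<Sum>b\<in>Basis. (f x \<bullet> b) *\<^sub>R b)"
    by (intro smooth_on_sum smooth_on_scaleR assms) auto
  then show ?thesis by (simp add: euclidean_representation)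
qed

section \<open>Bump functions and the Hadamard lemma\<close>

text \<open>The family \<open>exp (-1/t) / t ^ n\<close>, extended by 0 to \<open>t \<le> 0\<close>. Its linear span is closed under
  differentiation, so that one induction proves smoothness of all members at once.\<close>

definition flat_exp :: "nat \<Rightarrow> real \<Rightarrow> real" where
  "flat_exp n t = (if t > 0 then exp (- 1 / t) / t ^ n else 0)"

lemma flat_exp_tendsto_0: "(flat_exp n \<longlongrightarrow> 0) (at 0)"
proof -
  have "((\<lambda>t. inverse t ^ n / exp (inverse t)) \<longlongrightarrow> (0::real)) (at_right 0)"
    by (rule filterlim_compose[OF tendsto_power_div_exp_0 filterlim_inverse_at_top_right])
  moreover have "\<forall>\<^sub>F t in at_right 0. inverse t ^ n / exp (inverse t) = flat_exp n t"
    unfolding eventually_at_filter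
    by (rule always_eventually) (auto simp: flat_exp_def exp_minus field_simps)
  ultimately have 1: "(flat_exp n \<longlongrightarrow> 0) (at_right 0)" by (rule Lim_transform_eventually)
  have "\<forall>\<^sub>F t in at_left 0. 0 = flat_exp n t"
    unfolding eventually_at_filter by (rule always_eventually) (auto simp: flat_exp_def)
  then have 2: "(flat_exp n \<longlongrightarrow> 0) (at_left 0)" by (rule Lim_transform_eventually[OF tendsto_const])
  show ?thesis using filterlim_at_split 1 2 by blast
qed

lemma flat_exp_has_derivative:
  "(flat_exp n has_field_derivative (flat_exp (n + 2) t - real n * flat_exp (n + 1) t)) (at t)"
proof -
  consider "t > 0" | "t < 0" | "t = 0" by linarith
  then show ?thesis
  proof cases
    case 1
    have "((\<lambda>t. exp (- 1 / t) / t ^ n) has_field_derivative (flat_exp (n + 2) t - real n * flat_exp (n + 1) t)) (at t)"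
      using 1
      by (auto intro!: derivative_eq_intros simp: flat_exp_def field_simps power2_eq_square power_add)
        (cases n; simp add: field_simps)
    then show ?thesis
      by (rule has_field_derivative_transform_within_open[of _ _ _ "{0<..}"]) (use 1 in \<open>auto simp: flat_exp_def\<close>)
  next
    case 2
    have "((\<lambda>t. 0) has_field_derivative (flat_exp (n + 2) t - real n * flat_exp (n + 1) t)) (at t)"
      using 2 by (auto simp: flat_exp_def)
    then show ?thesis
      by (rule has_field_derivative_transform_within_open[of _ _ _ "{..<0}"]) (use 2 in \<open>auto simp: flat_exp_def\<close>)
  next
    case 3
    have "((\<lambda>h. flat_exp n h / h) \<longlongrightarrow> 0) (at 0)"
      by (rule Lim_transform_eventually[OF flat_exp_tendsto_0[of "Suc n"]])
        (auto simp: flat_exp_def eventually_at_filter intro!: always_eventually)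
    then show ?thesis by (simp add: DERIV_def 3 flat_exp_def)
  qed
qed

lemma smooth_on_flat_exp: "smooth_on S (flat_exp n)"
proof -
  have "Ck_on k UNIV (flat_exp n)" for k
  proof (induction k arbitrary: n)
    case 0
    then show ?case
      by (auto intro!: continuous_at_imp_continuous_on DERIV_isCont flat_exp_has_derivative)
  next
    case (Suc k)
    have d: "(flat_exp n has_derivative (\<lambda>v. (flat_exp (n + 2) t - real n * flat_exp (n + 1) t) * v)) (at t)" for n t
      using flat_exp_has_derivative by (simp add: has_field_derivative_def)
    have "Ck_on k UNIV (\<lambda>t. (flat_exp (n + 2) t + (- real n) * flat_exp (n + 1) t) * v)" for v
      by (intro Ck_on_bilinear[OF bounded_bilinear_mult] Ck_on_add Suc.IH Ck_on_const) auto
    then show ?case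
      using d by (auto simp: differentiable_def dder_unique[OF d])
  qed
  then show ?thesis unfolding smooth_on_def using Ck_on_subset by blast
qed

lemma bump_function:
  fixes x0 :: "'e::euclidean_space"
  assumes "r > 0"
  obtains b :: "'e \<Rightarrow> real" where "smooth_on UNIV b" "\<And>x. x \<in> ball x0 r \<Longrightarrow> b x > 0"
    "\<And>x. x \<notin> ball x0 r \<Longrightarrow> b x = 0"
proof
  let ?b = "\<lambda>x. flat_exp 0 (r\<^sup>2 + (- ((x - x0) \<bullet> (x - x0))))"
  show "smooth_on UNIV ?b"
    by (rule smooth_on_compose[OF smooth_on_flat_exp[of UNIV]])
      (auto intro!: smooth_on_add smooth_on_minus smooth_on_diff smooth_on_bilinear[OF bounded_bilinear_inner])
  have *: "(x - x0) \<bullet> (x - x0) = (dist x0 x)\<^sup>2" for x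
    by (simp add: dist_norm dot_square_norm norm_minus_commute)
  show "?b x > 0" if "x \<in> ball x0 r" for x
    using that \<open>r > 0\<close> by (auto simp: flat_exp_def * intro!: power_strict_mono)
  show "?b x = 0" if "x \<notin> ball x0 r" for x
  proof -
    have "r\<^sup>2 \<le> (dist x0 x)\<^sup>2" using that \<open>r > 0\<close> by (intro power_mono) auto
    then show ?thesis by (simp add: flat_exp_def *)
  qed
qed

lemma ray_in_ball:
  fixes x0 x :: "'a::real_normed_vector"
  assumes "x \<in> ball x0 r" "t \<in> {0..1}"
  shows "x0 + t *\<^sub>R (x - x0) \<in> ball x0 r"
proof -
  have "\<bar>t\<bar> * norm (x - x0) \<le> 1 * norm (x - x0)" using assms by (intro mult_right_mono) auto
  then show ?thesis using assms by (simp add: dist_norm norm_minus_commute)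
qed

text \<open>Differentiation under the integral sign along a ray produces one more factor \<open>t\<close>. With the factor
  \<open>t ^ n\<close> the statement reproduces itself for the directional derivatives of \<open>G\<close>.\<close>

lemma Ck_on_ray_integral:
  fixes G :: "'e::euclidean_space \<Rightarrow> real"
  assumes "Ck_on k (ball x0 r) G"
  shows "Ck_on k (ball x0 r) (\<lambda>x. integral {0..1} (\<lambda>t. t ^ n * G (x0 + t *\<^sub>R (x - x0))))"
  using assms
proof (induction k arbitrary: n G)
  have ray: "x0 + t *\<^sub>R (x - x0) \<in> ball x0 r" if "x \<in> ball x0 r" "t \<in> {0..1}" for x t
    using that by (rule ray_in_ball)
  have cont: "continuous_on (ball x0 r \<times> cbox 0 1) (\<lambda>(x, t). t ^ n * G (x0 + t *\<^sub>R (x - x0)))"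
    if "continuous_on (ball x0 r) G" for G :: "'e \<Rightarrow> real" and n
    unfolding split_beta
    by (intro continuous_intros continuous_on_compose2[OF that]) (use ray in auto)
  {
    case 0
    then show ?case using integral_continuous_on_param[OF cont[of G n]] by simp
  next
    case (Suc k)
    have diffG: "(G has_derivative dder G y) (at y)" if "y \<in> ball x0 r" for y
      using Suc.prems that by (auto simp: frechet_derivative_works[symmetric])
    define fx where "fx x t = Blinfun (\<lambda>v. t ^ Suc n * dder G (x0 + t *\<^sub>R (x - x0)) v)" for x t
    have fx: "blinfun_apply (fx x t) = (\<lambda>v. t ^ Suc n * dder G (x0 + t *\<^sub>R (x - x0)) v)"
      if "x \<in> ball x0 r" "t \<in> {0..1}" for x t
      unfolding fx_def
      by (rule bounded_linear_Blinfun_apply)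
        (intro bounded_linear_const_mult has_derivative_bounded_linear[OF diffG] ray that)
    have cG: "continuous_on (ball x0 r) (\<lambda>y. dder G y v)" for v
      using Suc.prems Ck_on_imp_continuous[of k _ "\<lambda>y. dder G y v"] by auto
    have d: "((\<lambda>x. integral (cbox 0 1) (\<lambda>t. t ^ n * G (x0 + t *\<^sub>R (x - x0)))) has_derivative
        integral (cbox 0 1) (fx x)) (at x within ball x0 r)" if x: "x \<in> ball x0 r" for x
    proof (rule leibniz_rule)
      show "((\<lambda>x. t ^ n * G (x0 + t *\<^sub>R (x - x0))) has_derivative fx x t) (at x within ball x0 r)"
        if "x \<in> ball x0 r" "t \<in> cbox 0 1" for x t
      proof -
        have t: "t \<in> {0..1}" using that by simp
        have "((\<lambda>x. x0 + t *\<^sub>R (x - x0)) has_derivative (\<lambda>v. t *\<^sub>R v)) (at x)"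
          by (auto intro!: derivative_eq_intros)
        from diff_chain_at[OF this diffG[OF ray[OF that(1) t]]]
        have "((\<lambda>x. t ^ n * G (x0 + t *\<^sub>R (x - x0))) has_derivative
            (\<lambda>v. t ^ n * dder G (x0 + t *\<^sub>R (x - x0)) (t *\<^sub>R v))) (at x)"
          by (auto simp: o_def intro!: derivative_eq_intros)
        moreover have "linear (dder G (x0 + t *\<^sub>R (x - x0)))"
          using diffG[OF ray[OF that(1) t]] has_derivative_linear by blast
        ultimately show ?thesis
          by (auto simp: fx[OF that(1) t] linear_cmul ac_simps intro: has_derivative_at_withinI)
      qed
      show "(\<lambda>t. t ^ n * G (x0 + t *\<^sub>R (x - x0))) integrable_on cbox 0 1" if "x \<in> ball x0 r" for x
      proof (rule integrable_continuous)
        show "continuous_on (cbox 0 1) (\<lambda>t. t ^ n * G (x0 + t *\<^sub>R (x - x0)))"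
          using continuous_on_compose2[OF cont[of G n] continuous_on_Pair[OF continuous_on_const continuous_on_id]]
            Ck_on_imp_continuous[OF Suc.prems] that by force
      qed
      show "continuous_on (ball x0 r \<times> cbox 0 1) (\<lambda>(x, t). fx x t)"
      proof (rule continuous_on_blinfun_componentwise)
        fix b :: 'e
        show "continuous_on (ball x0 r \<times> cbox 0 1) (\<lambda>p. blinfun_apply (case p of (x, t) \<Rightarrow> fx x t) b)"
          by (rule continuous_on_eq[OF cont[OF cG[of b], of "Suc n"]]) (auto simp: fx)
      qed
    qed (use x in auto)
    have int: "fx x integrable_on cbox 0 1" if "x \<in> ball x0 r" for x
    proof (rule integrable_continuous, rule continuous_on_blinfun_componentwise)
      fix b :: 'e
      have "continuous_on (cbox 0 1) (\<lambda>t. t ^ Suc n * dder G (x0 + t *\<^sub>R (x - x0)) b)"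
        using continuous_on_compose2[OF cont[OF cG[of b], of "Suc n"]
            continuous_on_Pair[OF continuous_on_const continuous_on_id]] that by force
      then show "continuous_on (cbox 0 1) (\<lambda>t. blinfun_apply (fx x t) b)"
        by (rule continuous_on_eq) (use that in \<open>auto simp: fx\<close>)
    qed
    have d2: "((\<lambda>x. integral {0..1} (\<lambda>t. t ^ n * G (x0 + t *\<^sub>R (x - x0)))) has_derivative
        (\<lambda>v. integral {0..1} (\<lambda>t. t ^ Suc n * dder G (x0 + t *\<^sub>R (x - x0)) v))) (at x)"
      if x: "x \<in> ball x0 r" for x
    proof -
      have "blinfun_apply (integral (cbox 0 1) (fx x)) v =
          integral {0..1} (\<lambda>t. t ^ Suc n * dder G (x0 + t *\<^sub>R (x - x0)) v)" for v
        by (subst blinfun_apply_integral[OF int[OF x]]) (auto intro!: integral_cong simp: fx[OF x])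
      then have "blinfun_apply (integral (cbox 0 1) (fx x)) =
          (\<lambda>v. integral {0..1} (\<lambda>t. t ^ Suc n * dder G (x0 + t *\<^sub>R (x - x0)) v))"
        by blast
      from d[OF x, unfolded this, unfolded at_within_open[OF x open_ball] cbox_interval] show ?thesis .
    qed
    have "Ck_on k (ball x0 r) (\<lambda>x. integral {0..1} (\<lambda>t. t ^ Suc n * dder G (x0 + t *\<^sub>R (x - x0)) v))" for v
      by (rule Suc.IH) (use Suc.prems in simp)
    then have "Ck_on k (ball x0 r) (\<lambda>x. dder (\<lambda>x. integral {0..1} (\<lambda>t. t ^ n * G (x0 + t *\<^sub>R (x - x0)))) x v)" for v
      by (rule Ck_on_eqI[OF _ open_ball]) (rule dder_unique[OF d2])
    moreover have "(\<lambda>x. integral {0..1} (\<lambda>t. t ^ n * G (x0 + t *\<^sub>R (x - x0)))) differentiable (at x)"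
      if "x \<in> ball x0 r" for x
      using d2[OF that] unfolding differentiable_def by blast
    ultimately show ?case by simp
  }
qed

text \<open>Integrate the derivative of \<open>f\<close> along the ray from \<open>x0\<close> to \<open>x\<close>. This is what makes a derivation on
  germs depend on the first derivatives only.\<close>

lemma hadamard_lemma:
  fixes f :: "'e::euclidean_space \<Rightarrow> real"
  assumes "smooth_on (ball x0 r) f"
  obtains k where "\<And>b. smooth_on (ball x0 r) (k b)"
    "\<And>x. x \<in> ball x0 r \<Longrightarrow> f x = f x0 + (\<Sum>b\<in>Basis. ((x - x0) \<bullet> b) * k b x)"
proof
  let ?k = "\<lambda>b x. integral {0..1} (\<lambda>t. t ^ 0 * dder f (x0 + t *\<^sub>R (x - x0)) b)"
  show "smooth_on (ball x0 r) (?k b)" for b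
    using smooth_on_dder[OF assms] unfolding smooth_on_def by (intro allI Ck_on_ray_integral) simp
  fix x assume x: "x \<in> ball x0 r"
  note ray = ray_in_ball[OF x]
  have "((\<lambda>t. f (x0 + t *\<^sub>R (x - x0))) has_vector_derivative dder f (x0 + t *\<^sub>R (x - x0)) (x - x0)) (at t within {0..1})"
    if "t \<in> {0..1}" for t
  proof -
    have "((\<lambda>t. x0 + t *\<^sub>R (x - x0)) has_derivative (\<lambda>s. s *\<^sub>R (x - x0))) (at t)"
      by (auto intro!: derivative_eq_intros)
    from diff_chain_at[OF this smooth_on_imp_has_derivative[OF assms ray[OF that]]]
    show ?thesis
      using dder_linear(1)[OF smooth_on_imp_differentiable[OF assms ray[OF that]]]
      by (auto simp: has_vector_derivative_def o_def linear_cmul intro: has_derivative_at_withinI)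
  qed
  from fundamental_theorem_of_calculus[OF _ this]
  have I: "((\<lambda>t. dder f (x0 + t *\<^sub>R (x - x0)) (x - x0)) has_integral f x - f x0) {0..1}"
    by simp
  have cont: "continuous_on {0..1} (\<lambda>t. dder f (x0 + t *\<^sub>R (x - x0)) b)" for b
    by (rule continuous_on_compose2[OF smooth_on_imp_continuous[OF smooth_on_dder[OF assms]]])
      (use ray in \<open>auto intro!: continuous_intros\<close>)
  have "f x - f x0 = integral {0..1} (\<lambda>t. dder f (x0 + t *\<^sub>R (x - x0)) (x - x0))"
    using I by (simp add: integral_unique)
  also have "\<dots> = integral {0..1} (\<lambda>t. \<Sum>b\<in>Basis. ((x - x0) \<bullet> b) * dder f (x0 + t *\<^sub>R (x - x0)) b)"
    using linear_eq_sum_Basis[OF dder_linear(1)[OF smooth_on_imp_differentiable[OF assms ray]], of _ "x - x0"]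
    by (intro integral_cong) auto
  also have "\<dots> = (\<Sum>b\<in>Basis. ((x - x0) \<bullet> b) * ?k b x)"
    by (subst integral_sum) (auto intro!: integrable_continuous_real continuous_intros cont)
  finally show "f x = f x0 + (\<Sum>b\<in>Basis. ((x - x0) \<bullet> b) * ?k b x)" by simp
qed

section \<open>Smooth dependence of the solution of a linear system\<close>

lemma has_derivativeI_norm:
  assumes "bounded_linear f'"
    "\<And>e. e > 0 \<Longrightarrow> \<exists>d>0. \<forall>y. norm (y - x) < d \<longrightarrow> norm (f y - f x - f' (y - x)) \<le> e * norm (y - x)"
  shows "(f has_derivative f') (at x)"
  using assms by (simp add: has_derivative_at_alt)

text \<open>The derivative \<open>w\<close> of \<open>u\<close> is forced by differentiating \<open>A x (u x) = b x\<close>. The defect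
  \<open>A y (u y - u x - w (y - x))\<close> is an explicit function \<open>H\<close> of \<open>y\<close> whose derivative at \<open>x\<close> vanishes,
  and the constant \<open>K\<close> turns this into an estimate of \<open>u y - u x - w (y - x)\<close>.\<close>

lemma solution_differentiable:
  fixes A :: "'a::euclidean_space \<Rightarrow> 'b::euclidean_space \<Rightarrow> 'b"
  assumes S: "open S" "x \<in> S" and lin: "\<And>x. x \<in> S \<Longrightarrow> linear (A x)"
    and A: "\<And>v. (\<lambda>y. A y v) differentiable (at x)"
    and K: "K > 0" "\<And>x v. x \<in> S \<Longrightarrow> norm v \<le> K * norm (A x v)"
    and b: "b differentiable (at x)" and u: "\<And>x. x \<in> S \<Longrightarrow> A x (u x) = b x"
  shows "u differentiable (at x)"
    "A x (dder u x h) = dder b x h - (\<Sum>c\<in>Basis. (u x \<bullet> c) *\<^sub>R dder (\<lambda>y. A y c) x h)"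
proof -
  define rhs where "rhs h = dder b x h - (\<Sum>c\<in>Basis. (u x \<bullet> c) *\<^sub>R dder (\<lambda>y. A y c) x h)" for h
  have lA: "linear (A x)" using S lin by blast
  have inj: "inj (A x)"
    unfolding linear_injective_0[OF lA]
  proof (intro allI impI)
    fix v assume "A x v = 0"
    with K(2)[OF \<open>x \<in> S\<close>, of v] show "v = 0" by simp
  qed
  then have surj: "surj (A x)" using linear_injective_imp_surjective[OF lA] by blast
  define w where "w h = inv (A x) (rhs h)" for h
  have Aw: "A x (w h) = rhs h" for h unfolding w_def using surj by (simp add: surj_f_inv_f)
  have lr: "linear rhs"
    unfolding rhs_def using dder_linear(1)[OF b] dder_linear(1)[OF A]
    by (intro linear_compose_sub linear_compose_sum ballI linear_compose_scale_right) auto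
  have lw: "linear w"
  proof
    show "w (h + k) = w h + w k" for h k
      by (rule injD[OF inj]) (simp add: Aw linear_add[OF lA] linear_add[OF lr])
    show "w (c *\<^sub>R h) = c *\<^sub>R w h" for c h
      by (rule injD[OF inj]) (simp add: Aw linear_cmul[OF lA] linear_cmul[OF lr])
  qed
  note blw = linear_conv_bounded_linear[THEN iffD1, OF lw]
  define H where "H y = b y - (\<Sum>c\<in>Basis. ((u x + w (y - x)) \<bullet> c) *\<^sub>R A y c)" for y
  have Ae: "A y v = (\<Sum>c\<in>Basis. (v \<bullet> c) *\<^sub>R A y c)" if "y \<in> S" for y v
    by (rule linear_eq_sum_Basis[OF lin[OF that]])
  have H: "H y = A y (u y - u x - w (y - x))" if "y \<in> S" for y
    unfolding H_def Ae[OF that, symmetric] using u[OF that] lin[OF that]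
    by (simp add: linear_diff linear_add)
  have w0: "w 0 = 0" using lw by (rule linear_0)
  have "(H has_derivative (\<lambda>h. dder b x h -
      (\<Sum>c\<in>Basis. (u x \<bullet> c) *\<^sub>R dder (\<lambda>y. A y c) x h + (w h \<bullet> c) *\<^sub>R A x c))) (at x)"
  proof -
    have "((\<lambda>y. w (y - x)) has_derivative w) (at x)"
      by (rule bounded_linear.has_derivative[OF blw]) (auto intro!: derivative_eq_intros)
    then have "((\<lambda>y. ((u x + w (y - x)) \<bullet> c) *\<^sub>R A y c) has_derivative
        (\<lambda>h. (u x \<bullet> c) *\<^sub>R dder (\<lambda>y. A y c) x h + (w h \<bullet> c) *\<^sub>R A x c)) (at x)" for c
      using A[of c] by (auto intro!: derivative_eq_intros simp: frechet_derivative_works w0)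
    then show ?thesis
      unfolding H_def using b by (auto intro!: derivative_intros simp: frechet_derivative_works)
  qed
  also have "(\<lambda>h. dder b x h - (\<Sum>c\<in>Basis. (u x \<bullet> c) *\<^sub>R dder (\<lambda>y. A y c) x h + (w h \<bullet> c) *\<^sub>R A x c))
      = (\<lambda>h. 0)"
  proof
    fix h
    have "(\<Sum>c\<in>Basis. (w h \<bullet> c) *\<^sub>R A x c) = rhs h" using Ae[OF \<open>x \<in> S\<close>] Aw by metis
    then show "dder b x h - (\<Sum>c\<in>Basis. (u x \<bullet> c) *\<^sub>R dder (\<lambda>y. A y c) x h + (w h \<bullet> c) *\<^sub>R A x c) = 0"
      by (simp add: sum.distrib rhs_def)
  qed
  finally have dH: "(H has_derivative (\<lambda>h. 0)) (at x)" .
  have H0: "H x = 0" using H[OF \<open>x \<in> S\<close>] lA by (simp add: w0 linear_0)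
  have "(u has_derivative w) (at x)"
  proof (rule has_derivativeI_norm[OF blw])
    fix e :: real assume "e > 0"
    with dH K(1) obtain d1 where d1: "d1 > 0" "\<And>y. norm (y - x) < d1 \<Longrightarrow> norm (H y) \<le> e / K * norm (y - x)"
      unfolding has_derivative_at_alt using H0 by (metis divide_pos_pos diff_zero)
    obtain d2 where d2: "d2 > 0" "ball x d2 \<subseteq> S" using S open_contains_ball by blast
    have "norm (u y - u x - w (y - x)) \<le> e * norm (y - x)" if "norm (y - x) < min d1 d2" for y
    proof -
      have y: "y \<in> S" using that d2 by (auto simp: dist_norm norm_minus_commute)
      have "norm (u y - u x - w (y - x)) \<le> K * norm (H y)" using K(2)[OF y] H[OF y] by simp
      also have "\<dots> \<le> K * (e / K * norm (y - x))" using d1(2)[of y] that K(1) by (intro mult_left_mono) auto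
      finally show ?thesis using K(1) by simp
    qed
    then show "\<exists>d>0. \<forall>y. norm (y - x) < d \<longrightarrow> norm (u y - u x - w (y - x)) \<le> e * norm (y - x)"
      using d1(1) d2(1) by (intro exI[of _ "min d1 d2"]) auto
  qed
  then show "u differentiable (at x)"
    "A x (dder u x h) = dder b x h - (\<Sum>c\<in>Basis. (u x \<bullet> c) *\<^sub>R dder (\<lambda>y. A y c) x h)"
    using Aw by (auto simp: differentiable_def dder_unique rhs_def)
qed

text \<open>By the formula for its derivative, \<open>dder u x h\<close> solves a system with the same operator and a
  right-hand side built from \<open>b\<close>, \<open>A\<close> and \<open>u\<close>. So each degree of smoothness of \<open>u\<close> gives the next
  one.\<close>

lemma smooth_on_solution:
  fixes A :: "'a::euclidean_space \<Rightarrow> 'b::euclidean_space \<Rightarrow> 'b"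
  assumes S: "open S" and lin: "\<And>x. x \<in> S \<Longrightarrow> linear (A x)"
    and A: "\<And>v. smooth_on S (\<lambda>y. A y v)"
    and K: "K > 0" "\<And>x v. x \<in> S \<Longrightarrow> norm v \<le> K * norm (A x v)"
    and b: "smooth_on S b" and u: "\<And>x. x \<in> S \<Longrightarrow> A x (u x) = b x"
  shows "smooth_on S u"
proof -
  have "Ck_on k S u" if "Ck_on k S b" "\<And>x. x \<in> S \<Longrightarrow> A x (u x) = b x" for k b u
    using that
  proof (induction k arbitrary: b u)
    case 0
    have "isCont u x" if "x \<in> S" for x
    proof -
      have "isCont b x" "isCont (\<lambda>y. A y (u x)) x"
        using S that 0 smooth_on_imp_continuous[OF A]
        by (simp_all add: continuous_on_eq_continuous_at)
      then have "(\<lambda>y. b y - A y (u x)) \<midarrow>x\<rightarrow> b x - A x (u x)"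
        by (auto simp: isCont_def intro: tendsto_diff)
      then have "((\<lambda>y. K * norm (b y - A y (u x))) \<longlongrightarrow> K * norm (b x - A x (u x))) (at x)"
        by (intro tendsto_mult tendsto_norm tendsto_const)
      then have lim: "((\<lambda>y. K * norm (b y - A y (u x))) \<longlongrightarrow> 0) (at x)"
        using 0(2)[OF that] by simp
      have "\<forall>\<^sub>F y in at x. norm (u y - u x) \<le> K * norm (b y - A y (u x))"
        using eventually_at_in_open'[OF S that]
      proof eventually_elim
        case (elim y)
        have "A y (u y - u x) = b y - A y (u x)"
          using 0(2)[OF elim] lin[OF elim] by (simp add: linear_diff)
        then show ?case using K(2)[OF elim, of "u y - u x"] by simp
      qed
      from Lim_null_comparison[OF this lim] show ?thesis using LIM_zero_cancel isCont_def by blast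
    qed
    then show ?case by (auto intro: continuous_at_imp_continuous_on)
  next
    case (Suc k)
    note sd = solution_differentiable[of S _ A K b u, OF S _ lin smooth_on_imp_differentiable[OF A] K]
    have d: "u differentiable (at x)"
      and e: "A x (dder u x h) = dder b x h - (\<Sum>c\<in>Basis. (u x \<bullet> c) *\<^sub>R dder (\<lambda>y. A y c) x h)"
      if "x \<in> S" for x h
      using sd[of x] that Suc.prems by auto
    have "Ck_on k S u" using Suc.IH[of b u] Suc.prems Ck_on_Suc_imp by blast
    then have "Ck_on k S (\<lambda>x. dder b x h + (\<Sum>c\<in>Basis. ((- (u x)) \<bullet> c) *\<^sub>R dder (\<lambda>y. A y c) x h))" for h
      using Suc.prems(1)
      by (intro Ck_on_add Ck_on_sum Ck_on_bilinear[OF bounded_bilinear_scaleR]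
          smooth_onD[OF smooth_on_dder[OF A]] Ck_on_linear[OF bounded_linear_inner_left]
          Ck_on_linear[OF bounded_linear_minus[OF bounded_linear_ident]] S) auto
    then have "Ck_on k S (\<lambda>x. dder u x h)" for h
      by (rule Suc.IH) (simp add: e sum_negf)
    with d show ?case by auto
  qed
  with b u show ?thesis unfolding smooth_on_def by blast
qed

section \<open>Frobenius theorem for commuting frames\<close>

text \<open>All bounds come from compactness of the ball, applied to \<open>f\<close> and to its first and second
  derivatives.\<close>

lemma second_order_bounds:
  fixes f :: "'a::euclidean_space \<Rightarrow> 'b::euclidean_space"
  assumes f: "smooth_on S f" and S: "cball x0 R \<subseteq> S"
  obtains C where "C > 0"
    "\<And>x. x \<in> cball x0 R \<Longrightarrow> norm (f x) \<le> C"
    "\<And>x v. x \<in> cball x0 R \<Longrightarrow> norm (dder f x v) \<le> C * norm v"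
    "\<And>x y. x \<in> cball x0 R \<Longrightarrow> y \<in> cball x0 R \<Longrightarrow> norm (f y - f x) \<le> C * norm (y - x)"
    "\<And>x y. x \<in> cball x0 R \<Longrightarrow> y \<in> cball x0 R \<Longrightarrow> norm (f y - f x - dder f x (y - x)) \<le> C * (norm (y - x))\<^sup>2"
proof -
  have bdd: "\<exists>C. C \<ge> 0 \<and> (\<forall>x\<in>cball x0 R. norm (f x) \<le> C)" if "smooth_on S f" for f :: "'a \<Rightarrow> 'b"
  proof -
    have "compact (f ` cball x0 R)"
      using smooth_on_imp_continuous[OF that] S by (intro compact_continuous_image) (auto intro: continuous_on_subset)
    then obtain B where "\<forall>y\<in>f ` cball x0 R. norm y \<le> B" using compact_imp_bounded bounded_iff by blast
    then show ?thesis by (intro exI[of _ "\<bar>B\<bar>"]) force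
  qed
  have der: "\<exists>C. C \<ge> 0 \<and> (\<forall>x\<in>cball x0 R. \<forall>v. norm (dder f x v) \<le> C * norm v)" if f: "smooth_on S f" for f :: "'a \<Rightarrow> 'b"
  proof -
    obtain B where B: "\<And>b. B b \<ge> 0" "\<And>b x. x \<in> cball x0 R \<Longrightarrow> norm (dder f x b) \<le> B b"
      using bdd[OF smooth_on_dder[OF f]] by metis
    have "norm (dder f x v) \<le> (\<Sum>b\<in>Basis. B b) * norm v" if "x \<in> cball x0 R" for x v
    proof -
      have "linear (dder f x)"
        using that S f by (intro dder_linear smooth_on_imp_differentiable) auto
      then have "norm (dder f x v) = norm (\<Sum>b\<in>Basis. (v \<bullet> b) *\<^sub>R dder f x b)"
        using linear_eq_sum_Basis by metis
      also have "\<dots> \<le> (\<Sum>b\<in>Basis. norm v * B b)"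
        by (rule sum_norm_le) (use B that Basis_le_norm in \<open>auto intro!: mult_mono\<close>)
      finally show ?thesis by (simp add: sum_distrib_left mult.commute)
    qed
    then show ?thesis using B(1) by (intro exI[of _ "\<Sum>b\<in>Basis. B b"]) (auto intro: sum_nonneg)
  qed
  have lip: "\<exists>C. C \<ge> 0 \<and> (\<forall>x\<in>cball x0 R. \<forall>y\<in>cball x0 R. norm (f y - f x) \<le> C * norm (y - x))"
    if f: "smooth_on S f" for f :: "'a \<Rightarrow> 'b"
  proof -
    obtain C where C: "C \<ge> 0" "\<And>x v. x \<in> cball x0 R \<Longrightarrow> norm (dder f x v) \<le> C * norm v"
      using der[OF f] by blast
    have "norm (f y - f x) \<le> C * norm (y - x)" if "x \<in> cball x0 R" "y \<in> cball x0 R" for x y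
    proof (rule differentiable_bound[of "cball x0 R" f "\<lambda>x. dder f x"])
      show "(f has_derivative dder f x) (at x within cball x0 R)" if "x \<in> cball x0 R" for x
        using that S by (intro has_derivative_at_withinI[OF smooth_on_imp_has_derivative[OF f]]) auto
      show "onorm (dder f x) \<le> C" if "x \<in> cball x0 R" for x
        by (rule onorm_bound[OF C(1) C(2)[OF that]])
    qed (use that in simp_all)
    with C show ?thesis by blast
  qed
  obtain C1 where C1: "\<And>x. x \<in> cball x0 R \<Longrightarrow> norm (f x) \<le> C1" "C1 \<ge> 0" using bdd[OF f] by blast
  obtain C2 where C2: "C2 \<ge> 0" "\<And>x v. x \<in> cball x0 R \<Longrightarrow> norm (dder f x v) \<le> C2 * norm v" using der[OF f] by blast
  obtain C3 where C3: "C3 \<ge> 0" "\<And>x y. x \<in> cball x0 R \<Longrightarrow> y \<in> cball x0 R \<Longrightarrow> norm (f y - f x) \<le> C3 * norm (y - x)"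
    using lip[OF f] by blast
  obtain L where L: "\<And>b. L b \<ge> 0"
    "\<And>b x y. x \<in> cball x0 R \<Longrightarrow> y \<in> cball x0 R \<Longrightarrow> norm (dder f y b - dder f x b) \<le> L b * norm (y - x)"
    using lip[OF smooth_on_dder[OF f]] by metis
  define C4 where "C4 = (\<Sum>b\<in>Basis. L b)"
  have C4: "C4 \<ge> 0" unfolding C4_def using L by (auto intro: sum_nonneg)
  have lipd: "norm (dder f y v - dder f x v) \<le> C4 * norm (y - x) * norm v"
    if "x \<in> cball x0 R" "y \<in> cball x0 R" for x y v
  proof -
    have l: "linear (dder f z)" if "z \<in> cball x0 R" for z
      using that S f by (intro dder_linear smooth_on_imp_differentiable) auto
    have "dder f y v - dder f x v = (\<Sum>b\<in>Basis. (v \<bullet> b) *\<^sub>R (dder f y b - dder f x b))"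
      using linear_eq_sum_Basis[OF l[OF that(1)], of v] linear_eq_sum_Basis[OF l[OF that(2)], of v]
      by (simp add: scaleR_diff_right sum_subtractf)
    also have "norm \<dots> \<le> (\<Sum>b\<in>Basis. norm v * (L b * norm (y - x)))"
      by (rule sum_norm_le) (use L that Basis_le_norm in \<open>auto intro!: mult_mono\<close>)
    finally show ?thesis by (simp add: C4_def sum_distrib_left sum_distrib_right ac_simps)
  qed
  have quad: "norm (f y - f x - dder f x (y - x)) \<le> C4 * (norm (y - x))\<^sup>2"
    if "x \<in> cball x0 R" "y \<in> cball x0 R" for x y
  proof -
    have seg: "closed_segment x y \<subseteq> cball x0 R" using that by (intro closed_segment_subset) auto
    have "norm (f y - f x - dder f x (y - x)) \<le> norm (y - x) * (C4 * norm (y - x))"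
    proof (rule differentiable_bound_linearization[of x y "closed_segment x y" f "\<lambda>x. dder f x" x])
      show "x + t *\<^sub>R (y - x) \<in> closed_segment x y" if "t \<in> {0..1}" for t
        using that unfolding closed_segment_def by (auto intro!: exI[of _ t] simp: algebra_simps)
      show "(f has_derivative dder f z) (at z within closed_segment x y)"
        if "z \<in> closed_segment x y" for z
        using that seg S by (intro has_derivative_at_withinI[OF smooth_on_imp_has_derivative[OF f]]) auto
      show "onorm (dder f z - dder f x) \<le> C4 * norm (y - x)"
        if "z \<in> closed_segment x y" for z
        unfolding fun_diff_def
      proof (rule onorm_bound)
        fix v
        have "norm (dder f z v - dder f x v) \<le> C4 * norm (z - x) * norm v"
          using that seg \<open>x \<in> cball x0 R\<close> by (intro lipd) auto
        also have "\<dots> \<le> C4 * norm (y - x) * norm v"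
          using segment_bound(1)[OF that] C4 by (intro mult_right_mono mult_left_mono) (auto simp: norm_minus_commute)
        finally show "norm (dder f z v - dder f x v) \<le> C4 * norm (y - x) * norm v" .
      qed (use C4 in auto)
    qed auto
    then show ?thesis by (simp add: power2_eq_square ac_simps)
  qed
  let ?C = "1 + C1 + C2 + C3 + C4"
  have mono: "a * t \<le> ?C * t" if "a \<in> {C2, C3, C4}" "t \<ge> 0" for a t
    using that C1 C2(1) C3(1) C4 by (intro mult_right_mono) auto
  show thesis
  proof (rule that[of ?C])
    show "norm (f x) \<le> ?C" if "x \<in> cball x0 R" for x
      using C1(1)[OF that] C2(1) C3(1) C4 by linarith
    show "norm (dder f x v) \<le> ?C * norm v" if "x \<in> cball x0 R" for x v
      using C2(2)[OF that, of v] mono[of C2 "norm v"] by simp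
    show "norm (f y - f x) \<le> ?C * norm (y - x)" if "x \<in> cball x0 R" "y \<in> cball x0 R" for x y
      using C3(2)[OF that] mono[of C3 "norm (y - x)"] by simp
    show "norm (f y - f x - dder f x (y - x)) \<le> ?C * (norm (y - x))\<^sup>2" if "x \<in> cball x0 R" "y \<in> cball x0 R" for x y
      using quad[OF that] mono[of C4 "(norm (y - x))\<^sup>2"] by simp
  qed (use C1 C2 C3 C4 in auto)
qed

text \<open>Banach's fixed point theorem for the integral equation. The time is clamped to \<open>{0..1}\<close> because
  bounded continuous functions form a complete space on the whole line. The constant 1/2 makes the
  integral operator a contraction on the unit time interval.\<close>

lemma picard_unit_interval:
  fixes f :: "'e::euclidean_space \<Rightarrow> 'e"
  assumes "\<rho> \<ge> 0"
    and bound: "\<And>x. x \<in> cball x0 \<rho> \<Longrightarrow> norm (f x) \<le> \<rho>"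
    and lip: "\<And>x y. x \<in> cball x0 \<rho> \<Longrightarrow> y \<in> cball x0 \<rho> \<Longrightarrow> norm (f y - f x) \<le> (1/2) * norm (y - x)"
  obtains y where "y 0 = x0" "\<And>t. t \<in> {0..1} \<Longrightarrow> y t \<in> cball x0 \<rho>"
    "\<And>t. t \<in> {0..1} \<Longrightarrow> (y has_vector_derivative f (y t)) (at t within {0..1})"
proof -
  define c where "c t = max 0 (min 1 t)" for t :: real
  have c: "c t \<in> {0..1}" for t by (auto simp: c_def)
  have c_id: "c t = t" if "t \<in> {0..1}" for t using that by (auto simp: c_def)
  have contc: "continuous_on UNIV c" unfolding c_def by (intro continuous_intros)
  have contf: "continuous_on (cball x0 \<rho>) f"
    unfolding continuous_on_iff dist_norm
  proof (intro ballI allI impI)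
    fix x e :: _ assume "x \<in> cball x0 \<rho>" "(0::real) < e"
    then show "\<exists>d>0. \<forall>y\<in>cball x0 \<rho>. norm (y - x) < d \<longrightarrow> norm (f y - f x) < e"
      using lip by (intro exI[of _ e]) force
  qed
  define X where "X = {y :: real \<Rightarrow>\<^sub>C 'e. \<forall>t. apply_bcontfun y t \<in> cball x0 \<rho>}"
  define I where "I y t = x0 + integral {0..c t} (\<lambda>\<tau>. f (apply_bcontfun y \<tau>))" for y t
  define T where "T y = Bcontfun (I y)" for y
  have conty: "continuous_on {0..1} (\<lambda>\<tau>. f (apply_bcontfun y \<tau>))" if "y \<in> X" for y
    by (rule continuous_on_compose2[OF contf]) (use that in \<open>auto simp: X_def intro: continuous_on_apply_bcontfun continuous_on_subset\<close>)
  have conty': "continuous_on {0..c t} (\<lambda>\<tau>. f (apply_bcontfun y \<tau>))" if "y \<in> X" for y t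
    using conty[OF that] by (rule continuous_on_subset) (use c in auto)
  have ball: "I y t \<in> cball x0 \<rho>" if "y \<in> X" for y t
  proof -
    have "norm (integral {0..c t} (\<lambda>\<tau>. f (apply_bcontfun y \<tau>))) \<le> \<rho> * (c t - 0)"
      using that c[of t] by (intro integral_bound conty' bound) (auto simp: X_def)
    also have "\<dots> \<le> \<rho> * 1" using c[of t] \<open>\<rho> \<ge> 0\<close> by (intro mult_left_mono) auto
    finally show ?thesis by (simp add: I_def dist_norm)
  qed
  have contI: "continuous_on UNIV (I y)" if "y \<in> X" for y
    unfolding I_def
    by (intro continuous_intros continuous_on_compose2[OF indefinite_integral_continuous_1 contc])
      (use c in \<open>auto intro!: integrable_continuous_real conty that\<close>)
  have T: "apply_bcontfun (T y) = I y" if "y \<in> X" for y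
    unfolding T_def
  proof (rule Bcontfun_inverse, rule bcontfun_normI)
    show "continuous_on UNIV (I y)" using contI that .
    show "norm (I y t) \<le> norm x0 + \<rho>" for t
      using ball[OF that, of t] norm_triangle_sub[of "I y t" x0]
      by (simp add: dist_norm norm_minus_commute)
  qed
  have "\<exists>!y\<in>X. T y = y"
  proof (rule Banach_fix)
    show "complete X"
    proof -
      have "X = PiC UNIV (\<lambda>_. cball x0 \<rho>)" by (auto simp: X_def mem_PiC_iff Pi_iff)
      then show ?thesis by (simp add: complete_eq_closed closed_PiC)
    qed
    have "const_bcontfun x0 \<in> X" using \<open>\<rho> \<ge> 0\<close> by (simp add: X_def)
    then show "X \<noteq> {}" by auto
    show "T ` X \<subseteq> X" using T ball by (auto simp: X_def)
    show "dist (T y) (T z) \<le> 1/2 * dist y z" if yz: "y \<in> X" "z \<in> X" for y z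
      proof (rule dist_bound)
        fix t
        have "dist (T y t) (T z t) = norm (integral {0..c t} (\<lambda>\<tau>. f (y \<tau>) - f (z \<tau>)))"
          by (subst integral_diff)
            (auto intro!: integrable_continuous_real conty' yz simp: T yz I_def dist_norm)
        also have "\<dots> \<le> (1/2 * dist y z) * (c t - 0)"
        proof (rule integral_bound)
          fix \<tau>
          have "norm (f (y \<tau>) - f (z \<tau>)) \<le> 1/2 * dist (y \<tau>) (z \<tau>)"
            using lip[of "z \<tau>" "y \<tau>"] yz by (auto simp: X_def dist_norm)
          also have "\<dots> \<le> 1/2 * dist y z" using dist_bounded[of y \<tau> z] by simp
          finally show "norm (f (y \<tau>) - f (z \<tau>)) \<le> 1/2 * dist y z" .
        qed (use c[of t] in \<open>auto intro!: continuous_intros conty' yz\<close>)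
        also have "\<dots> \<le> (1/2 * dist y z) * 1" using c[of t] by (intro mult_left_mono) auto
        finally show "dist (T y t) (T z t) \<le> 1/2 * dist y z" by simp
      qed
  qed auto
  then obtain y where y: "y \<in> X" "T y = y" by blast
  then have yI: "apply_bcontfun y = I y" using T by metis
  show thesis
  proof (rule that[of "apply_bcontfun y"])
    show "apply_bcontfun y 0 = x0" using fun_cong[OF yI, of 0] by (simp add: I_def c_def)
    show "apply_bcontfun y t \<in> cball x0 \<rho>" for t using y by (simp add: X_def)
    fix t :: real assume t: "t \<in> {0..1}"
    have "((\<lambda>u. integral {0..u} (\<lambda>\<tau>. f (y \<tau>))) has_vector_derivative f (y t)) (at t within {0..1})"
      by (rule integral_has_vector_derivative[OF conty[OF y(1)] t])
    then have "((\<lambda>u. x0 + integral {0..u} (\<lambda>\<tau>. f (y \<tau>))) has_vector_derivative f (y t)) (at t within {0..1})"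
      by (auto intro!: derivative_eq_intros)
    then show "(apply_bcontfun y has_vector_derivative f (y t)) (at t within {0..1})"
    proof (rule has_vector_derivative_transform[OF t, rotated])
      show "apply_bcontfun y u = x0 + integral {0..u} (\<lambda>\<tau>. f (y \<tau>))" if "u \<in> {0..1}" for u
        using fun_cong[OF yI, of u] c_id[OF that] by (simp only: I_def)
    qed
  qed
qed

text \<open>Each \<open>s\<close> gives the curve \<open>Y s\<close> with \<open>y' = F y s\<close> and \<open>y 0 = x0\<close>; put \<open>z s = Y s 1\<close>. To see that
  \<open>z\<close> has derivative \<open>F (z s)\<close>, compare \<open>Y (s + h)\<close> with the guess \<open>w t = Y s t + t F (Y s t) h\<close>. As
  the fields \<open>F \<cdot> e\<close> commute, \<open>w\<close> solves the equation of \<open>Y (s + h)\<close> up to an error of order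
  \<open>(norm h)\<^sup>2\<close>, and therefore the two curves differ by that order. Smoothness follows by induction
  on the degree, since \<open>F (z s)\<close> is as smooth as \<open>z\<close>.\<close>

lemma frobenius:
  fixes F :: "'e::euclidean_space \<Rightarrow> 'd::euclidean_space \<Rightarrow> 'e"
  assumes S: "open S" "x0 \<in> S"
    and lin: "\<And>x. x \<in> S \<Longrightarrow> linear (F x)"
    and smooth: "\<And>e. smooth_on S (\<lambda>x. F x e)"
    and comm: "\<And>x e e'. x \<in> S \<Longrightarrow>
      dder (\<lambda>x. F x e') x (F x e) = dder (\<lambda>x. F x e) x (F x e')"
  obtains r z where "r > 0" "z 0 = x0" "z ` ball 0 r \<subseteq> S" "smooth_on (ball 0 r) z"
    "\<And>s. s \<in> ball 0 r \<Longrightarrow> (z has_derivative F (z s)) (at s)"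
proof -
  obtain R where R: "R > 0" "cball x0 R \<subseteq> S" using S open_contains_cball by blast
  have "\<exists>C>0. (\<forall>x\<in>cball x0 R. norm (F x e) \<le> C) \<and>
      (\<forall>x\<in>cball x0 R. \<forall>v. norm (dder (\<lambda>x. F x e) x v) \<le> C * norm v) \<and>
      (\<forall>x\<in>cball x0 R. \<forall>y\<in>cball x0 R. norm (F y e - F x e) \<le> C * norm (y - x)) \<and>
      (\<forall>x\<in>cball x0 R. \<forall>y\<in>cball x0 R. norm (F y e - F x e - dder (\<lambda>x. F x e) x (y - x)) \<le> C * (norm (y - x))\<^sup>2)"
    for e
    using second_order_bounds[OF smooth R(2)] by metis
  then obtain B where B: "\<And>e. B e > 0" "\<And>e x. x \<in> cball x0 R \<Longrightarrow> norm (F x e) \<le> B e"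
    "\<And>e x v. x \<in> cball x0 R \<Longrightarrow> norm (dder (\<lambda>x. F x e) x v) \<le> B e * norm v"
    "\<And>e x y. x \<in> cball x0 R \<Longrightarrow> y \<in> cball x0 R \<Longrightarrow> norm (F y e - F x e) \<le> B e * norm (y - x)"
    "\<And>e x y. x \<in> cball x0 R \<Longrightarrow> y \<in> cball x0 R \<Longrightarrow>
       norm (F y e - F x e - dder (\<lambda>x. F x e) x (y - x)) \<le> B e * (norm (y - x))\<^sup>2"
    by metis
  define C where "C = (\<Sum>b\<in>Basis. B b)"
  have C: "C > 0" unfolding C_def using B(1) by (intro sum_pos) auto
  have extend: "norm (L e) \<le> C * norm e * k"
    if "linear L" "\<And>b. norm (L b) \<le> B b * k" for L :: "'d \<Rightarrow> 'e" and e k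
  proof -
    have "norm (L e) = norm (\<Sum>b\<in>Basis. (e \<bullet> b) *\<^sub>R L b)" using linear_eq_sum_Basis[OF that(1)] by metis
    also have "\<dots> \<le> (\<Sum>b\<in>Basis. norm e * (B b * k))"
      by (rule sum_norm_le) (use that(2) Basis_le_norm in \<open>auto intro!: mult_mono\<close>)
    finally show ?thesis by (simp add: C_def sum_distrib_left sum_distrib_right ac_simps)
  qed
  have dF: "((\<lambda>x. F x e) has_derivative dder (\<lambda>x. F x e) x) (at x)" if "x \<in> S" for x e
    using smooth_on_imp_has_derivative[OF smooth that] .
  have linD: "linear (\<lambda>e. dder (\<lambda>x. F x e) x v)" if "x \<in> S" for x v
  proof
    have "((\<lambda>x. F x (a + b)) has_derivative (\<lambda>v. dder (\<lambda>x. F x a) x v + dder (\<lambda>x. F x b) x v)) (at x)" for a b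
      by (rule has_derivative_transform_within_open[OF has_derivative_add[OF dF[OF that] dF[OF that]] S(1) that])
        (simp add: linear_add[OF lin])
    then show "dder (\<lambda>x. F x (a + b)) x v = dder (\<lambda>x. F x a) x v + dder (\<lambda>x. F x b) x v" for a b
      by (rule dder_unique)
    have "((\<lambda>x. F x (c *\<^sub>R b)) has_derivative (\<lambda>v. c *\<^sub>R dder (\<lambda>x. F x b) x v)) (at x)" for c b
      by (rule has_derivative_transform_within_open[OF has_derivative_scaleR_right[OF dF[OF that]] S(1) that])
        (simp add: linear_cmul[OF lin])
    then show "dder (\<lambda>x. F x (c *\<^sub>R b)) x v = c *\<^sub>R dder (\<lambda>x. F x b) x v" for c b
      by (rule dder_unique)
  qed
  have F1: "norm (F x e) \<le> C * norm e" if "x \<in> cball x0 R" for x e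
    using extend[of "F x" 1 e] B(2)[OF that] lin that R by auto
  have F2: "norm (dder (\<lambda>x. F x e) x v) \<le> C * norm e * norm v" if "x \<in> cball x0 R" for x e v
    by (rule extend[of "\<lambda>e. dder (\<lambda>x. F x e) x v"]) (use that R B(3)[OF that] linD in auto)
  have F3: "norm (F y e - F x e) \<le> C * norm e * norm (y - x)" if "x \<in> cball x0 R" "y \<in> cball x0 R" for x y e
    by (rule extend[of "\<lambda>e. F y e - F x e"]) (use that R B(4) lin in \<open>auto intro!: linear_compose_sub\<close>)
  have F4: "norm (F y e - F x e - dder (\<lambda>x. F x e) x (y - x)) \<le> C * norm e * (norm (y - x))\<^sup>2"
    if "x \<in> cball x0 R" "y \<in> cball x0 R" for x y e
    by (rule extend[of "\<lambda>e. F y e - F x e - dder (\<lambda>x. F x e) x (y - x)"])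
      (use that R B(5) lin linD in \<open>auto intro!: linear_compose_sub\<close>)
  define \<rho> where "\<rho> = R / 2"
  have \<rho>: "\<rho> > 0" "cball x0 \<rho> \<subseteq> cball x0 R" using R by (auto simp: \<rho>_def)
  \<comment> \<open>The first bound keeps all curves in \<open>cball x0 \<rho>\<close> and the guesses \<open>w\<close> in \<open>cball x0 R\<close>; the second
    one makes the Lipschitz constants at most 1/2.\<close>
  define r where "r = min (\<rho> / (2 * C)) (1 / (2 * C))"
  have r: "r > 0" "2 * C * r \<le> \<rho>" "C * r \<le> 1/2"
    using C \<rho> by (auto simp: r_def min_def field_simps)
  have "\<exists>y. y 0 = x0 \<and> (\<forall>t\<in>{0..1}. y t \<in> cball x0 \<rho>) \<and>
      (\<forall>t\<in>{0..1}. (y has_vector_derivative F (y t) s) (at t within {0..1}))" if s: "s \<in> ball 0 r" for s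
  proof -
    have Cs: "C * norm s \<le> C * r" using s C by (intro mult_left_mono) auto
    have "norm (F x s) \<le> \<rho>" if "x \<in> cball x0 \<rho>" for x
    proof -
      have "norm (F x s) \<le> C * norm s" using that \<rho> by (intro F1) auto
      moreover have "C * r > 0" using C r by simp
      ultimately show ?thesis using Cs r(2) by linarith
    qed
    moreover have "norm (F y s - F x s) \<le> 1/2 * norm (y - x)" if "x \<in> cball x0 \<rho>" "y \<in> cball x0 \<rho>" for x y
    proof -
      have "norm (F y s - F x s) \<le> C * norm s * norm (y - x)" using that \<rho> by (intro F3) auto
      also have "\<dots> \<le> 1/2 * norm (y - x)" using Cs r by (intro mult_right_mono) auto
      finally show ?thesis .
    qed
    ultimately show ?thesis
      using picard_unit_interval[of \<rho> x0 "\<lambda>x. F x s"] \<rho>(1) by (metis less_imp_le)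
  qed
  then obtain Y where Y: "\<And>s. s \<in> ball 0 r \<Longrightarrow> Y s 0 = x0"
    "\<And>s t. s \<in> ball 0 r \<Longrightarrow> t \<in> {0..1} \<Longrightarrow> Y s t \<in> cball x0 \<rho>"
    "\<And>s t. s \<in> ball 0 r \<Longrightarrow> t \<in> {0..1} \<Longrightarrow> (Y s has_vector_derivative F (Y s t) s) (at t within {0..1})"
    by metis
  define z where "z s = Y s 1" for s
  define K where "K = C * r * C\<^sup>2 + C\<^sup>2"
  have K: "K \<ge> 0" unfolding K_def using C r by auto
  have key: "norm (z (s + h) - z s - F (z s) h) \<le> 2 * K * (norm h)\<^sup>2"
    if s: "s \<in> ball 0 r" "s + h \<in> ball 0 r" for s h
  proof -
    define y1 y2 where "y1 = Y s" and "y2 = Y (s + h)"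
    define w where "w t = y1 t + t *\<^sub>R F (y1 t) h" for t
    define w' where "w' t = F (y1 t) (s + h) + t *\<^sub>R dder (\<lambda>x. F x s) (y1 t) (F (y1 t) h)" for t
    have y1: "y1 t \<in> cball x0 \<rho>" "y1 t \<in> cball x0 R" "y1 t \<in> S"
      and y2: "y2 t \<in> cball x0 R" if "t \<in> {0..1}" for t
      using Y(2) s that \<rho>(2) R(2) unfolding y1_def y2_def by blast+
    have nh: "norm h \<le> 2 * r"
    proof -
      have "norm h = norm ((s + h) - s)" by simp
      also have "\<dots> \<le> norm (s + h) + norm s" by (rule norm_triangle_ineq4)
      finally show ?thesis using s by auto
    qed
    have wy: "norm (w t - y1 t) \<le> C * norm h" if "t \<in> {0..1}" for t
    proof -
      have "norm (w t - y1 t) = \<bar>t\<bar> * norm (F (y1 t) h)" by (simp add: w_def)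
      also have "\<dots> \<le> 1 * (C * norm h)" using that F1[OF y1(2)[OF that]] by (intro mult_mono) auto
      finally show ?thesis by simp
    qed
    have wR: "w t \<in> cball x0 R" if "t \<in> {0..1}" for t
    proof -
      have "C * norm h \<le> C * (2 * r)" using nh C by (intro mult_left_mono) auto
      then have "norm (w t - y1 t) \<le> \<rho>" using wy[OF that] r by (simp add: ac_simps)
      then have "dist x0 (w t) \<le> \<rho> + \<rho>"
        using y1(1)[OF that] dist_triangle[of x0 "w t" "y1 t"] by (simp add: dist_norm norm_minus_commute)
      then show ?thesis by (simp add: \<rho>_def)
    qed
    have dw: "(w has_vector_derivative w' t) (at t within {0..1})" if t: "t \<in> {0..1}" for t
    proof -
      have 1: "(y1 has_vector_derivative F (y1 t) s) (at t within {0..1})"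
        using Y(3)[OF s(1) t] by (simp add: y1_def)
      have 2: "((\<lambda>t. F (y1 t) h) has_vector_derivative dder (\<lambda>x. F x h) (y1 t) (F (y1 t) s)) (at t within {0..1})"
        using vector_derivative_diff_chain_within[OF 1 has_derivative_at_withinI[OF dF[OF y1(3)[OF t]]]]
        by (simp add: o_def)
      have "(w has_vector_derivative F (y1 t) s + (t *\<^sub>R dder (\<lambda>x. F x h) (y1 t) (F (y1 t) s) + 1 *\<^sub>R F (y1 t) h)) (at t within {0..1})"
        unfolding w_def
        by (intro has_vector_derivative_add 1 has_vector_derivative_scaleR 2 derivative_intros)
      \<comment> \<open>The only use of commutativity: it exchanges the roles of \<open>h\<close> and \<open>s\<close>.\<close>
      then show ?thesis
        by (simp add: w'_def linear_add[OF lin[OF y1(3)[OF t]]] comm[OF y1(3)[OF t], of h s] ac_simps)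
    qed
    have err: "norm (F (w t) (s + h) - w' t) \<le> K * (norm h)\<^sup>2" if t: "t \<in> {0..1}" for t
    proof -
      let ?D = "\<lambda>e. dder (\<lambda>x. F x e) (y1 t)"
      let ?E = "F (w t) (s + h) - F (y1 t) (s + h) - ?D (s + h) (w t - y1 t)"
      have lD: "linear (?D e)" for e
        using y1(3)[OF t] smooth by (intro dder_linear smooth_on_imp_differentiable)
      have "?D (s + h) (w t - y1 t) = t *\<^sub>R ?D s (F (y1 t) h) + t *\<^sub>R ?D h (F (y1 t) h)"
        by (simp add: w_def linear_cmul[OF lD] linear_add[OF linD[OF y1(3)[OF t]]] scaleR_add_right)
      then have "F (w t) (s + h) - w' t = ?E + t *\<^sub>R ?D h (F (y1 t) h)"
        by (simp add: w'_def)
      also have "norm \<dots> \<le> norm ?E + norm (t *\<^sub>R ?D h (F (y1 t) h))" by (rule norm_triangle_ineq)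
      also have "norm ?E \<le> C * r * (C * norm h)\<^sup>2"
      proof -
        have "norm ?E \<le> C * norm (s + h) * (norm (w t - y1 t))\<^sup>2" by (rule F4[OF y1(2)[OF t] wR[OF t]])
        also have "\<dots> \<le> C * r * (C * norm h)\<^sup>2"
          using wy[OF t] s C r by (intro mult_mono power_mono) auto
        finally show ?thesis .
      qed
      also have "norm (t *\<^sub>R ?D h (F (y1 t) h)) \<le> 1 * (C * norm h * (C * norm h))"
      proof -
        have "norm (?D h (F (y1 t) h)) \<le> C * norm h * norm (F (y1 t) h)" by (rule F2[OF y1(2)[OF t]])
        also have "\<dots> \<le> C * norm h * (C * norm h)"
          using C F1[OF y1(2)[OF t]] by (intro mult_left_mono) auto
        finally show ?thesis using t by (simp only: norm_scaleR, intro mult_mono) auto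
      qed
      finally show ?thesis by (simp add: K_def power2_eq_square algebra_simps)
    qed
    define \<delta> where "\<delta> t = y2 t - w t" for t
    have d\<delta>: "(\<delta> has_vector_derivative F (y2 t) (s + h) - w' t) (at t within {0..1})" if "t \<in> {0..1}" for t
      unfolding \<delta>_def using Y(3)[OF s(2) that] dw[OF that]
      by (auto simp: y2_def intro!: has_vector_derivative_diff)
    \<comment> \<open>The derivative of \<open>\<delta>\<close> is bounded by half the maximum of \<open>\<delta>\<close> plus the error of \<open>w\<close>; on the unit
      interval the former can be absorbed into the maximum.\<close>
    have "continuous_on {0..1} (\<lambda>t. norm (\<delta> t))"
      using d\<delta> by (intro continuous_on_norm continuous_on_vector_derivative) auto
    then obtain t0 where t0: "t0 \<in> {0..1}" "\<And>t. t \<in> {0..1} \<Longrightarrow> norm (\<delta> t) \<le> norm (\<delta> t0)"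
      using continuous_attains_sup[of "{0..1::real}" "\<lambda>t. norm (\<delta> t)"] by auto
    have b\<delta>: "norm (F (y2 t) (s + h) - w' t) \<le> norm (\<delta> t0) / 2 + K * (norm h)\<^sup>2" if t: "t \<in> {0..1}" for t
    proof -
      have "norm (F (y2 t) (s + h) - F (w t) (s + h)) \<le> C * norm (s + h) * norm (\<delta> t)"
        using F3[OF wR[OF t] y2[OF t], of "s + h"] by (simp add: \<delta>_def)
      also have "\<dots> \<le> 1/2 * norm (\<delta> t0)"
      proof (rule mult_mono)
        have "C * norm (s + h) \<le> C * r" using s C by (intro mult_left_mono) auto
        then show "C * norm (s + h) \<le> 1/2" using r by linarith
      qed (use t0(2)[OF t] in auto)
      finally have "norm (F (y2 t) (s + h) - F (w t) (s + h)) \<le> norm (\<delta> t0) / 2" by simp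
      with err[OF t] norm_triangle_ineq[of "F (y2 t) (s + h) - F (w t) (s + h)" "F (w t) (s + h) - w' t"]
      show ?thesis by simp
    qed
    have "norm (\<delta> t0 - \<delta> 0) \<le> (norm (\<delta> t0) / 2 + K * (norm h)\<^sup>2) * norm (t0 - 0)"
    proof (rule differentiable_bound[of "{0..1}" \<delta> "\<lambda>t v. v *\<^sub>R (F (y2 t) (s + h) - w' t)"])
      show "(\<delta> has_derivative (\<lambda>v. v *\<^sub>R (F (y2 t) (s + h) - w' t))) (at t within {0..1})" if "t \<in> {0..1}" for t
        using d\<delta>[OF that] by (simp add: has_vector_derivative_def)
      show "onorm (\<lambda>v. v *\<^sub>R (F (y2 t) (s + h) - w' t)) \<le> norm (\<delta> t0) / 2 + K * (norm h)\<^sup>2" if "t \<in> {0..1}" for t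
      proof (rule onorm_bound)
        show "norm (v *\<^sub>R (F (y2 t) (s + h) - w' t)) \<le> (norm (\<delta> t0) / 2 + K * (norm h)\<^sup>2) * norm v" for v
          using mult_left_mono[OF b\<delta>[OF that], of "\<bar>v\<bar>"] by (simp add: mult.commute)
      qed (use K in auto)
    qed (use t0 in auto)
    also have "\<dots> \<le> (norm (\<delta> t0) / 2 + K * (norm h)\<^sup>2) * 1"
      using t0 K by (intro mult_left_mono) auto
    finally have "norm (\<delta> t0 - \<delta> 0) \<le> norm (\<delta> t0) / 2 + K * (norm h)\<^sup>2" by simp
    moreover have "\<delta> 0 = 0" using Y(1) s by (simp add: \<delta>_def w_def y1_def y2_def)
    ultimately have "norm (\<delta> t0) \<le> 2 * K * (norm h)\<^sup>2" by simp
    with t0(2)[of 1] show ?thesis by (simp add: \<delta>_def w_def y1_def y2_def z_def diff_diff_eq)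
  qed
  have zS: "z s \<in> S" if "s \<in> ball 0 r" for s
    using Y(2)[OF that, of 1] \<rho>(2) R(2) by (auto simp: z_def)
  have dz: "(z has_derivative F (z s)) (at s)" if s: "s \<in> ball 0 r" for s
  proof (rule has_derivativeI_norm)
    show "bounded_linear (F (z s))" using lin[OF zS[OF s]] linear_conv_bounded_linear by blast
    fix e :: real assume e: "e > 0"
    define d where "d = min (r - norm s) (e / (2 * K + 1))"
    have "norm (z y - z s - F (z s) (y - s)) \<le> e * norm (y - s)" if y: "norm (y - s) < d" for y
    proof -
      have "norm y \<le> norm s + norm (y - s)" by (metis norm_triangle_sub add.commute)
      then have "s + (y - s) \<in> ball 0 r" using y by (simp add: d_def)
      from key[OF s this] have "norm (z y - z s - F (z s) (y - s)) \<le> 2 * K * norm (y - s) * norm (y - s)"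
        by (simp add: power2_eq_square)
      also have "\<dots> \<le> e * norm (y - s)"
      proof (rule mult_right_mono)
        have "2 * K * norm (y - s) \<le> (2 * K + 1) * (e / (2 * K + 1))"
          using y K e by (intro mult_mono) (auto simp: d_def)
        then show "2 * K * norm (y - s) \<le> e" using K by simp
      qed auto
      finally show ?thesis .
    qed
    moreover have "d > 0" using s e K by (auto simp: d_def)
    ultimately show "\<exists>d>0. \<forall>y. norm (y - s) < d \<longrightarrow> norm (z y - z s - F (z s) (y - s)) \<le> e * norm (y - s)"
      by blast
  qed
  have "Ck_on k (ball 0 r) z" for k
  proof (induction k)
    case 0
    then show ?case
      using dz by (auto intro!: continuous_at_imp_continuous_on has_derivative_continuous)
  next
    case (Suc k)
    have "Ck_on k (ball 0 r) (\<lambda>s. F (z s) e)" for e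
      using smooth zS S by (intro Ck_on_compose[OF _ Suc]) (auto simp: smooth_onD)
    then have "Ck_on k (ball 0 r) (\<lambda>s. dder z s e)" for e
      by (rule Ck_on_eqI[OF _ open_ball]) (rule dder_unique[OF dz])
    moreover have "z differentiable (at s)" if "s \<in> ball 0 r" for s
      using dz[OF that] unfolding differentiable_def by blast
    ultimately show ?case by simp
  qed
  moreover have "z 0 = x0"
  proof -
    have "(0::'d) \<in> ball 0 r" using r by simp
    note Y0 = Y[OF this] 
    have "norm (Y 0 1 - Y 0 0) \<le> 0 * norm (1 - 0 :: real)"
    proof (rule differentiable_bound[of "{0..1::real}" "Y 0" "\<lambda>t v. 0"])
      show "(Y 0 has_derivative (\<lambda>v. 0)) (at t within {0..1})" if "t \<in> {0..1}" for t
        using Y0(3)[OF that] lin Y0(2)[OF that] \<rho>(2) R(2)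
        by (auto simp: has_vector_derivative_def linear_0 subset_iff)
    qed (auto simp: onorm_zero)
    then show ?thesis using Y0(1) by (simp add: z_def)
  qed
  ultimately show thesis
    using that[OF r(1)] zS dz by (auto simp: smooth_on_def image_subset_iff)
qed

section \<open>Charts\<close>

lemma is_chartD:
  assumes "is_chart (U, \<phi>)"
  shows "open U" "open (\<phi> ` U)" "inj_on \<phi> U" "continuous_on U \<phi>" "continuous_on (\<phi> ` U) (inv_into U \<phi>)"
proof -
  from assms obtain \<psi> where o: "open U" "open (\<phi> ` U)" and h: "homeomorphism U (\<phi> ` U) \<phi> \<psi>"
    by (auto simp: is_chart_def)
  show "open U" "open (\<phi> ` U)" by (fact o)+
  show inj: "inj_on \<phi> U" using h by (auto simp: homeomorphism_def intro: inj_on_inverseI)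
  show "continuous_on U \<phi>" using h by (simp add: homeomorphism_def)
  show "continuous_on (\<phi> ` U) (inv_into U \<phi>)"
    by (rule continuous_on_eq[of _ \<psi>]) (use h inj in \<open>auto simp: homeomorphism_def\<close>)
qed

lemma chart_open_image:
  assumes "is_chart (U, \<phi>)" "open W"
  shows "open (\<phi> ` (U \<inter> W))"
proof -
  have "\<phi> ` (U \<inter> W) = inv_into U \<phi> -` W \<inter> \<phi> ` U"
    using is_chartD(3)[OF assms(1)] by (auto simp: inv_into_into)
  then show ?thesis
    using continuous_open_preimage[OF is_chartD(5,2)[OF assms(1)] assms(2)] by (simp add: Int_commute)
qed

lemma chart_open_vimage:
  assumes "is_chart (U, \<phi>)" "open S"
  shows "open {q \<in> U. \<phi> q \<in> S}"
  using continuous_open_preimage[OF is_chartD(4,1)[OF assms(1)] assms(2)] by (simp add: vimage_def Int_def)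

text \<open>Stated, as \<open>smooth_in_max_chart\<close> below, for maps into any Euclidean space: applied to functions it
  shows that smoothness may be tested in one chart per point, applied to chart maps that charts of
  the maximal atlas are compatible with each other.\<close>

lemma smooth_change_of_chart:
  assumes c: "is_chart (U, \<phi>)" and d: "is_chart (V, \<psi>)" and "open W"
    and t: "smooth_on (\<psi> ` (V \<inter> U)) (\<phi> \<circ> inv_into V \<psi>)"
    and f: "smooth_on (\<phi> ` (U \<inter> W)) (f \<circ> inv_into U \<phi>)"
  shows "smooth_on (\<psi> ` (V \<inter> (U \<inter> W))) (f \<circ> inv_into V \<psi>)"
proof -
  note inj = is_chartD(3)[OF c] is_chartD(3)[OF d]
  have o: "open (\<psi> ` (V \<inter> (U \<inter> W)))" using chart_open_image[OF d] is_chartD(1)[OF c] \<open>open W\<close> by blast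
  have "smooth_on (\<psi> ` (V \<inter> (U \<inter> W))) (\<lambda>x. (f \<circ> inv_into U \<phi>) ((\<phi> \<circ> inv_into V \<psi>) x))"
    by (rule smooth_on_compose[OF f smooth_on_subset[OF t]])
      (use inj o chart_open_image[OF c \<open>open W\<close>] in auto)
  then show ?thesis
    by (subst smooth_on_cong[OF o, where g = "\<lambda>x. (f \<circ> inv_into U \<phi>) ((\<phi> \<circ> inv_into V \<psi>) x)"])
      (use inj in auto)
qed

context
  fixes M :: "('m::{t2_space,second_countable_topology}, 'e::euclidean_space) atlas"
  assumes M: "smooth_manifold M"
begin

lemma chart_at: obtains U \<phi> where "(U, \<phi>) \<in> M" "p \<in> U"
proof -
  have "(\<Union>(U, \<phi>)\<in>M. U) = UNIV" using M by (simp add: smooth_manifold_def)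
  then obtain c where "c \<in> M" "p \<in> fst c" by (fastforce simp: case_prod_unfold)
  then show ?thesis using that[of "fst c" "snd c"] by simp
qed

lemma atlas_subset_max_atlas: "M \<subseteq> max_atlas M"
  using M unfolding smooth_manifold_def max_atlas_def by blast

lemma max_atlas_chart: "c \<in> max_atlas M \<Longrightarrow> is_chart c"
  by (simp add: max_atlas_def)

lemmas max_chartD = is_chartD[OF max_atlas_chart]
lemmas max_chart_open_image = chart_open_image[OF max_atlas_chart]
lemmas max_chart_open_vimage = chart_open_vimage[OF max_atlas_chart]

lemma max_atlas_compat_atlas:
  assumes "(U, \<phi>) \<in> max_atlas M" "(V, \<psi>) \<in> M"
  shows "smooth_on (\<phi> ` (U \<inter> V)) (\<psi> \<circ> inv_into U \<phi>)" "smooth_on (\<psi> ` (V \<inter> U)) (\<phi> \<circ> inv_into V \<psi>)"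
  using assms by (auto simp: max_atlas_def smooth_compatible_def Int_commute)

lemma smooth_in_max_chart:
  fixes f :: "'m \<Rightarrow> 'b::euclidean_space"
  assumes f: "\<And>A \<alpha>. (A, \<alpha>) \<in> M \<Longrightarrow> smooth_on (\<alpha> ` (A \<inter> W)) (f \<circ> inv_into A \<alpha>)"
    and "open W" and c: "(U, \<phi>) \<in> max_atlas M"
  shows "smooth_on (\<phi> ` (U \<inter> W)) (f \<circ> inv_into U \<phi>)"
proof (rule smooth_on_local)
  fix x assume "x \<in> \<phi> ` (U \<inter> W)"
  then obtain q where q: "q \<in> U" "q \<in> W" "x = \<phi> q" by auto
  obtain A \<alpha> where A: "(A, \<alpha>) \<in> M" "q \<in> A" by (rule chart_at)
  then have a: "is_chart (A, \<alpha>)" using atlas_subset_max_atlas max_atlas_chart by blast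
  have "smooth_on (\<phi> ` (U \<inter> (A \<inter> W))) (f \<circ> inv_into U \<phi>)"
    by (rule smooth_change_of_chart[OF a max_atlas_chart[OF c] \<open>open W\<close>
          max_atlas_compat_atlas(1)[OF c A(1)] f[OF A(1)]])
  moreover have "open (\<phi> ` (U \<inter> (A \<inter> W)))"
    using is_chartD(1)[OF a] \<open>open W\<close> by (intro max_chart_open_image[OF c]) auto
  ultimately show "\<exists>T. open T \<and> x \<in> T \<and> smooth_on T (f \<circ> inv_into U \<phi>)"
    using q A by blast
qed

lemma max_atlas_compat:
  assumes c: "(U, \<phi>) \<in> max_atlas M" and d: "(V, \<psi>) \<in> max_atlas M"
  shows "smooth_on (\<phi> ` (U \<inter> V)) (\<psi> \<circ> inv_into U \<phi>)"
  by (rule smooth_in_max_chart[OF max_atlas_compat_atlas(2)[OF d] max_chartD(1)[OF d] c])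

lemma smooth_fun_on_chart:
  assumes f: "smooth_fun_on M W f" and "open W" and c: "(U, \<phi>) \<in> max_atlas M"
  shows "smooth_on (\<phi> ` (U \<inter> W)) (f \<circ> inv_into U \<phi>)"
  by (rule smooth_in_max_chart[OF _ \<open>open W\<close> c]) (use f in \<open>auto simp: smooth_fun_on_def\<close>)

lemma smooth_fun_onI:
  assumes "\<And>p. p \<in> W \<Longrightarrow> \<exists>U \<phi> W'. (U, \<phi>) \<in> max_atlas M \<and> open W' \<and> p \<in> U \<inter> W' \<and>
    smooth_on (\<phi> ` (U \<inter> W')) (f \<circ> inv_into U \<phi>)"
  shows "smooth_fun_on M W f"
  unfolding smooth_fun_on_def
proof safe
  fix A \<alpha> assume A: "(A, \<alpha>) \<in> M"
  then have a: "(A, \<alpha>) \<in> max_atlas M" using atlas_subset_max_atlas by blast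
  show "smooth_on (\<alpha> ` (A \<inter> W)) (f \<circ> inv_into A \<alpha>)"
  proof (rule smooth_on_local)
    fix x assume "x \<in> \<alpha> ` (A \<inter> W)"
    then obtain q where q: "q \<in> A" "q \<in> W" "x = \<alpha> q" by auto
    obtain U \<phi> W' where c: "(U, \<phi>) \<in> max_atlas M" "open W'" "q \<in> U \<inter> W'"
      "smooth_on (\<phi> ` (U \<inter> W')) (f \<circ> inv_into U \<phi>)"
      using assms[OF q(2)] by blast
    have "smooth_on (\<alpha> ` (A \<inter> (U \<inter> W'))) (f \<circ> inv_into A \<alpha>)"
      by (rule smooth_change_of_chart[OF max_atlas_chart[OF c(1)] max_atlas_chart[OF a] c(2)
            max_atlas_compat_atlas(2)[OF c(1) A] c(4)])
    moreover have "open (\<alpha> ` (A \<inter> (U \<inter> W')))"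
      using max_chartD(1)[OF c(1)] c(2) by (intro max_chart_open_image[OF a]) auto
    ultimately show "\<exists>T. open T \<and> x \<in> T \<and> smooth_on T (f \<circ> inv_into A \<alpha>)"
      using q c(3) by blast
  qed
qed

lemma smooth_near_iff_chart:
  assumes c: "(U, \<phi>) \<in> max_atlas M" and "p \<in> U"
  shows "smooth_near M p f \<longleftrightarrow> (\<exists>W. open W \<and> p \<in> W \<and> smooth_on (\<phi> ` (U \<inter> W)) (f \<circ> inv_into U \<phi>))"
proof
  assume "smooth_near M p f"
  then show "\<exists>W. open W \<and> p \<in> W \<and> smooth_on (\<phi> ` (U \<inter> W)) (f \<circ> inv_into U \<phi>)"
    unfolding smooth_near_def using smooth_fun_on_chart[OF _ _ c] by blast
next
  assume "\<exists>W. open W \<and> p \<in> W \<and> smooth_on (\<phi> ` (U \<inter> W)) (f \<circ> inv_into U \<phi>)"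
  then obtain W where W: "open W" "p \<in> W" "smooth_on (\<phi> ` (U \<inter> W)) (f \<circ> inv_into U \<phi>)" by blast
  have "smooth_fun_on M (U \<inter> W) f"
  proof (rule smooth_fun_onI)
    fix q assume "q \<in> U \<inter> W"
    with W c show "\<exists>U \<phi> W'. (U, \<phi>) \<in> max_atlas M \<and> open W' \<and> q \<in> U \<inter> W' \<and> smooth_on (\<phi> ` (U \<inter> W')) (f \<circ> inv_into U \<phi>)"
      by blast
  qed
  then show "smooth_near M p f"
    unfolding smooth_near_def using W \<open>p \<in> U\<close> max_chartD(1)[OF c] by blast
qed

lemma smooth_near_chart_fun:
  assumes c: "(U, \<phi>) \<in> max_atlas M" and "p \<in> U" "open S" "\<phi> p \<in> S" "smooth_on S g"
  shows "smooth_near M p (\<lambda>q. g (\<phi> q))"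
proof -
  let ?W = "{q \<in> U. \<phi> q \<in> S}"
  have W: "open ?W" by (rule max_chart_open_vimage[OF c \<open>open S\<close>])
  have "smooth_on (\<phi> ` (U \<inter> ?W)) ((\<lambda>q. g (\<phi> q)) \<circ> inv_into U \<phi>)"
    using smooth_on_subset[OF \<open>smooth_on S g\<close>, of "\<phi> ` (U \<inter> ?W)"] max_chartD(3)[OF c]
    by (subst smooth_on_cong[OF max_chart_open_image[OF c W], where g = g]) auto
  with W assms show ?thesis by (subst smooth_near_iff_chart[OF c]) auto
qed

lemma smooth_fun_on_chart_coord:
  assumes c: "(U, \<phi>) \<in> max_atlas M"
  shows "smooth_fun_on M U (\<lambda>q. \<phi> q \<bullet> b)"
proof (rule smooth_fun_onI)
  fix p assume "p \<in> U"
  note o = max_chartD(2)[OF c]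
  have "smooth_on (\<phi> ` U) ((\<lambda>q. \<phi> q \<bullet> b) \<circ> inv_into U \<phi>)"
    using o by (subst smooth_on_cong[where g = "\<lambda>x. x \<bullet> b"]) (auto intro!: smooth_on_inner_left simp: f_inv_into_f)
  with c \<open>p \<in> U\<close> show "\<exists>U \<phi>' W'. (U, \<phi>') \<in> max_atlas M \<and> open W' \<and> p \<in> U \<inter> W' \<and>
      smooth_on (\<phi>' ` (U \<inter> W')) ((\<lambda>q. \<phi> q \<bullet> b) \<circ> inv_into U \<phi>')"
    by (metis Int_UNIV_right open_UNIV)
qed

lemma smooth_near_chart_coord:
  "(U, \<phi>) \<in> max_atlas M \<Longrightarrow> p \<in> U \<Longrightarrow> smooth_near M p (\<lambda>q. \<phi> q \<bullet> b)"
  unfolding smooth_near_def using smooth_fun_on_chart_coord[of U \<phi> b] max_chartD(1)[of U \<phi>] by (intro exI[of _ U]) simp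

lemma smooth_near_const [simp]: "smooth_near M p (\<lambda>q. k)"
proof -
  obtain U \<phi> where "(U, \<phi>) \<in> M" "p \<in> U" by (rule chart_at)
  then have "(U, \<phi>) \<in> max_atlas M" "p \<in> U" using atlas_subset_max_atlas by auto
  from smooth_near_chart_fun[OF this open_UNIV, of "\<lambda>_. k"] show ?thesis by simp
qed

lemma smooth_near_binop:
  assumes f: "smooth_near M p f" and h: "smooth_near M p h"
    and op: "\<And>S F H. open S \<Longrightarrow> smooth_on S F \<Longrightarrow> smooth_on S H \<Longrightarrow> smooth_on S (\<lambda>x :: 'e. op (F x) (H x))"
  shows "smooth_near M p (\<lambda>q. op (f q) (h q))"
proof -
  obtain U \<phi> where "(U, \<phi>) \<in> M" and p: "p \<in> U" by (rule chart_at)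
  then have c: "(U, \<phi>) \<in> max_atlas M" using atlas_subset_max_atlas by auto
  obtain W1 W2 where W: "open W1" "p \<in> W1" "smooth_on (\<phi> ` (U \<inter> W1)) (f \<circ> inv_into U \<phi>)"
    "open W2" "p \<in> W2" "smooth_on (\<phi> ` (U \<inter> W2)) (h \<circ> inv_into U \<phi>)"
    using f h unfolding smooth_near_iff_chart[OF c p] by blast
  have "smooth_on (\<phi> ` (U \<inter> (W1 \<inter> W2))) (\<lambda>x. op ((f \<circ> inv_into U \<phi>) x) ((h \<circ> inv_into U \<phi>) x))"
    using W(1,4) by (intro op max_chart_open_image[OF c] smooth_on_subset[OF W(3)] smooth_on_subset[OF W(6)]) auto
  then show ?thesis
    unfolding smooth_near_iff_chart[OF c p] using W by (intro exI[of _ "W1 \<inter> W2"]) (auto simp: o_def)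
qed

lemma smooth_near_add: "smooth_near M p f \<Longrightarrow> smooth_near M p h \<Longrightarrow> smooth_near M p (\<lambda>q. f q + h q)"
  by (rule smooth_near_binop) (auto intro: smooth_on_add)

lemma smooth_near_mult: "smooth_near M p f \<Longrightarrow> smooth_near M p h \<Longrightarrow> smooth_near M p (\<lambda>q. f q * h q)"
  by (rule smooth_near_binop) (auto intro: smooth_on_mult)

lemma smooth_near_sum:
  "(\<And>i. i \<in> I \<Longrightarrow> smooth_near M p (f i)) \<Longrightarrow> smooth_near M p (\<lambda>q. \<Sum>i\<in>I. f i q)"
  by (induction I rule: infinite_finite_induct) (auto intro!: smooth_near_add)

lemma smooth_near_cong:
  assumes "smooth_near M p f" "\<forall>\<^sub>F q in nhds p. f q = h q"
  shows "smooth_near M p h"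
proof -
  obtain U \<phi> where "(U, \<phi>) \<in> M" and p: "p \<in> U" by (rule chart_at)
  then have c: "(U, \<phi>) \<in> max_atlas M" using atlas_subset_max_atlas by auto
  obtain W1 W2 where W: "open W1" "p \<in> W1" "smooth_on (\<phi> ` (U \<inter> W1)) (f \<circ> inv_into U \<phi>)"
    "open W2" "p \<in> W2" "\<And>q. q \<in> W2 \<Longrightarrow> f q = h q"
    using assms unfolding smooth_near_iff_chart[OF c p] eventually_nhds by blast
  have "smooth_on (\<phi> ` (U \<inter> (W1 \<inter> W2))) (f \<circ> inv_into U \<phi>)"
    using W by (auto elim!: smooth_on_subset)
  then have "smooth_on (\<phi> ` (U \<inter> (W1 \<inter> W2))) (h \<circ> inv_into U \<phi>)"
    by (subst smooth_on_cong[OF max_chart_open_image[OF c], where g = "f \<circ> inv_into U \<phi>"])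
      (use W max_chartD(3)[OF c] in auto)
  then show ?thesis
    unfolding smooth_near_iff_chart[OF c p] using W by (intro exI[of _ "W1 \<inter> W2"]) auto
qed

section \<open>Tangent vectors\<close>

lemma tangent_spaceD:
  assumes "v \<in> tangent_space M p"
  shows "linear_on {f. smooth_near M p f} v"
    "\<And>f h. smooth_near M p f \<Longrightarrow> smooth_near M p h \<Longrightarrow> v (f * h) = f p * v h + h p * v f"
    "\<And>f h. smooth_near M p f \<Longrightarrow> smooth_near M p h \<Longrightarrow> \<forall>\<^sub>F q in nhds p. f q = h q \<Longrightarrow> v f = v h"
    "\<And>f. \<not> smooth_near M p f \<Longrightarrow> v f = 0"
  using assms unfolding tangent_space_def mem_Collect_eq by blast+

lemma tangent_space_linear:
  assumes "v \<in> tangent_space M p" "smooth_near M p f" "smooth_near M p h"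
  shows "v (\<lambda>q. a * f q + b * h q) = a * v f + b * v h"
proof -
  have "v (a *\<^sub>R f + b *\<^sub>R h) = a *\<^sub>R v f + b *\<^sub>R v h"
    using tangent_spaceD(1)[OF assms(1)] assms(2,3) unfolding linear_on_def by blast
  moreover have "a *\<^sub>R f + b *\<^sub>R h = (\<lambda>q. a * f q + b * h q)" by (simp add: scaleR_fun_def fun_eq_iff)
  ultimately show ?thesis by simp
qed

lemma tangent_space_add:
  assumes "v \<in> tangent_space M p" "smooth_near M p f" "smooth_near M p h"
  shows "v (\<lambda>q. f q + h q) = v f + v h"
  using tangent_space_linear[OF assms, of 1 1] by simp

lemma tangent_space_mult:
  assumes "v \<in> tangent_space M p" "smooth_near M p f" "smooth_near M p h"
  shows "v (\<lambda>q. f q * h q) = f p * v h + h p * v f"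
proof -
  have "v (f * h) = f p * v h + h p * v f" using tangent_spaceD(2)[OF assms] .
  then show ?thesis by (simp add: times_fun_def)
qed

lemma tangent_space_const:
  assumes "v \<in> tangent_space M p"
  shows "v (\<lambda>q. k) = 0"
proof -
  have "v (\<lambda>q. 1) = 0" using tangent_space_mult[OF assms, of "\<lambda>q. 1" "\<lambda>q. 1"] by simp
  then show ?thesis
    using tangent_space_linear[OF assms, of "\<lambda>q. 1" "\<lambda>q. 1" k 0] by simp
qed

text \<open>Functions that are not smooth near \<open>p\<close> have the value 0, so that equality of germs suffices.\<close>

lemma tangent_space_cong:
  assumes "v \<in> tangent_space M p" "\<forall>\<^sub>F q in nhds p. f q = h q"
  shows "v f = v h"
proof (cases "smooth_near M p f")
  case True
  then show ?thesis using tangent_spaceD(3)[OF assms(1) _ _ assms(2)] smooth_near_cong assms(2) by blast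
next
  case False
  moreover have "\<not> smooth_near M p h"
    using False smooth_near_cong[of p h f] assms(2) by (auto simp: eq_commute)
  ultimately show ?thesis using tangent_spaceD(4)[OF assms(1)] by simp
qed

lemma tangent_space_not_smooth: "v \<in> tangent_space M p \<Longrightarrow> \<not> smooth_near M p f \<Longrightarrow> v f = 0"
  by (rule tangent_spaceD(4))

lemma tangent_space_sum:
  assumes "v \<in> tangent_space M p" "\<And>i. i \<in> I \<Longrightarrow> smooth_near M p (f i)"
  shows "v (\<lambda>q. \<Sum>i\<in>I. f i q) = (\<Sum>i\<in>I. v (f i))"
  using assms(2)
  by (induction I rule: infinite_finite_induct)
    (auto simp: tangent_space_const[OF assms(1)] tangent_space_add[OF assms(1)] smooth_near_sum)

lemma tangent_space_lincomb:
  assumes v: "v \<in> tangent_space M p" and w: "w \<in> tangent_space M p"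
  shows "a *\<^sub>R v + b *\<^sub>R w \<in> tangent_space M p"
proof -
  have vl: "v (s *\<^sub>R f + t *\<^sub>R h) = s *\<^sub>R v f + t *\<^sub>R v h" "w (s *\<^sub>R f + t *\<^sub>R h) = s *\<^sub>R w f + t *\<^sub>R w h"
    if "smooth_near M p f" "smooth_near M p h" for f h s t
    using that tangent_spaceD(1)[OF v] tangent_spaceD(1)[OF w] unfolding linear_on_def by blast+
  have vm: "v (f * h) = f p * v h + h p * v f" "w (f * h) = f p * w h + h p * w f"
    if "smooth_near M p f" "smooth_near M p h" for f h
    using that tangent_spaceD(2)[OF v] tangent_spaceD(2)[OF w] by blast+
  have "linear_on {f. smooth_near M p f} (a *\<^sub>R v + b *\<^sub>R w)"
    by (simp add: linear_on_def scaleR_fun_def[of _ v] scaleR_fun_def[of _ w] vl algebra_simps)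
  moreover have "v f = v h \<and> w f = w h" if "\<forall>\<^sub>F q in nhds p. f q = h q" for f h
    using tangent_space_cong[OF v that] tangent_space_cong[OF w that] by simp
  ultimately show ?thesis
    unfolding tangent_space_def
    by (auto simp: scaleR_fun_def[of _ v] scaleR_fun_def[of _ w] vm algebra_simps
        tangent_space_not_smooth[OF v] tangent_space_not_smooth[OF w])
qed

lemma zero_in_tangent_space: "0 \<in> tangent_space M p"
  by (auto simp: tangent_space_def linear_on_def)

lemma subspace_tangent_space: "subspace (tangent_space M p)"
proof (rule subspaceI)
  show "x + y \<in> tangent_space M p" if "x \<in> tangent_space M p" "y \<in> tangent_space M p" for x y
    using tangent_space_lincomb[OF that, of 1 1] by simp
  show "c *\<^sub>R x \<in> tangent_space M p" if "x \<in> tangent_space M p" for x c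
    using tangent_space_lincomb[OF that that, of c 0] by simp
qed (rule zero_in_tangent_space)

end

lemma coord_vec_inner: "b \<in> Basis \<Longrightarrow> coord_vec \<phi> v \<bullet> b = v (\<lambda>q. \<phi> q \<bullet> b)"
  by (simp add: coord_vec_def inner_sum_left inner_Basis if_distrib[of "(*) _"] cong: if_cong)

lemma coord_vec_linear: "linear (coord_vec \<phi>)"
proof
  show "coord_vec \<phi> (v + w) = coord_vec \<phi> v + coord_vec \<phi> w" for v w
    by (simp add: coord_vec_def scaleR_add_left sum.distrib)
  show "coord_vec \<phi> (a *\<^sub>R v) = a *\<^sub>R coord_vec \<phi> v" for a v
    by (simp add: coord_vec_def scaleR_fun_def scaleR_sum_right)
qed

context
  fixes M :: "('m::{t2_space,second_countable_topology}, 'e::euclidean_space) atlas"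
  assumes M: "smooth_manifold M"
begin

lemma chart_ball:
  assumes c: "(U, \<phi>) \<in> max_atlas M" and "p \<in> U" "open W" "p \<in> W"
  obtains r where "r > 0" "ball (\<phi> p) r \<subseteq> \<phi> ` (U \<inter> W)"
proof -
  have "open (\<phi> ` (U \<inter> W))" "\<phi> p \<in> \<phi> ` (U \<inter> W)"
    using max_chart_open_image[OF M c \<open>open W\<close>] assms by auto
  then show ?thesis using that open_contains_ball by blast
qed

lemma eventually_in_chart_ball:
  assumes c: "(U, \<phi>) \<in> max_atlas M" and "p \<in> U" "open S" "\<phi> p \<in> S"
  shows "\<forall>\<^sub>F q in nhds p. q \<in> U \<and> \<phi> q \<in> S"
  using eventually_nhds_in_open[OF max_chart_open_vimage[OF M c \<open>open S\<close>], of p] assms by simp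

text \<open>By the Hadamard lemma \<open>f\<close> is near \<open>p\<close> a constant plus a sum of products of two smooth functions,
  the first of which is a coordinate vanishing at \<open>p\<close>. The Leibniz rule reduces \<open>v f\<close> to the values
  of \<open>v\<close> on the coordinates.\<close>

lemma tangent_vector_eq_dder:
  assumes c: "(U, \<phi>) \<in> max_atlas M" and p: "p \<in> U" and v: "v \<in> tangent_space M p"
    and f: "smooth_near M p f"
  shows "v f = dder (f \<circ> inv_into U \<phi>) (\<phi> p) (coord_vec \<phi> v)"
proof -
  note inj = max_chartD(3)[OF M c]
  obtain W where W: "open W" "p \<in> W" "smooth_on (\<phi> ` (U \<inter> W)) (f \<circ> inv_into U \<phi>)"
    using f unfolding smooth_near_iff_chart[OF M c p] by blast
  obtain r where r: "r > 0" "ball (\<phi> p) r \<subseteq> \<phi> ` (U \<inter> W)" by (rule chart_ball[OF c p W(1,2)])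
  let ?F = "f \<circ> inv_into U \<phi>"
  obtain k where k: "\<And>b. smooth_on (ball (\<phi> p) r) (k b)"
    "\<And>x. x \<in> ball (\<phi> p) r \<Longrightarrow> ?F x = ?F (\<phi> p) + (\<Sum>b\<in>Basis. ((x - \<phi> p) \<bullet> b) * k b x)"
    using hadamard_lemma[OF smooth_on_subset[OF W(3) r(2)]] by metis
  have inball: "\<phi> p \<in> ball (\<phi> p) r" using r by simp
  have kn: "smooth_near M p (\<lambda>q. k b (\<phi> q))" for b
    by (rule smooth_near_chart_fun[OF M c p open_ball inball k(1)])
  have cn: "smooth_near M p (\<lambda>q. (\<phi> q - \<phi> p) \<bullet> b)" for b
    using smooth_near_add[OF M smooth_near_chart_coord[OF M c p] smooth_near_const[OF M], of b "- (\<phi> p \<bullet> b)"]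
    by (simp add: inner_diff_left)
  have vc: "v (\<lambda>q. (\<phi> q - \<phi> p) \<bullet> b) = coord_vec \<phi> v \<bullet> b" if "b \<in> Basis" for b
    using tangent_space_add[OF M v smooth_near_chart_coord[OF M c p] smooth_near_const[OF M], of b "- (\<phi> p \<bullet> b)"]
      that by (simp add: inner_diff_left tangent_space_const[OF M v] coord_vec_inner)
  have "\<forall>\<^sub>F q in nhds p. q \<in> U \<and> \<phi> q \<in> ball (\<phi> p) r"
    by (rule eventually_in_chart_ball[OF c p open_ball inball])
  then have "\<forall>\<^sub>F q in nhds p. f q = f p + (\<Sum>b\<in>Basis. ((\<phi> q - \<phi> p) \<bullet> b) * k b (\<phi> q))"
  proof eventually_elim
    case (elim q)
    with k(2)[of "\<phi> q"] inj p show ?case by simp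
  qed
  then have "v f = v (\<lambda>q. f p + (\<Sum>b\<in>Basis. ((\<phi> q - \<phi> p) \<bullet> b) * k b (\<phi> q)))"
    by (rule tangent_space_cong[OF M v])
  also have "\<dots> = (\<Sum>b\<in>Basis. (coord_vec \<phi> v \<bullet> b) * k b (\<phi> p))"
    by (simp add: tangent_space_add[OF M v] tangent_space_const[OF M v] tangent_space_sum[OF M v]
        tangent_space_mult[OF M v] smooth_near_sum[OF M] smooth_near_mult[OF M] smooth_near_const[OF M]
        kn cn vc mult.commute)
  also have "\<dots> = dder ?F (\<phi> p) (coord_vec \<phi> v)"
  proof -
    have "((\<lambda>x. ((x - \<phi> p) \<bullet> b) * k b x) has_derivative (\<lambda>h. (h \<bullet> b) * k b (\<phi> p))) (at (\<phi> p))" for b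
      using smooth_on_imp_has_derivative[OF k(1) inball, of b]
      by (auto intro!: derivative_eq_intros)
    then have "((\<lambda>x. ?F (\<phi> p) + (\<Sum>b\<in>Basis. ((x - \<phi> p) \<bullet> b) * k b x)) has_derivative
        (\<lambda>h. 0 + (\<Sum>b\<in>Basis. (h \<bullet> b) * k b (\<phi> p)))) (at (\<phi> p))"
      by (intro has_derivative_add has_derivative_const has_derivative_sum)
    then have "(?F has_derivative (\<lambda>h. 0 + (\<Sum>b\<in>Basis. (h \<bullet> b) * k b (\<phi> p)))) (at (\<phi> p))"
      by (rule has_derivative_transform_within_open[OF _ open_ball inball]) (simp only: k(2))
    from dder_unique[OF this] show ?thesis by simp
  qed
  finally show ?thesis .
qed

lemma coord_vec_inj:
  assumes c: "(U, \<phi>) \<in> max_atlas M" and p: "p \<in> U" and v: "v \<in> tangent_space M p" "w \<in> tangent_space M p"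
    and eq: "coord_vec \<phi> v = coord_vec \<phi> w"
  shows "v = w"
proof
  fix f
  show "v f = w f"
    using tangent_vector_eq_dder[OF c p v(1)] tangent_vector_eq_dder[OF c p v(2)] eq
      tangent_space_not_smooth[OF M v(1)] tangent_space_not_smooth[OF M v(2)]
    by (cases "smooth_near M p f") auto
qed

text \<open>The inverse of \<open>coord_vec\<close>: the tangent vector with given coordinates.\<close>

definition chart_vec :: "'m set \<Rightarrow> ('m \<Rightarrow> 'e) \<Rightarrow> 'm \<Rightarrow> 'e \<Rightarrow> 'm tvec" where
  "chart_vec U \<phi> p c = (\<lambda>f. if smooth_near M p f then dder (f \<circ> inv_into U \<phi>) (\<phi> p) c else 0)"

lemma chart_rep_has_derivative:
  assumes c: "(U, \<phi>) \<in> max_atlas M" and p: "p \<in> U" and f: "smooth_near M p f"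
  shows "((f \<circ> inv_into U \<phi>) has_derivative dder (f \<circ> inv_into U \<phi>) (\<phi> p)) (at (\<phi> p))"
proof -
  obtain W where W: "open W" "p \<in> W" "smooth_on (\<phi> ` (U \<inter> W)) (f \<circ> inv_into U \<phi>)"
    using f unfolding smooth_near_iff_chart[OF M c p] by blast
  then show ?thesis using p by (intro smooth_on_imp_has_derivative[OF W(3)]) auto
qed

lemma chart_vec_in_tangent_space:
  assumes c: "(U, \<phi>) \<in> max_atlas M" and p: "p \<in> U"
  shows "chart_vec U \<phi> p w \<in> tangent_space M p"
proof -
  note d = chart_rep_has_derivative[OF c p] and inj = max_chartD(3)[OF M c]
  have sc: "a *\<^sub>R f + b *\<^sub>R h = (\<lambda>q. a * f q + b * h q)" for a b and f h :: "'m \<Rightarrow> real"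
    by (simp add: scaleR_fun_def fun_eq_iff)
  have lin: "smooth_near M p (\<lambda>q. a * f q + b * h q)" if "smooth_near M p f" "smooth_near M p h" for f h a b
    using that by (intro smooth_near_add[OF M] smooth_near_mult[OF M] smooth_near_const[OF M])
  have "dder ((\<lambda>q. a * f q + b * h q) \<circ> inv_into U \<phi>) (\<phi> p) w
      = a * dder (f \<circ> inv_into U \<phi>) (\<phi> p) w + b * dder (h \<circ> inv_into U \<phi>) (\<phi> p) w"
    if "smooth_near M p f" "smooth_near M p h" for f h a b
  proof -
    have "((\<lambda>q. a * f q + b * h q) \<circ> inv_into U \<phi> has_derivative
      (\<lambda>w. a * dder (f \<circ> inv_into U \<phi>) (\<phi> p) w + b * dder (h \<circ> inv_into U \<phi>) (\<phi> p) w)) (at (\<phi> p))"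
      using d[OF that(1)] d[OF that(2)] unfolding o_def by (auto intro!: derivative_eq_intros)
    then show ?thesis by (rule dder_unique)
  qed
  moreover have "dder ((\<lambda>q. f q * h q) \<circ> inv_into U \<phi>) (\<phi> p) w
      = f p * dder (h \<circ> inv_into U \<phi>) (\<phi> p) w + h p * dder (f \<circ> inv_into U \<phi>) (\<phi> p) w"
    if "smooth_near M p f" "smooth_near M p h" for f h
  proof -
    have "((\<lambda>q. f q * h q) \<circ> inv_into U \<phi> has_derivative
      (\<lambda>w. f p * dder (h \<circ> inv_into U \<phi>) (\<phi> p) w + h p * dder (f \<circ> inv_into U \<phi>) (\<phi> p) w)) (at (\<phi> p))"
      using d[OF that(1)] d[OF that(2)] inj p unfolding o_def by (auto intro!: derivative_eq_intros)
    then show ?thesis by (rule dder_unique)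
  qed
  moreover have "dder (f \<circ> inv_into U \<phi>) (\<phi> p) w = dder (h \<circ> inv_into U \<phi>) (\<phi> p) w"
    if f: "smooth_near M p f" and eq: "\<forall>\<^sub>F q in nhds p. f q = h q" for f h
  proof -
    obtain W where W: "open W" "p \<in> W" "\<And>q. q \<in> W \<Longrightarrow> f q = h q" using eq unfolding eventually_nhds by blast
    have "(h \<circ> inv_into U \<phi> has_derivative dder (f \<circ> inv_into U \<phi>) (\<phi> p)) (at (\<phi> p))"
      by (rule has_derivative_transform_within_open[OF d[OF f] max_chart_open_image[OF M c W(1)]])
        (use W p inj in auto)
    from dder_unique[OF this] show ?thesis by simp
  qed
  ultimately show ?thesis
    unfolding tangent_space_def chart_vec_def linear_on_def mem_Collect_eq
    using smooth_near_cong[OF M] lin smooth_near_mult[OF M] unfolding sc times_fun_def by simp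
qed

lemma coord_vec_chart_vec:
  assumes c: "(U, \<phi>) \<in> max_atlas M" and p: "p \<in> U"
  shows "coord_vec \<phi> (chart_vec U \<phi> p w) = w"
proof (rule euclidean_eqI)
  fix b :: 'e assume b: "b \<in> Basis"
  have "((\<lambda>q. \<phi> q \<bullet> b) \<circ> inv_into U \<phi> has_derivative (\<lambda>w. w \<bullet> b)) (at (\<phi> p))"
    by (rule has_derivative_transform_within_open[of "\<lambda>x. x \<bullet> b", OF _ max_chartD(2)[OF M c]])
      (use p in \<open>auto intro!: derivative_eq_intros simp: f_inv_into_f\<close>)
  from dder_unique[OF this] show "coord_vec \<phi> (chart_vec U \<phi> p w) \<bullet> b = w \<bullet> b"
    using b smooth_near_chart_coord[OF M c p] by (simp add: coord_vec_inner chart_vec_def)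
qed

end

section \<open>Vector fields in charts\<close>

definition field_rep :: "'m set \<Rightarrow> ('m \<Rightarrow> 'e::euclidean_space) \<Rightarrow> 'm vfield \<Rightarrow> 'e \<Rightarrow> 'e" where
  "field_rep U \<phi> X x = coord_vec \<phi> (X (inv_into U \<phi> x))"

context
  fixes M :: "('m::{t2_space,second_countable_topology}, 'e::euclidean_space) atlas"
  assumes M: "smooth_manifold M"
begin

lemma vector_field_tangent: "vector_field M X \<Longrightarrow> X p \<in> tangent_space M p"
  unfolding vector_field_def section_along_def by simp

lemma vector_field_smooth_fun_on:
  assumes "vector_field M X" "open W" "smooth_fun_on M W f"
  shows "smooth_fun_on M W (\<lambda>p. X p f)"
proof -
  have "smooth_fun_on M (id -` W) (\<lambda>p. X p f)"
    using assms unfolding vector_field_def section_along_def by blast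
  then show ?thesis by simp
qed

lemma vector_field_smooth_near:
  "vector_field M X \<Longrightarrow> smooth_near M p f \<Longrightarrow> smooth_near M p (\<lambda>p. X p f)"
  unfolding smooth_near_def using vector_field_smooth_fun_on by blast

lemma field_rep_at:
  "(U, \<phi>) \<in> max_atlas M \<Longrightarrow> p \<in> U \<Longrightarrow> field_rep U \<phi> X (\<phi> p) = coord_vec \<phi> (X p)"
  using max_chartD(3)[OF M] by (simp add: field_rep_def)

lemma smooth_on_field_rep:
  assumes c: "(U, \<phi>) \<in> max_atlas M" and X: "vector_field M X"
  shows "smooth_on (\<phi> ` U) (field_rep U \<phi> X)"
proof (rule smooth_on_components)
  show "open (\<phi> ` U)" by (rule max_chartD(2)[OF M c])
  fix b :: 'e assume b: "b \<in> Basis"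
  have "smooth_on (\<phi> ` (U \<inter> U)) ((\<lambda>q. X q (\<lambda>q. \<phi> q \<bullet> b)) \<circ> inv_into U \<phi>)"
    by (rule smooth_fun_on_chart[OF M vector_field_smooth_fun_on[OF X] _ c])
      (use max_chartD(1)[OF M c] smooth_fun_on_chart_coord[OF M c] in auto)
  then show "smooth_on (\<phi> ` U) (\<lambda>x. field_rep U \<phi> X x \<bullet> b)"
    by (simp add: field_rep_def coord_vec_inner[OF b] o_def)
qed

text \<open>A vector field is smooth if its coordinates in one chart around each point are, because \<open>X f\<close> is
  the sum of products of these coordinates with the partial derivatives of \<open>f\<close>.\<close>

lemma vector_fieldI:
  assumes T: "\<And>p. X p \<in> tangent_space M p"
    and S: "\<And>p. \<exists>U \<phi> S. (U, \<phi>) \<in> max_atlas M \<and> p \<in> U \<and> open S \<and> \<phi> p \<in> S \<and> S \<subseteq> \<phi> ` U \<and> smooth_on S (field_rep U \<phi> X)"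
  shows "vector_field M X"
  unfolding vector_field_def section_along_def
proof (intro conjI allI impI)
  show "X p \<in> tangent_space M (id p)" for p using T by simp
  fix W f assume W: "open W" and f: "smooth_fun_on M W f"
  show "smooth_fun_on M (id -` W) (\<lambda>p. X p f)"
  proof (rule smooth_fun_onI[OF M])
    fix p assume p: "p \<in> id -` W"
    from S[of p] obtain U \<phi> S where c: "(U, \<phi>) \<in> max_atlas M"
      and S: "p \<in> U" "open S" "\<phi> p \<in> S" "S \<subseteq> \<phi> ` U" "smooth_on S (field_rep U \<phi> X)" by blast
    note inj = max_chartD(3)[OF M c]
    define W' where "W' = {q \<in> U. \<phi> q \<in> S} \<inter> W"
    have oW': "open W'" unfolding W'_def using max_chart_open_vimage[OF M c S(2)] W by blast
    have o: "open (\<phi> ` (U \<inter> W'))" by (rule max_chart_open_image[OF M c oW'])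
    have F: "smooth_on (\<phi> ` (U \<inter> W')) (f \<circ> inv_into U \<phi>)"
      using smooth_fun_on_chart[OF M f W c] by (rule smooth_on_subset) (auto simp: W'_def)
    have "smooth_on (\<phi> ` (U \<inter> W')) (field_rep U \<phi> X)"
      using S(5) by (rule smooth_on_subset) (auto simp: W'_def)
    then have "smooth_on (\<phi> ` (U \<inter> W')) (\<lambda>x. \<Sum>b\<in>Basis. (field_rep U \<phi> X x \<bullet> b) *\<^sub>R dder (f \<circ> inv_into U \<phi>) x b)"
      by (intro smooth_on_sum smooth_on_scaleR smooth_on_inner_left smooth_on_dder F o)
    moreover have "((\<lambda>p. X p f) \<circ> inv_into U \<phi>) x = (\<Sum>b\<in>Basis. (field_rep U \<phi> X x \<bullet> b) *\<^sub>R dder (f \<circ> inv_into U \<phi>) x b)"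
      if x: "x \<in> \<phi> ` (U \<inter> W')" for x
    proof -
      from x obtain q where q: "q \<in> U" "q \<in> W'" "x = \<phi> q" by auto
      have "smooth_near M q f" unfolding smooth_near_def using W f q by (auto simp: W'_def)
      from tangent_vector_eq_dder[OF M c q(1) T this]
      have "X q f = dder (f \<circ> inv_into U \<phi>) x (field_rep U \<phi> X x)"
        by (simp add: q field_rep_at[OF c])
      moreover have "dder (f \<circ> inv_into U \<phi>) x (field_rep U \<phi> X x) =
          (\<Sum>b\<in>Basis. (field_rep U \<phi> X x \<bullet> b) *\<^sub>R dder (f \<circ> inv_into U \<phi>) x b)"
        by (rule linear_eq_sum_Basis[OF dder_linear(1)[OF smooth_on_imp_differentiable[OF F x]]])
      ultimately show ?thesis using q inj by simp
    qed
    ultimately have "smooth_on (\<phi> ` (U \<inter> W')) ((\<lambda>p. X p f) \<circ> inv_into U \<phi>)"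
      by (rule smooth_on_eqI[OF o])
    moreover have "p \<in> U \<inter> W'" using p S by (simp add: W'_def)
    ultimately show "\<exists>U \<phi> W'. (U, \<phi>) \<in> max_atlas M \<and> open W' \<and> p \<in> U \<inter> W' \<and> smooth_on (\<phi> ` (U \<inter> W')) ((\<lambda>p. X p f) \<circ> inv_into U \<phi>)"
      using oW' c by blast
  qed
qed

lemma lie_bracket_coord:
  assumes c: "(U, \<phi>) \<in> max_atlas M" and p: "p \<in> U" and X: "vector_field M X" and Y: "vector_field M Y"
  shows "coord_vec \<phi> (lie_bracket M X Y p) =
    dder (field_rep U \<phi> Y) (\<phi> p) (coord_vec \<phi> (X p)) - dder (field_rep U \<phi> X) (\<phi> p) (coord_vec \<phi> (Y p))"
proof (rule euclidean_eqI)
  fix b :: 'e assume b: "b \<in> Basis"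
  have *: "X p (\<lambda>q. Y q (\<lambda>q. \<phi> q \<bullet> b)) = dder (field_rep U \<phi> Y) (\<phi> p) (coord_vec \<phi> (X p)) \<bullet> b"
    if X: "vector_field M X" and Y: "vector_field M Y" for X Y
  proof -
    have "X p (\<lambda>q. Y q (\<lambda>q. \<phi> q \<bullet> b)) =
        dder ((\<lambda>q. Y q (\<lambda>q. \<phi> q \<bullet> b)) \<circ> inv_into U \<phi>) (\<phi> p) (coord_vec \<phi> (X p))"
      by (rule tangent_vector_eq_dder[OF M c p vector_field_tangent[OF X]
            vector_field_smooth_near[OF Y smooth_near_chart_coord[OF M c p]]])
    also have "(\<lambda>q. Y q (\<lambda>q. \<phi> q \<bullet> b)) \<circ> inv_into U \<phi> = (\<lambda>x. field_rep U \<phi> Y x \<bullet> b)"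
      unfolding o_def field_rep_def coord_vec_inner[OF b] ..
    also have "dder \<dots> (\<phi> p) (coord_vec \<phi> (X p)) = dder (field_rep U \<phi> Y) (\<phi> p) (coord_vec \<phi> (X p)) \<bullet> b"
      by (rule dder_unique[OF bounded_linear.has_derivative[OF bounded_linear_inner_left
            smooth_on_imp_has_derivative[OF smooth_on_field_rep[OF c Y] imageI[OF p]]]])
    finally show ?thesis .
  qed
  show "coord_vec \<phi> (lie_bracket M X Y p) \<bullet> b = (dder (field_rep U \<phi> Y) (\<phi> p) (coord_vec \<phi> (X p)) -
      dder (field_rep U \<phi> X) (\<phi> p) (coord_vec \<phi> (Y p))) \<bullet> b"
    using smooth_near_chart_coord[OF M c p]
    by (simp add: coord_vec_inner[OF b] lie_bracket_def *[OF X Y] *[OF Y X] inner_diff_left)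
qed

definition cutoff_field :: "'m set \<Rightarrow> ('m \<Rightarrow> 'e) \<Rightarrow> ('e \<Rightarrow> real) \<Rightarrow> ('e \<Rightarrow> 'e) \<Rightarrow> 'm vfield" where
  "cutoff_field U \<phi> h c q = (if q \<in> U then chart_vec M U \<phi> q (h (\<phi> q) *\<^sub>R c (\<phi> q)) else 0)"

lemma coord_vec_cutoff_field:
  "(U, \<phi>) \<in> max_atlas M \<Longrightarrow> q \<in> U \<Longrightarrow> coord_vec \<phi> (cutoff_field U \<phi> h c q) = h (\<phi> q) *\<^sub>R c (\<phi> q)"
  by (simp add: cutoff_field_def coord_vec_chart_vec[OF M])

text \<open>The field vanishes off the image of \<open>K\<close>. This image is compact, hence closed in the Hausdorff
  space, so that the complement is open and the extension by 0 is smooth.\<close>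

lemma vector_field_cutoff_field:
  assumes c: "(U, \<phi>) \<in> max_atlas M" and h: "smooth_on UNIV h" and K: "\<And>x. x \<notin> K \<Longrightarrow> h x = 0"
    and "compact K" "K \<subseteq> S" "open S" "S \<subseteq> \<phi> ` U" and w: "smooth_on S w"
  shows "vector_field M (cutoff_field U \<phi> h w)"
proof (rule vector_fieldI)
  show tangent: "cutoff_field U \<phi> h w p \<in> tangent_space M p" for p
    by (simp add: cutoff_field_def chart_vec_in_tangent_space[OF M c] zero_in_tangent_space[OF M])
  note inj = max_chartD(3)[OF M c]
  fix p
  show "\<exists>U' \<phi>' S. (U', \<phi>') \<in> max_atlas M \<and> p \<in> U' \<and> open S \<and> \<phi>' p \<in> S \<and> S \<subseteq> \<phi>' ` U' \<and>
      smooth_on S (field_rep U' \<phi>' (cutoff_field U \<phi> h w))"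
  proof (cases "p \<in> U \<and> \<phi> p \<in> S")
    case True
    have "smooth_on S (\<lambda>x. h x *\<^sub>R w x)"
      using \<open>open S\<close> h w by (intro smooth_on_scaleR) (auto elim: smooth_on_subset)
    moreover have "field_rep U \<phi> (cutoff_field U \<phi> h w) x = h x *\<^sub>R w x" if x: "x \<in> S" for x
    proof -
      from x \<open>S \<subseteq> \<phi> ` U\<close> obtain q where "q \<in> U" "x = \<phi> q" by auto
      then show ?thesis by (simp add: field_rep_at[OF c] coord_vec_cutoff_field[OF c])
    qed
    ultimately have "smooth_on S (field_rep U \<phi> (cutoff_field U \<phi> h w))"
      by (rule smooth_on_eqI[OF \<open>open S\<close>])
    then show ?thesis using c True \<open>open S\<close> \<open>S \<subseteq> \<phi> ` U\<close> by blast
  next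
    case False
    define K' where "K' = inv_into U \<phi> ` K"
    have "compact K'"
      unfolding K'_def
      by (rule compact_continuous_image[OF continuous_on_subset[OF max_chartD(5)[OF M c]] \<open>compact K\<close>])
        (use \<open>K \<subseteq> S\<close> \<open>S \<subseteq> \<phi> ` U\<close> in blast)
    then have o: "open (- K')" by (simp add: compact_imp_closed open_Compl)
    have vanish: "cutoff_field U \<phi> h w q = 0" if "q \<notin> K'" for q
    proof (cases "q \<in> U")
      case True
      then have "\<phi> q \<notin> K" using that inj by (force simp: K'_def)
      then have "coord_vec \<phi> (cutoff_field U \<phi> h w q) = coord_vec \<phi> 0"
        by (simp add: coord_vec_cutoff_field[OF c True] K linear_0[OF coord_vec_linear])
      then show ?thesis by (rule coord_vec_inj[OF M c True tangent zero_in_tangent_space[OF M]])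
    qed (simp add: cutoff_field_def)
    have "p \<notin> K'"
    proof
      assume "p \<in> K'"
      then obtain x where x: "x \<in> K" "p = inv_into U \<phi> x" by (auto simp: K'_def)
      with \<open>K \<subseteq> S\<close> \<open>S \<subseteq> \<phi> ` U\<close> have "x \<in> \<phi> ` U" by blast
      with x \<open>K \<subseteq> S\<close> False show False by (auto simp: inv_into_into f_inv_into_f)
    qed
    obtain V \<psi> where "(V, \<psi>) \<in> M" and V: "p \<in> V" by (rule chart_at[OF M])
    then have d: "(V, \<psi>) \<in> max_atlas M" using atlas_subset_max_atlas[OF M] by blast
    have o': "open (\<psi> ` (V \<inter> - K'))" by (rule max_chart_open_image[OF M d o])
    have "field_rep V \<psi> (cutoff_field U \<phi> h w) x = 0" if "x \<in> \<psi> ` (V \<inter> - K')" for x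
      using that max_chartD(3)[OF M d] by (auto simp: field_rep_def vanish linear_0[OF coord_vec_linear])
    then have "smooth_on (\<psi> ` (V \<inter> - K')) (field_rep V \<psi> (cutoff_field U \<phi> h w))"
      using smooth_on_cong[OF o', of "field_rep V \<psi> (cutoff_field U \<phi> h w)" "\<lambda>_. 0"] by simp
    moreover have "\<psi> p \<in> \<psi> ` (V \<inter> - K')" "\<psi> ` (V \<inter> - K') \<subseteq> \<psi> ` V" using V \<open>p \<notin> K'\<close> by auto
    ultimately show ?thesis using d V o' by blast
  qed
qed

lemma tangent_vector_extends:
  assumes v: "v \<in> tangent_space M p"
  obtains X where "vector_field M X" "X p = v"
proof -
  obtain U \<phi> where "(U, \<phi>) \<in> M" and p: "p \<in> U" by (rule chart_at[OF M])
  then have c: "(U, \<phi>) \<in> max_atlas M" using atlas_subset_max_atlas[OF M] by blast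
  note o = max_chartD(2)[OF M c]
  obtain r where r: "r > 0" "cball (\<phi> p) r \<subseteq> \<phi> ` U" using o p open_contains_cball by blast
  obtain h :: "'e \<Rightarrow> real" where h: "smooth_on UNIV h" "\<And>x. x \<in> ball (\<phi> p) r \<Longrightarrow> h x > 0"
    "\<And>x. x \<notin> ball (\<phi> p) r \<Longrightarrow> h x = 0"
    using bump_function[OF r(1)] by metis
  let ?w = "coord_vec \<phi> v /\<^sub>R h (\<phi> p)"
  let ?X = "cutoff_field U \<phi> h (\<lambda>_. ?w)"
  have X: "vector_field M ?X"
    by (rule vector_field_cutoff_field[OF c h(1), of "cball (\<phi> p) r" "\<phi> ` U"]) (use h(3) r o in auto)
  have "h (\<phi> p) \<noteq> 0" using h(2)[of "\<phi> p"] r by simp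
  then have "coord_vec \<phi> (?X p) = coord_vec \<phi> v"
    by (simp add: coord_vec_cutoff_field[OF c p])
  then have "?X p = v" by (rule coord_vec_inj[OF M c p vector_field_tangent[OF X] v])
  with X show ?thesis by (rule that)
qed

end

section \<open>The differential in charts\<close>

lemma differential_linear: "linear (differential N F p)"
  by standard (auto simp: differential_def fun_eq_iff scaleR_fun_def)

context
  fixes M :: "('m::{t2_space,second_countable_topology}, 'e::euclidean_space) atlas"
    and N :: "('n::{t2_space,second_countable_topology}, 'f::euclidean_space) atlas"
    and F :: "'m \<Rightarrow> 'n"
  assumes M: "smooth_manifold M" and N: "smooth_manifold N" and F: "smooth_map M N F"
begin

lemma open_vimage_smooth_map: "open V \<Longrightarrow> open (F -` V)"
  using F by (simp add: smooth_map_def continuous_on_open_vimage)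

lemma smooth_map_chart:
  assumes c: "(U, \<phi>) \<in> max_atlas M" and d: "(V, \<psi>) \<in> N"
  shows "smooth_on (\<phi> ` (U \<inter> F -` V)) (\<psi> \<circ> F \<circ> inv_into U \<phi>)"
proof -
  have oV: "open (F -` V)"
    using open_vimage_smooth_map max_chartD(1)[OF N] d atlas_subset_max_atlas[OF N] by blast
  have "smooth_on (\<alpha> ` (A \<inter> F -` V)) ((\<psi> \<circ> F) \<circ> inv_into A \<alpha>)" if "(A, \<alpha>) \<in> M" for A \<alpha>
    using F that d unfolding smooth_map_def by fastforce
  from smooth_in_max_chart[OF M this oV c] show ?thesis .
qed

lemma smooth_near_pullback:
  assumes f: "smooth_near N (F p) f"
  shows "smooth_near M p (f \<circ> F)"
proof -
  obtain U \<phi> where "(U, \<phi>) \<in> M" and p: "p \<in> U" by (rule chart_at[OF M])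
  then have c: "(U, \<phi>) \<in> max_atlas M" using atlas_subset_max_atlas[OF M] by blast
  obtain V \<psi> where V: "(V, \<psi>) \<in> N" "F p \<in> V" by (rule chart_at[OF N])
  then have d: "(V, \<psi>) \<in> max_atlas N" using atlas_subset_max_atlas[OF N] by blast
  obtain W where W: "open W" "F p \<in> W" "smooth_on (\<psi> ` (V \<inter> W)) (f \<circ> inv_into V \<psi>)"
    using f unfolding smooth_near_iff_chart[OF N d V(2)] by blast
  define W' where "W' = F -` (V \<inter> W)"
  have oW': "open W'" unfolding W'_def using open_vimage_smooth_map max_chartD(1)[OF N d] W(1) by blast
  note o = max_chart_open_image[OF M c oW']
  have "smooth_on (\<phi> ` (U \<inter> W')) (\<lambda>x. (f \<circ> inv_into V \<psi>) ((\<psi> \<circ> F \<circ> inv_into U \<phi>) x))"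
    by (rule smooth_on_compose[OF W(3) smooth_on_subset[OF smooth_map_chart[OF c V(1)]]])
      (use o max_chart_open_image[OF N d W(1)] max_chartD(3)[OF M c] in \<open>auto simp: W'_def\<close>)
  then have "smooth_on (\<phi> ` (U \<inter> W')) ((f \<circ> F) \<circ> inv_into U \<phi>)"
    by (subst smooth_on_cong[OF o, where g = "\<lambda>x. (f \<circ> inv_into V \<psi>) ((\<psi> \<circ> F \<circ> inv_into U \<phi>) x)"])
      (use max_chartD(3)[OF M c] max_chartD(3)[OF N d] in \<open>auto simp: W'_def\<close>)
  then show ?thesis
    unfolding smooth_near_iff_chart[OF M c p] using oW' W V by (intro exI[of _ W']) (auto simp: W'_def)
qed

lemma coord_vec_differential:
  assumes c: "(U, \<phi>) \<in> max_atlas M" and d: "(V, \<psi>) \<in> N" and p: "p \<in> U" "F p \<in> V"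
    and v: "v \<in> tangent_space M p"
  shows "coord_vec \<psi> (differential N F p v) = dder (\<psi> \<circ> F \<circ> inv_into U \<phi>) (\<phi> p) (coord_vec \<phi> v)"
proof (rule euclidean_eqI)
  fix b :: 'f assume b: "b \<in> Basis"
  have d': "(V, \<psi>) \<in> max_atlas N" using d atlas_subset_max_atlas[OF N] by blast
  note sn = smooth_near_chart_coord[OF N d' p(2), of b]
  have x: "\<phi> p \<in> \<phi> ` (U \<inter> F -` V)" using p by auto
  have "coord_vec \<psi> (differential N F p v) \<bullet> b = v ((\<lambda>q. \<psi> q \<bullet> b) \<circ> F)"
    using sn by (simp add: coord_vec_inner[OF b] differential_def)
  also have "\<dots> = dder ((\<lambda>q. \<psi> q \<bullet> b) \<circ> F \<circ> inv_into U \<phi>) (\<phi> p) (coord_vec \<phi> v)"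
    by (rule tangent_vector_eq_dder[OF M c p(1) v smooth_near_pullback[OF sn]])
  also have "(\<lambda>q. \<psi> q \<bullet> b) \<circ> F \<circ> inv_into U \<phi> = (\<lambda>x. (\<psi> \<circ> F \<circ> inv_into U \<phi>) x \<bullet> b)" by (simp add: fun_eq_iff)
  also have "dder \<dots> (\<phi> p) (coord_vec \<phi> v) = dder (\<psi> \<circ> F \<circ> inv_into U \<phi>) (\<phi> p) (coord_vec \<phi> v) \<bullet> b"
    by (rule dder_unique[OF bounded_linear.has_derivative[OF bounded_linear_inner_left
          smooth_on_imp_has_derivative[OF smooth_map_chart[OF c d] x]]])
  finally show "coord_vec \<psi> (differential N F p v) \<bullet> b =
      dder (\<psi> \<circ> F \<circ> inv_into U \<phi>) (\<phi> p) (coord_vec \<phi> v) \<bullet> b" .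
qed

lemma section_along_zero: "section_along M N F (\<lambda>q. 0)"
  unfolding section_along_def using zero_in_tangent_space[OF N] by (simp add: smooth_fun_on_def o_def)

end

section \<open>Orthogonal projections in tangent spaces\<close>

text \<open>Pull back a basis of the image of \<open>S\<close> in the coordinate space; this is where tangent spaces turn
  out to be finite-dimensional.\<close>

lemma finite_spanning_set:
  fixes M :: "('m::{t2_space,second_countable_topology}, 'e::euclidean_space) atlas"
  assumes M: "smooth_manifold M" and S: "subspace S" "S \<subseteq> tangent_space M p"
  obtains B where "finite B" "span B = S"
proof -
  obtain U \<phi> where "(U, \<phi>) \<in> M" and p: "p \<in> U" by (rule chart_at[OF M])
  then have c: "(U, \<phi>) \<in> max_atlas M" using atlas_subset_max_atlas[OF M] by blast
  have "subspace (coord_vec \<phi> ` S)" by (rule linear_subspace_image[OF coord_vec_linear S(1)])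
  then obtain B' where B': "B' \<subseteq> coord_vec \<phi> ` S" "finite B'" "span B' = coord_vec \<phi> ` S"
    by (metis basis_exists finiteI_independent span_subspace)
  then obtain B where B: "B \<subseteq> S" "finite B" "B' = coord_vec \<phi> ` B"
    using finite_subset_image by metis
  have "span B \<subseteq> S" using B S(1) by (simp add: span_minimal)
  moreover have "S \<subseteq> span B"
  proof
    fix v assume v: "v \<in> S"
    then have "coord_vec \<phi> v \<in> coord_vec \<phi> ` span B"
      using B' B(3) linear_span_image[OF coord_vec_linear] by blast
    then obtain w where w: "w \<in> span B" "coord_vec \<phi> v = coord_vec \<phi> w" by auto
    then have "v = w"
      using v S(2) \<open>span B \<subseteq> S\<close> by (intro coord_vec_inj[OF M c p]) auto
    with w show "v \<in> span B" by simp
  qed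
  ultimately show ?thesis using that B(2) by blast
qed

lemma max_atlas_memI: "smooth_manifold M \<Longrightarrow> c \<in> M \<Longrightarrow> c \<in> max_atlas M"
  using atlas_subset_max_atlas by blast

context
  fixes M :: "('m::{t2_space,second_countable_topology}, 'e::euclidean_space) atlas" and g :: "'m metric"
  assumes M: "smooth_manifold M" and g: "riemannian_metric M g"
begin

lemmas subspace_T = subspace_tangent_space[OF M]

lemma metric_right: 
  assumes "v \<in> tangent_space M p" "w \<in> tangent_space M p" "u \<in> tangent_space M p"
  shows "g p v (w + u) = g p v w + g p v u" "g p v (w - u) = g p v w - g p v u"
proof -
  have l: "g p v (a *\<^sub>R w + b *\<^sub>R u) = a * g p v w + b * g p v u" for a b
    using g assms unfolding riemannian_metric_def linear_on_def by simp
  show "g p v (w + u) = g p v w + g p v u" "g p v (w - u) = g p v w - g p v u"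
    using l[of 1 1] l[of 1 "-1"] by simp_all
qed

lemma metric_scale_right:
  assumes "v \<in> tangent_space M p" "w \<in> tangent_space M p"
  shows "g p v (a *\<^sub>R w) = a * g p v w"
proof -
  have "g p v (a *\<^sub>R w + 0 *\<^sub>R w) = a * g p v w + 0 * g p v w"
    using g assms unfolding riemannian_metric_def linear_on_def by (metis real_scaleR_def)
  then show ?thesis by simp
qed

lemma metric_minus_right: "v \<in> tangent_space M p \<Longrightarrow> w \<in> tangent_space M p \<Longrightarrow> g p v (- w) = - g p v w"
  using metric_scale_right[of v p w "-1"] by simp

lemma metric_sym: "v \<in> tangent_space M p \<Longrightarrow> w \<in> tangent_space M p \<Longrightarrow> g p v w = g p w v"
  using g unfolding riemannian_metric_def by blast

lemma metric_zero_right: "v \<in> tangent_space M p \<Longrightarrow> g p v 0 = 0"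
  using metric_scale_right[of v p v 0] by simp

lemma metric_left:
  assumes "v \<in> tangent_space M p" "w \<in> tangent_space M p" "u \<in> tangent_space M p"
  shows "g p (w + u) v = g p w v + g p u v" "g p (w - u) v = g p w v - g p u v"
  using metric_right[OF assms] assms subspace_add[OF subspace_T assms(2,3)] subspace_diff[OF subspace_T assms(2,3)]
  by (simp_all add: metric_sym[of _ p v])

lemma metric_scale_left: "v \<in> tangent_space M p \<Longrightarrow> w \<in> tangent_space M p \<Longrightarrow> g p (a *\<^sub>R w) v = a * g p w v"
  using metric_scale_right[of v p w a] subspace_scale[OF subspace_T, of w p a] by (simp add: metric_sym[of _ p v])

lemma metric_minus_left: "v \<in> tangent_space M p \<Longrightarrow> w \<in> tangent_space M p \<Longrightarrow> g p (- w) v = - g p w v"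
  using metric_scale_left[of v p w "-1"] by simp

lemma metric_zero_left: "v \<in> tangent_space M p \<Longrightarrow> g p 0 v = 0"
  using metric_scale_left[of v p v 0] by simp

lemma metric_definite:
  assumes "v \<in> tangent_space M p" "g p v v = 0"
  shows "v = 0"
proof -
  have "v \<noteq> 0 \<longrightarrow> g p v v > 0" using g assms(1) unfolding riemannian_metric_def by blast
  with assms(2) show ?thesis by auto
qed

text \<open>Gram--Schmidt orthogonalisation along a finite spanning set.\<close>

lemma orthogonal_projection_exists:
  assumes S: "subspace S" "S \<subseteq> tangent_space M p" and v: "v \<in> tangent_space M p"
  obtains w where "w \<in> S" "\<And>u. u \<in> S \<Longrightarrow> g p (v - w) u = 0"
proof -
  obtain B where B: "finite B" "span B = S" by (rule finite_spanning_set[OF M S])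
  have ex: "\<exists>w\<in>span B. \<forall>u\<in>B. g p (v - w) u = 0" if "finite B" "B \<subseteq> tangent_space M p" "v \<in> tangent_space M p" for B v
    using that
  proof (induction B arbitrary: v)
    case empty
    then show ?case by (auto intro: bexI[of _ 0])
  next
    case (insert s B)
    have sub: "span B \<subseteq> tangent_space M p" using insert.prems span_minimal[OF _ subspace_T] by blast
    obtain w1 where w1: "w1 \<in> span B" "\<And>u. u \<in> B \<Longrightarrow> g p (v - w1) u = 0" using insert by blast
    obtain w2 where w2: "w2 \<in> span B" "\<And>u. u \<in> B \<Longrightarrow> g p (s - w2) u = 0" using insert by blast
    define s' where "s' = s - w2"
    define v' where "v' = v - w1"
    have T: "s' \<in> tangent_space M p" "v' \<in> tangent_space M p" "w1 \<in> tangent_space M p" "w2 \<in> tangent_space M p" "s \<in> tangent_space M p" "v \<in> tangent_space M p"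
      unfolding s'_def v'_def using insert.prems w1 w2 sub subspace_diff[OF subspace_T] by auto
    have perp: "g p x w2 = 0" if "x \<in> tangent_space M p" "\<And>u. u \<in> B \<Longrightarrow> g p x u = 0" for x
    proof -
      have "subspace {u \<in> tangent_space M p. g p x u = 0}"
        using that(1) subspace_T
        by (auto simp: subspace_def metric_right metric_scale_right metric_zero_right)
      moreover have "B \<subseteq> {u \<in> tangent_space M p. g p x u = 0}" using that insert.prems by auto
      ultimately show ?thesis using w2(1) span_minimal by blast
    qed
    define c where "c = g p v' s' / g p s' s'"
    have cT: "c *\<^sub>R s' \<in> tangent_space M p" using T subspace_scale[OF subspace_T] by blast
    have c: "c * g p s' s' = g p v' s'"
    proof (cases "s' = 0")
      case True
      then show ?thesis using T by (simp add: metric_zero_right)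
    next
      case False
      then have "g p s' s' \<noteq> 0" using metric_definite T by blast
      then show ?thesis by (simp add: c_def)
    qed
    have eq: "v - (w1 + c *\<^sub>R s') = v' - c *\<^sub>R s'" by (simp add: v'_def)
    have in_B: "g p (v' - c *\<^sub>R s') u = 0" if "u \<in> B" for u
    proof -
      have "u \<in> tangent_space M p" using that insert.prems by auto
      then show ?thesis
        using w1(2)[OF that] w2(2)[OF that] T cT
        by (simp add: metric_left metric_scale_left flip: s'_def v'_def)
    qed
    have vcT: "v' - c *\<^sub>R s' \<in> tangent_space M p" using T cT subspace_diff[OF subspace_T] by blast
    have "g p (v' - c *\<^sub>R s') s = g p (v' - c *\<^sub>R s') s' + g p (v' - c *\<^sub>R s') w2"
      using metric_right(1)[OF vcT T(1) T(4)] by (simp add: s'_def)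
    also have "\<dots> = 0"
      using perp[OF vcT in_B] T cT c by (simp add: metric_left metric_scale_left)
    finally have "\<forall>u\<in>insert s B. g p (v - (w1 + c *\<^sub>R s')) u = 0" using in_B unfolding eq by blast
    moreover have "w1 + c *\<^sub>R s' \<in> span (insert s B)"
      unfolding s'_def using w1(1) w2(1)
      by (intro span_add span_scale span_diff) (auto intro: span_base subsetD[OF span_mono[of B "insert s B"]])
    ultimately show ?case by blast
  qed
  have "B \<subseteq> tangent_space M p" using B S span_superset by blast
  from ex[OF B(1) this v] obtain w where w: "w \<in> S" "\<And>u. u \<in> B \<Longrightarrow> g p (v - w) u = 0"
    using B(2) by blast
  have vw: "v - w \<in> tangent_space M p" using v w S subspace_diff[OF subspace_T] by blast
  have "subspace {u \<in> tangent_space M p. g p (v - w) u = 0}"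
    using vw subspace_T by (auto simp: subspace_def metric_right metric_scale_right metric_zero_right)
  moreover have "B \<subseteq> {u \<in> tangent_space M p. g p (v - w) u = 0}" using w \<open>B \<subseteq> tangent_space M p\<close> by auto
  ultimately have "S \<subseteq> {u \<in> tangent_space M p. g p (v - w) u = 0}" using B span_minimal by blast
  with w that show ?thesis by blast
qed

lemma orth_proj_eqI:
  assumes S: "subspace S" "S \<subseteq> tangent_space M p" and v: "v \<in> tangent_space M p"
    and w: "w \<in> S" "\<And>u. u \<in> S \<Longrightarrow> g p (v - w) u = 0"
  shows "orth_proj g p S v = w"
  unfolding orth_proj_def
proof (rule the_equality)
  show "w \<in> S \<and> (\<forall>u\<in>S. g p (v - w) u = 0)" using w by blast
  fix w' assume w': "w' \<in> S \<and> (\<forall>u\<in>S. g p (v - w') u = 0)"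
  have d: "w - w' \<in> S" "w - w' \<in> tangent_space M p" using w w' S subspace_diff by blast+
  have T: "v - w \<in> tangent_space M p" "v - w' \<in> tangent_space M p"
    using v w(1) w' S subspace_diff[OF subspace_T] by blast+
  have "g p ((v - w') - (v - w)) (w - w') = 0"
    using metric_left(2)[OF d(2) T(2) T(1)] w(2)[OF d(1)] w' d(1) by simp
  then have "g p (w - w') (w - w') = 0" by simp
  then show "w' = w" using metric_definite[OF d(2)] by simp
qed

end

section \<open>The covariant derivative of the complex structure\<close>

text \<open>By additivity; sections with value 0 arise as images of vertical fields under the differential.\<close>

lemma connection_zero_section:
  fixes F :: "'m::topological_space \<Rightarrow> 'n::topological_space"
  assumes "connection_along M N F D" "section_along M N F (\<lambda>q. 0)" "v \<in> tangent_space M p"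
  shows "D p v (\<lambda>q. 0) = 0"
proof -
  have "D p v ((\<lambda>q. 0) + (\<lambda>q. 0)) = D p v (\<lambda>q. 0) + D p v (\<lambda>q. 0)"
    using assms unfolding connection_along_def by blast
  moreover have "(\<lambda>q. 0) + (\<lambda>q. 0) = ((\<lambda>q. 0) :: 'm \<Rightarrow> 'n tvec)" by (simp add: fun_eq_iff)
  ultimately have "D p v (\<lambda>q. 0) = D p v (\<lambda>q. 0) + D p v (\<lambda>q. 0)" by simp
  then show ?thesis by (simp only: add_cancel_right_right)
qed

locale lck_with_connection =
  fixes M :: "('m::{t2_space,second_countable_topology}, 'e::euclidean_space) atlas"
    and g :: "'m metric" and J :: "'m \<Rightarrow> 'm tvec \<Rightarrow> 'm tvec"
    and \<omega> :: "'m \<Rightarrow> 'm tvec \<Rightarrow> real" and nabla :: "('m, 'm) connection"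
  assumes lck: "lck_manifold M g J \<omega>" and lc: "levi_civita M g nabla"
begin

lemma smooth_M: "smooth_manifold M" and metric: "riemannian_metric M g"
  and complex: "complex_structure M J" and acs: "almost_complex_structure M J"
  using lck unfolding lck_manifold_def hermitian_manifold_def riemannian_manifold_def complex_structure_def by blast+

lemmas subspace_T = subspace_tangent_space[OF smooth_M]
lemmas T_add = subspace_add[OF subspace_T]
lemmas T_diff = subspace_diff[OF subspace_T]
lemmas g_left = metric_left[OF smooth_M metric]
lemmas g_scale_left = metric_scale_left[OF smooth_M metric]
lemmas g_minus_right = metric_minus_right[OF smooth_M metric]
lemmas g_minus_left = metric_minus_left[OF smooth_M metric]
lemmas g_sym = metric_sym[OF smooth_M metric]
lemmas field_T = vector_field_tangent[OF smooth_M]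

lemma J_T: "v \<in> tangent_space M p \<Longrightarrow> J p v \<in> tangent_space M p"
  and J_J: "v \<in> tangent_space M p \<Longrightarrow> J p (J p v) = - v"
  using acs unfolding almost_complex_structure_def by blast+

lemma J_lin: "v \<in> tangent_space M p \<Longrightarrow> w \<in> tangent_space M p \<Longrightarrow> J p (a *\<^sub>R v + b *\<^sub>R w) = a *\<^sub>R J p v + b *\<^sub>R J p w"
  using acs unfolding almost_complex_structure_def linear_on_def by blast

lemma J_diff: "v \<in> tangent_space M p \<Longrightarrow> w \<in> tangent_space M p \<Longrightarrow> J p (v - w) = J p v - J p w"
  using J_lin[of v p w 1 "-1"] by simp

lemma g_J_J: "v \<in> tangent_space M p \<Longrightarrow> w \<in> tangent_space M p \<Longrightarrow> g p (J p v) (J p w) = g p v w"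
  using lck unfolding lck_manifold_def hermitian_manifold_def by blast

lemma g_J: "v \<in> tangent_space M p \<Longrightarrow> w \<in> tangent_space M p \<Longrightarrow> g p (J p v) w = - g p v (J p w)"
  using g_J_J[of v p "J p w"] by (simp add: J_J J_T g_minus_right)

text \<open>A constant rather than an abbreviation, so that \<open>JF X p\<close> stays the value at \<open>p\<close> of a field when
  rewriting.\<close>

definition JF :: "'m vfield \<Rightarrow> 'm vfield" where "JF X = (\<lambda>q. J q (X q))"

lemma JF_apply: "JF X q = J q (X q)" by (simp add: JF_def)

lemma JF_field: "vector_field M X \<Longrightarrow> vector_field M (JF X)"
  using acs unfolding almost_complex_structure_def JF_def by blast

lemma connection: "connection_along M M id nabla"
  using lc unfolding levi_civita_def by blast

lemma nabla_T:
  assumes "vector_field M X" "vector_field M Y"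
  shows "nabla p (X p) Y \<in> tangent_space M p"
proof -
  have "vector_field M (\<lambda>p. nabla p (X p) Y)"
    using connection assms unfolding connection_along_def vector_field_def by blast
  then show ?thesis by (rule field_T)
qed

lemma torsion_free: "vector_field M X \<Longrightarrow> vector_field M Y \<Longrightarrow>
    lie_bracket M X Y p = nabla p (X p) Y - nabla p (Y p) X"
  using lc unfolding levi_civita_def by simp

lemma bracket_T: "vector_field M X \<Longrightarrow> vector_field M Y \<Longrightarrow> lie_bracket M X Y p \<in> tangent_space M p"
  by (simp add: torsion_free nabla_T T_diff)

lemma zero_section: "section_along M M id (\<lambda>q. 0)"
  unfolding section_along_def using zero_in_tangent_space[OF smooth_M] by (simp add: smooth_fun_on_def o_def)

lemma JF_JF: "vector_field M X \<Longrightarrow> JF (JF X) = (\<lambda>q. - X q)"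
  by (simp add: fun_eq_iff[of "JF (JF X)"] JF_apply J_J field_T)

lemma nabla_uminus:
  assumes "vector_field M X" "vector_field M Y"
  shows "nabla p (X p) (\<lambda>q. - Y q) = - nabla p (X p) Y"
proof -
  have s: "section_along M M id Y" "section_along M M id (\<lambda>q. - Y q)"
    using assms(2) JF_field[OF JF_field[OF assms(2)]] JF_JF[OF assms(2)] by (simp_all add: vector_field_def)
  have "nabla p (X p) (Y + (\<lambda>q. - Y q)) = nabla p (X p) Y + nabla p (X p) (\<lambda>q. - Y q)"
    using connection s field_T[OF assms(1)] unfolding connection_along_def by blast
  moreover have "Y + (\<lambda>q. - Y q) = (\<lambda>q. 0)" by (simp add: fun_eq_iff)
  ultimately show ?thesis
    using connection_zero_section[OF connection zero_section field_T[OF assms(1)], of p]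
    by (metis eq_neg_iff_add_eq_0 add.commute)
qed

text \<open>Christoffel symbols of the first kind, for arbitrary vector fields.\<close>

definition \<Gamma> :: "'m \<Rightarrow> 'm vfield \<Rightarrow> 'm vfield \<Rightarrow> 'm vfield \<Rightarrow> real" where
  "\<Gamma> p A B C = g p (nabla p (A p) B) (C p)"

lemma metric_compatible:
  assumes "vector_field M A" "vector_field M B" "vector_field M C"
  shows "A p (\<lambda>q. g q (B q) (C q)) = \<Gamma> p A B C + \<Gamma> p A C B"
proof -
  have "A p (\<lambda>q. g q (B q) (C q)) = g p (nabla p (A p) B) (C p) + g p (B p) (nabla p (A p) C)"
    using lc assms field_T[OF assms(1)] unfolding levi_civita_def by blast
  then show ?thesis
    using g_sym[OF field_T[OF assms(2)] nabla_T[OF assms(1,3)]] by (simp add: \<Gamma>_def)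
qed

lemma bracket_inner:
  assumes "vector_field M A" "vector_field M B" "vector_field M C"
  shows "g p (lie_bracket M A B p) (C p) = \<Gamma> p A B C - \<Gamma> p B A C"
  using assms by (simp add: torsion_free \<Gamma>_def g_left field_T nabla_T)

lemma \<Gamma>_uminus:
  assumes "vector_field M A" "vector_field M B" "vector_field M C"
  shows "\<Gamma> p A (\<lambda>q. - B q) C = - \<Gamma> p A B C" "\<Gamma> p A B (\<lambda>q. - C q) = - \<Gamma> p A B C"
  using assms by (simp_all add: \<Gamma>_def nabla_uminus g_minus_left g_minus_right field_T nabla_T)

lemma \<Gamma>_JF_JF:
  assumes "vector_field M A" "vector_field M B" "vector_field M C"
  shows "\<Gamma> p A (JF B) (JF C) + \<Gamma> p A (JF C) (JF B) = \<Gamma> p A B C + \<Gamma> p A C B"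
proof -
  have "(\<lambda>q. g q (JF B q) (JF C q)) = (\<lambda>q. g q (B q) (C q))" using assms by (simp add: JF_apply g_J_J field_T)
  then show ?thesis
    using metric_compatible[OF assms(1) JF_field[OF assms(2)] JF_field[OF assms(3)]] metric_compatible[OF assms] by simp
qed

lemma \<Gamma>_JF:
  assumes "vector_field M A" "vector_field M B" "vector_field M C"
  shows "\<Gamma> p A (JF B) C + \<Gamma> p A C (JF B) + \<Gamma> p A B (JF C) + \<Gamma> p A (JF C) B = 0"
  using \<Gamma>_JF_JF[OF assms(1) JF_field[OF assms(2)] assms(3), of p] assms
  by (simp add: JF_JF \<Gamma>_uminus JF_field)

lemma ext_deriv2_fundamental_form:
  assumes "vector_field M X" "vector_field M Y" "vector_field M Z"
  shows "ext_deriv2 M (fundamental_form g J) X Y Z p =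
    \<Gamma> p X (JF Z) Y + \<Gamma> p Y (JF X) Z + \<Gamma> p Z (JF Y) X + \<Gamma> p Y X (JF Z) + \<Gamma> p Z Y (JF X) + \<Gamma> p X Z (JF Y)"
  unfolding ext_deriv2_def fundamental_form_def JF_apply[symmetric]
  using assms by (simp add: metric_compatible bracket_inner JF_field)

text \<open>In a holomorphic chart \<open>J\<close> becomes a constant matrix \<open>J0\<close>, which commutes with directional
  derivatives. All terms of the coordinate expression then cancel.\<close>

lemma nijenhuis_zero:
  assumes Y: "vector_field M Y" and Z: "vector_field M Z"
  shows "lie_bracket M (JF Y) (JF Z) p - lie_bracket M Y Z p
    - J p (lie_bracket M (JF Y) Z p) - J p (lie_bracket M Y (JF Z) p) = 0" (is "?N = 0")
proof -
  obtain U \<phi> J0 where c: "(U, \<phi>) \<in> max_atlas M" and p: "p \<in> U" and J0: "linear J0" "\<And>x. J0 (J0 x) = - x"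
    and J: "\<And>q v. q \<in> U \<Longrightarrow> v \<in> tangent_space M q \<Longrightarrow> coord_vec \<phi> (J q v) = J0 (coord_vec \<phi> v)"
    using complex unfolding complex_structure_def by blast
  have rep: "field_rep U \<phi> (JF X) x = J0 (field_rep U \<phi> X x)" if "vector_field M X" "x \<in> \<phi> ` U" for X x
    using that by (auto simp: field_rep_at[OF smooth_M c] JF_apply J field_T)
  have dJ: "dder (field_rep U \<phi> (JF X)) (\<phi> p) v = J0 (dder (field_rep U \<phi> X) (\<phi> p) v)" if X: "vector_field M X" for X v
  proof -
    have "((\<lambda>x. J0 (field_rep U \<phi> X x)) has_derivative (\<lambda>v. J0 (dder (field_rep U \<phi> X) (\<phi> p) v))) (at (\<phi> p))"
      by (rule bounded_linear.has_derivative[OF linear_conv_bounded_linear[THEN iffD1, OF J0(1)]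
            smooth_on_imp_has_derivative[OF smooth_on_field_rep[OF smooth_M c X] imageI[OF p]]])
    then have "(field_rep U \<phi> (JF X) has_derivative (\<lambda>v. J0 (dder (field_rep U \<phi> X) (\<phi> p) v))) (at (\<phi> p))"
      by (rule has_derivative_transform_within_open[OF _ max_chartD(2)[OF smooth_M c] imageI[OF p]]) (simp add: rep[OF X])
    then show ?thesis by (rule dder_unique)
  qed
  have br: "coord_vec \<phi> (lie_bracket M A B p) =
    dder (field_rep U \<phi> B) (\<phi> p) (coord_vec \<phi> (A p)) - dder (field_rep U \<phi> A) (\<phi> p) (coord_vec \<phi> (B p))"
    if "vector_field M A" "vector_field M B" for A B
    by (rule lie_bracket_coord[OF smooth_M c p that])
  have cJ: "coord_vec \<phi> (J p v) = J0 (coord_vec \<phi> v)" if "v \<in> tangent_space M p" for v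
    using J[OF p that] .
  have NT: "?N \<in> tangent_space M p" using Y Z by (simp add: T_diff bracket_T J_T JF_field)
  have "coord_vec \<phi> ?N = coord_vec \<phi> 0"
    using Y Z J0
    by (simp add: linear_diff[OF coord_vec_linear] br cJ bracket_T JF_field JF_apply dJ field_T linear_diff[OF J0(1)]
        linear_0[OF coord_vec_linear])
  then show ?thesis
    using coord_vec_inj[OF smooth_M c p NT zero_in_tangent_space[OF smooth_M]] by blast
qed

text \<open>The wedge products are values of \<open>d\<Omega>\<close>. In \<open>d\<Omega>(X,JY,JZ) - d\<Omega>(X,Y,Z)\<close>, written with the Levi-Civita
  connection, the terms that do not differentiate along \<open>X\<close> add up to \<open>- g(N(Y,Z), JX)\<close> for the
  Nijenhuis tensor \<open>N\<close>, which is 0. Expanding the wedge products gives the usual formula for \<open>\<nabla>J\<close> on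
  a locally conformal Kaehler manifold.\<close>

lemma nabla_J:
  assumes X: "vector_field M X" and Y: "vector_field M Y" and Z: "vector_field M Z"
  shows "2 * g p (nabla p (X p) (JF Y) - J p (nabla p (X p) Y)) (Z p) =
    wedge12 \<omega> (fundamental_form g J) X (JF Y) (JF Z) p - wedge12 \<omega> (fundamental_form g J) X Y Z p"
proof -
  note F = X Y Z JF_field[OF X] JF_field[OF Y] JF_field[OF Z]
  have dO: "wedge12 \<omega> (fundamental_form g J) A B C p = ext_deriv2 M (fundamental_form g J) A B C p"
    if "vector_field M A" "vector_field M B" "vector_field M C" for A B C
    using lck that unfolding lck_manifold_def by simp
  have 1: "wedge12 \<omega> (fundamental_form g J) X Y Z p =
    \<Gamma> p X (JF Z) Y + \<Gamma> p Y (JF X) Z + \<Gamma> p Z (JF Y) X + \<Gamma> p Y X (JF Z) + \<Gamma> p Z Y (JF X) + \<Gamma> p X Z (JF Y)"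
    by (simp add: dO F ext_deriv2_fundamental_form)
  have 2: "wedge12 \<omega> (fundamental_form g J) X (JF Y) (JF Z) p =
    - \<Gamma> p X Z (JF Y) + \<Gamma> p (JF Y) (JF X) (JF Z) - \<Gamma> p (JF Z) Y X - \<Gamma> p (JF Y) X Z
    + \<Gamma> p (JF Z) (JF Y) (JF X) - \<Gamma> p X (JF Z) Y"
    by (simp add: dO F ext_deriv2_fundamental_form JF_JF \<Gamma>_uminus)
  have J_inner: "g p (J p v) (JF X p) = g p v (X p)" if "v \<in> tangent_space M p" for v
    using that X by (simp add: JF_apply g_J_J field_T)
  have NX: "JF X p \<in> tangent_space M p" by (rule field_T[OF F(4)])
  have "g p (lie_bracket M (JF Y) (JF Z) p - lie_bracket M Y Z p
    - J p (lie_bracket M (JF Y) Z p) - J p (lie_bracket M Y (JF Z) p)) (JF X p) = 0"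
    unfolding nijenhuis_zero[OF Y Z] using metric_zero_left[OF smooth_M metric NX] .
  then have "g p (lie_bracket M (JF Y) (JF Z) p) (JF X p) - g p (lie_bracket M Y Z p) (JF X p)
    - g p (lie_bracket M (JF Y) Z p) (X p) - g p (lie_bracket M Y (JF Z) p) (X p) = 0"
    by (simp add: g_left[OF NX] T_diff bracket_T F J_T J_inner)
  then have 3: "\<Gamma> p (JF Y) (JF Z) (JF X) - \<Gamma> p (JF Z) (JF Y) (JF X) - (\<Gamma> p Y Z (JF X) - \<Gamma> p Z Y (JF X))
    - (\<Gamma> p (JF Y) Z X - \<Gamma> p Z (JF Y) X) - (\<Gamma> p Y (JF Z) X - \<Gamma> p (JF Z) Y X) = 0"
    by (simp only: bracket_inner F)
  have 4: "g p (J p (nabla p (X p) Y)) (Z p) = - \<Gamma> p X Y (JF Z)"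
    unfolding \<Gamma>_def JF_apply by (rule g_J[OF nabla_T[OF X Y] field_T[OF Z]])
  have 5: "g p (nabla p (X p) (JF Y) - J p (nabla p (X p) Y)) (Z p) = \<Gamma> p X (JF Y) Z + \<Gamma> p X Y (JF Z)"
    using g_left(2)[OF field_T[OF Z] nabla_T[OF X F(5)] J_T[OF nabla_T[OF X Y]]] 4 by (simp add: \<Gamma>_def)
  \<comment> \<open>By metric compatibility, 3 accounts for all terms of 1 and 2 that are differentiated along \<open>Y\<close>,
    \<open>Z\<close>, \<open>JY\<close>, \<open>JZ\<close>.\<close>
  show ?thesis
    unfolding 1 2 5
    using 3 \<Gamma>_JF_JF[OF F(5) X Z, of p] \<Gamma>_JF[OF Y X Z, of p] \<Gamma>_JF[OF X Y Z, of p]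
    by argo
qed

end

section \<open>Lagrangian submersions\<close>

locale lck_lagrangian = lck_with_connection M g J \<omega> nabla
  for M :: "('m::{t2_space,second_countable_topology}, 'e::euclidean_space) atlas"
    and g J \<omega> nabla +
  fixes N :: "('n::{t2_space,second_countable_topology}, 'f::euclidean_space) atlas"
    and gN :: "'n metric" and \<pi> :: "'m \<Rightarrow> 'n"
  assumes smooth_N: "smooth_manifold N" and lagr: "lagrangian_submersion M g J N gN \<pi>"
begin

abbreviation "d\<pi> \<equiv> differential N \<pi>"
abbreviation "Ver \<equiv> vertical_space M N \<pi>"
abbreviation "Hor \<equiv> horizontal_space M g N \<pi>"

lemma smooth_\<pi>: "smooth_map M N \<pi>"
  and d\<pi>_onto: "d\<pi> p ` tangent_space M p = tangent_space N (\<pi> p)"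
  and J_Ver: "J p ` Ver p = Hor p"
  using lagr unfolding lagrangian_submersion_def riemannian_submersion_def by blast+

lemma Ver_iff: "v \<in> Ver p \<longleftrightarrow> v \<in> tangent_space M p \<and> d\<pi> p v = 0"
  by (simp add: vertical_space_def)

lemma Hor_iff: "v \<in> Hor p \<longleftrightarrow> v \<in> tangent_space M p \<and> (\<forall>w\<in>Ver p. g p v w = 0)"
  by (simp add: horizontal_space_def)

lemma Ver_T: "v \<in> Ver p \<Longrightarrow> v \<in> tangent_space M p" by (simp add: Ver_iff)
lemma Hor_T: "v \<in> Hor p \<Longrightarrow> v \<in> tangent_space M p" by (simp add: Hor_iff)

lemma subspace_Ver: "subspace (Ver p)"
  by (rule subspaceI) (simp_all add: Ver_iff subspace_0[OF subspace_T] T_add subspace_scale[OF subspace_T]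
      linear_0[OF differential_linear] linear_add[OF differential_linear] linear_cmul[OF differential_linear])

lemma subspace_Hor: "subspace (Hor p)"
  by (rule subspaceI) (simp_all add: Hor_iff Ver_T subspace_0[OF subspace_T] T_add subspace_scale[OF subspace_T]
      g_left g_scale_left metric_zero_left[OF smooth_M metric])

lemma J_Ver_Hor: "v \<in> Ver p \<Longrightarrow> J p v \<in> Hor p"
  using J_Ver by blast

lemma Hor_iff_J_Ver: "v \<in> Hor p \<longleftrightarrow> v \<in> tangent_space M p \<and> J p v \<in> Ver p"
proof
  assume v: "v \<in> Hor p"
  then obtain w where w: "w \<in> Ver p" "v = J p w" using J_Ver by blast
  then have "J p v = - w" using J_J Ver_T by blast
  then show "v \<in> tangent_space M p \<and> J p v \<in> Ver p"
    using v w Hor_T subspace_neg[OF subspace_Ver] by simp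
next
  assume v: "v \<in> tangent_space M p \<and> J p v \<in> Ver p"
  then have "- v \<in> Hor p" using J_Ver_Hor[of "J p v" p] J_J by simp
  then show "v \<in> Hor p" using subspace_neg[OF subspace_Hor, of "- v"] by simp
qed

lemma J_Hor_Ver: "v \<in> Hor p \<Longrightarrow> J p v \<in> Ver p"
  by (simp add: Hor_iff_J_Ver)

lemma orthogonal_decomposition:
  assumes "v \<in> tangent_space M p"
  obtains w where "w \<in> Ver p" "v - w \<in> Hor p"
proof -
  obtain w where w: "w \<in> Ver p" "\<And>u. u \<in> Ver p \<Longrightarrow> g p (v - w) u = 0"
    using orthogonal_projection_exists[OF smooth_M metric subspace_Ver _ assms] Ver_T by blast
  then have "v - w \<in> Hor p" using assms by (simp add: Hor_iff T_diff Ver_T)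
  with w that show ?thesis by blast
qed

lemma Ver_Hor_orth: "v \<in> Hor p \<Longrightarrow> w \<in> Ver p \<Longrightarrow> g p v w = 0" "v \<in> Hor p \<Longrightarrow> w \<in> Ver p \<Longrightarrow> g p w v = 0"
  using Hor_iff g_sym Ver_T by metis+

text \<open>Subtract the vertical component of \<open>v\<close>: the rest is horizontal and orthogonal to itself.\<close>

lemma Ver_if_orth_Hor:
  assumes "v \<in> tangent_space M p" "\<And>z. z \<in> Hor p \<Longrightarrow> g p v z = 0"
  shows "v \<in> Ver p"
proof -
  obtain w where w: "w \<in> Ver p" "v - w \<in> Hor p" using orthogonal_decomposition[OF assms(1)] .
  have "g p (v - w) (v - w) = g p v (v - w) - g p w (v - w)"
    using g_left(2) assms(1) w by (simp add: Hor_T Ver_T)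
  also have "\<dots> = 0" using assms(2)[OF w(2)] Ver_Hor_orth(2)[OF w(2,1)] by simp
  finally have "v - w = 0" using metric_definite[OF smooth_M metric] w Hor_T by blast
  with w show ?thesis by simp
qed

lemma vertical_part_eqI:
  assumes "w \<in> Ver p" "v - w \<in> Hor p"
  shows "vertical_part M g N \<pi> p v = w"
  unfolding vertical_part_def
proof (rule orth_proj_eqI[OF smooth_M metric subspace_Ver])
  have "(v - w) + w \<in> tangent_space M p" using assms Hor_T Ver_T T_add by blast
  then show "v \<in> tangent_space M p" by simp
qed (use assms Ver_T Ver_Hor_orth in auto)

lemma horizontal_part_eqI:
  assumes "w \<in> Ver p" "v - w \<in> Hor p"
  shows "horizontal_part M g N \<pi> p v = v - w"
  unfolding horizontal_part_def
proof (rule orth_proj_eqI[OF smooth_M metric subspace_Hor])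
  have "(v - w) + w \<in> tangent_space M p" using assms Hor_T Ver_T T_add by blast
  then show "v \<in> tangent_space M p" by simp
qed (use assms Hor_T Ver_Hor_orth in auto)

lemma vertical_part_Ver: "v \<in> Ver p \<Longrightarrow> vertical_part M g N \<pi> p v = v"
  by (rule vertical_part_eqI) (auto intro: subspace_0[OF subspace_Hor])

lemma horizontal_part_Ver: "v \<in> Ver p \<Longrightarrow> horizontal_part M g N \<pi> p v = 0"
  using horizontal_part_eqI[of v p v] by (auto intro: subspace_0[OF subspace_Hor])

lemma horizontal_part_Hor: "v \<in> Hor p \<Longrightarrow> horizontal_part M g N \<pi> p v = v"
  using horizontal_part_eqI[of 0 p v] by (auto intro: subspace_0[OF subspace_Ver])

lemma d\<pi>_horizontal_part:
  assumes "v \<in> tangent_space M p"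
  shows "d\<pi> p (horizontal_part M g N \<pi> p v) = d\<pi> p v"
proof -
  obtain w where w: "w \<in> Ver p" "v - w \<in> Hor p" using orthogonal_decomposition[OF assms] .
  then show ?thesis using horizontal_part_eqI[OF w] by (simp add: linear_diff[OF differential_linear] Ver_iff)
qed

definition horizontal_involutive :: bool where
  "horizontal_involutive \<longleftrightarrow> (\<forall>X\<in>sections M Hor. \<forall>Y\<in>sections M Hor. \<forall>p. lie_bracket M X Y p \<in> Hor p)"

lemma sections_Hor: "X \<in> sections M Hor \<longleftrightarrow> vector_field M X \<and> (\<forall>p. X p \<in> Hor p)"
  by (simp add: sections_def)

text \<open>\<open>JY\<close> is vertical, so the second summand of \<open>\<A>\<close> differentiates the zero field.\<close>

lemma d\<pi>_oneill_A:
  assumes X: "X \<in> sections M Hor" and Y: "Y \<in> sections M Hor"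
  shows "d\<pi> p (oneill_A M g N \<pi> nabla X (JF Y) p) = d\<pi> p (nabla p (X p) (JF Y))"
proof -
  have X': "vector_field M X" "X p \<in> Hor p" and Y': "vector_field M Y" "Y q \<in> Hor q" for q
    using X Y by (auto simp: sections_Hor)
  have JY: "JF Y q \<in> Ver q" for q using J_Hor_Ver[OF Y'(2)] by (simp add: JF_apply)
  have "nabla p (X p) (\<lambda>q. 0) = 0"
    by (rule connection_zero_section[OF connection zero_section field_T[OF X'(1)]])
  moreover have "vertical_part M g N \<pi> p 0 = 0"
    by (rule vertical_part_Ver[OF subspace_0[OF subspace_Ver]])
  ultimately have "oneill_A M g N \<pi> nabla X (JF Y) p = horizontal_part M g N \<pi> p (nabla p (X p) (JF Y))"
    unfolding oneill_A_def Let_def by (simp add: vertical_part_Ver[OF JY] horizontal_part_Ver[OF JY] horizontal_part_Hor[OF X'(2)])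
  then show ?thesis using d\<pi>_horizontal_part[OF nabla_T[OF X'(1) JF_field[OF Y'(1)]]] by simp
qed

text \<open>\<open>JY\<close> is vertical, so its image under \<open>d\<pi>\<close> is the zero section.\<close>

lemma second_fundamental_form_JF:
  assumes D: "connection_along M N \<pi> D" and X: "X \<in> sections M Hor" and Y: "Y \<in> sections M Hor"
  shows "second_fundamental_form N \<pi> nabla D X (JF Y) p = - d\<pi> p (nabla p (X p) (JF Y))"
proof -
  have "d\<pi> q (JF Y q) = 0" for q
    using J_Hor_Ver[of "Y q" q] Y by (simp add: sections_Hor JF_apply Ver_iff)
  moreover have "D p (X p) (\<lambda>q. 0) = 0"
    using X by (intro connection_zero_section[OF D section_along_zero[OF smooth_M smooth_N smooth_\<pi>]] field_T) (simp add: sections_Hor)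
  ultimately show ?thesis by (simp add: second_fundamental_form_def)
qed

text \<open>Torsion-freeness gives \<open>\<nabla>\<^sub>X JY - \<nabla>\<^sub>Y JX = (\<nabla>\<^sub>X J)Y - (\<nabla>\<^sub>Y J)X + J[X,Y]\<close>. As \<open>B1\<close> is vertical, \<open>\<omega>\<close>
  and \<open>\<Omega>\<close> vanish on horizontal vectors, and by \<open>nabla_J\<close> the horizontal part of
  \<open>(\<nabla>\<^sub>X J)Y - (\<nabla>\<^sub>Y J)X\<close> is \<open>R = 1/2 (\<omega>(JY) X - \<omega>(JX) Y)\<close>. So the two sides of the identity differ by
  the image of \<open>J[X,Y]\<close>, and they agree iff \<open>J[X,Y]\<close> is vertical, that is, iff \<open>[X,Y]\<close> is
  horizontal.\<close>

lemma bracket_horizontal_iff: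
  assumes B1: "lee_vector_field M g \<omega> B1" "\<And>p. B1 p \<in> Ver p"
    and X: "X \<in> sections M Hor" and Y: "Y \<in> sections M Hor"
  shows "lie_bracket M X Y p \<in> Hor p \<longleftrightarrow>
    d\<pi> p (nabla p (X p) (JF Y) - nabla p (Y p) (JF X)) =
      ((1/2) * g p (J p (Y p)) (B1 p)) *\<^sub>R d\<pi> p (X p) - ((1/2) * g p (J p (X p)) (B1 p)) *\<^sub>R d\<pi> p (Y p)"
proof -
  have X': "vector_field M X" "X p \<in> Hor p" and Y': "vector_field M Y" "Y p \<in> Hor p"
    using X Y by (auto simp: sections_Hor)
  note F = X'(1) Y'(1) JF_field[OF X'(1)] JF_field[OF Y'(1)]
  have T: "X p \<in> tangent_space M p" "Y p \<in> tangent_space M p" using X' Y' Hor_T by blast+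
  have \<omega>: "\<omega> p v = g p v (B1 p)" if "v \<in> tangent_space M p" for v
    using B1(1) that by (simp add: lee_vector_field_def)
  have \<omega>0: "\<omega> p v = 0" if "v \<in> Hor p" for v
    using \<omega>[OF Hor_T[OF that]] Ver_Hor_orth(1)[OF that B1(2)] by simp
  define D where "D = nabla p (X p) (JF Y) - nabla p (Y p) (JF X)"
  define R where "R = ((1/2) * g p (J p (Y p)) (B1 p)) *\<^sub>R X p - ((1/2) * g p (J p (X p)) (B1 p)) *\<^sub>R Y p"
  define Br where "Br = lie_bracket M X Y p"
  have DT: "D \<in> tangent_space M p" unfolding D_def by (simp add: T_diff nabla_T F)
  have RT: "R \<in> tangent_space M p" unfolding R_def using T by (simp add: T_diff subspace_scale[OF subspace_T])
  have BrT: "Br \<in> tangent_space M p" unfolding Br_def by (rule bracket_T[OF F(1,2)])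
  have key: "2 * g p (nabla p (A p) (JF B) - J p (nabla p (A p) B)) z =
      g p (J p (B p)) (B1 p) * g p (A p) z - g p (J p z) (B1 p) * g p (A p) (B p)"
    if z: "z \<in> Hor p" and A: "A \<in> sections M Hor" and B: "B \<in> sections M Hor" for z A B
  proof -
    obtain Z where Z: "vector_field M Z" "Z p = z" using tangent_vector_extends[OF smooth_M Hor_T[OF z]] .
    have A': "vector_field M A" "A p \<in> Hor p" "A p \<in> tangent_space M p"
      and B': "vector_field M B" "B p \<in> Hor p" "B p \<in> tangent_space M p"
      using A B Hor_T by (auto simp: sections_Hor)
    have \<Omega>0: "fundamental_form g J p v w = 0" if "v \<in> Hor p" "w \<in> Hor p" for v w
      using that Ver_Hor_orth(1)[OF that(1) J_Hor_Ver] by (simp add: fundamental_form_def)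
    have "wedge12 \<omega> (fundamental_form g J) A B Z p = 0"
      using \<Omega>0 A' B' z Z by (simp add: wedge12_def)
    moreover have "wedge12 \<omega> (fundamental_form g J) A (JF B) (JF Z) p =
        g p (J p (B p)) (B1 p) * g p (A p) z - g p (J p z) (B1 p) * g p (A p) (B p)"
      using A' B' Hor_T[OF z] g_sym[OF Hor_T[OF z] A'(3)]
      by (simp add: wedge12_def JF_apply Z(2) \<omega>0 \<omega> J_T fundamental_form_def g_J_J J_J g_minus_right)
    ultimately show ?thesis using nabla_J[OF A'(1) B'(1) Z(1), of p] Z(2) by simp
  qed
  have inner: "g p (D - R) z = g p (J p Br) z" if z: "z \<in> Hor p" for z
  proof -
    note zT = Hor_T[OF z]
    have nT: "nabla p (X p) Y \<in> tangent_space M p" "nabla p (Y p) X \<in> tangent_space M p"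
      "nabla p (X p) (JF Y) \<in> tangent_space M p" "nabla p (Y p) (JF X) \<in> tangent_space M p"
      by (simp_all add: nabla_T F)
    have "J p Br = J p (nabla p (X p) Y) - J p (nabla p (Y p) X)"
      unfolding Br_def torsion_free[OF F(1,2)] by (rule J_diff[OF nT(1,2)])
    then have "g p (D - R) z - g p (J p Br) z = g p (nabla p (X p) (JF Y) - J p (nabla p (X p) Y)) z
        - g p (nabla p (Y p) (JF X) - J p (nabla p (Y p) X)) z - g p R z"
      using nT zT RT DT by (simp add: D_def g_left T_diff J_T)
    moreover have "g p R z = (1/2) * g p (J p (Y p)) (B1 p) * g p (X p) z - (1/2) * g p (J p (X p)) (B1 p) * g p (Y p) z"
      unfolding R_def using T zT by (simp add: g_left g_scale_left subspace_scale[OF subspace_T])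
    moreover have "g p (X p) (Y p) = g p (Y p) (X p)" by (rule g_sym[OF T])
    ultimately show ?thesis using key[OF z X Y] key[OF z Y X] by simp
  qed
  have "d\<pi> p D = d\<pi> p R \<longleftrightarrow> D - R \<in> Ver p"
    using DT RT by (simp add: Ver_iff T_diff linear_diff[OF differential_linear])
  also have "\<dots> \<longleftrightarrow> J p Br \<in> Ver p"
    using inner Ver_if_orth_Hor Ver_Hor_orth(2) T_diff[OF DT RT] J_T[OF BrT] by metis
  also have "\<dots> \<longleftrightarrow> Br \<in> Hor p" using BrT by (simp add: Hor_iff_J_Ver)
  finally show ?thesis
    by (simp add: D_def R_def Br_def linear_diff[OF differential_linear] linear_cmul[OF differential_linear])
qed

end

section \<open>Integrable distributions are involutive\<close>

lemma subspace_orthogonal_test: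
  fixes E :: "'a::euclidean_space set"
  assumes E: "subspace E" and v: "\<And>w. (\<And>u. u \<in> E \<Longrightarrow> w \<bullet> u = 0) \<Longrightarrow> v \<bullet> w = 0"
  shows "v \<in> E"
proof -
  obtain y z where y: "y \<in> span E" and z: "\<And>w. w \<in> span E \<Longrightarrow> orthogonal z w" and vyz: "v = y + z"
    using orthogonal_subspace_decomp_exists[of E v] by blast
  have sp: "span E = E" using E by (simp add: span_eq_iff)
  have "v \<bullet> z = 0" using v[of z] z sp by (simp add: orthogonal_def)
  moreover have "y \<bullet> z = 0" using z[OF y] by (simp add: orthogonal_def inner_commute)
  ultimately have "z = 0" by (simp add: vyz inner_add_left)
  with y sp vyz show ?thesis by simp
qed

lemma dder_in_subspace:
  fixes f :: "'a::euclidean_space \<Rightarrow> 'a"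
  assumes f: "f differentiable (at x)" and S: "open S" "x \<in> S" and E: "subspace E" "x \<in> E"
    and inE: "\<And>y. y \<in> S \<Longrightarrow> y \<in> E \<Longrightarrow> f y \<in> E" and \<xi>: "\<xi> \<in> E"
  shows "dder f x \<xi> \<in> E"
proof (rule subspace_orthogonal_test[OF E(1)])
  fix w assume w: "\<And>u. u \<in> E \<Longrightarrow> w \<bullet> u = 0"
  let ?l = "\<lambda>t. x + t *\<^sub>R \<xi>"
  have "((\<lambda>t. x + t *\<^sub>R \<xi>) has_derivative (\<lambda>t. t *\<^sub>R \<xi>)) (at 0)"
    by (auto intro!: derivative_eq_intros)
  moreover have "(f has_derivative dder f x) (at (x + 0 *\<^sub>R \<xi>))"
    using f by (simp add: frechet_derivative_works)
  ultimately have "((\<lambda>t. f (x + t *\<^sub>R \<xi>)) has_derivative (\<lambda>t. dder f x (t *\<^sub>R \<xi>))) (at 0)"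
    using diff_chain_at[of ?l "\<lambda>t. t *\<^sub>R \<xi>" 0 f "dder f x"] by (simp add: o_def)
  then have 1: "((\<lambda>t. f (x + t *\<^sub>R \<xi>) \<bullet> w) has_derivative (\<lambda>t. dder f x (t *\<^sub>R \<xi>) \<bullet> w)) (at 0)"
    by (rule bounded_linear.has_derivative[OF bounded_linear_inner_left])
  have o: "open (?l -` S)" by (rule open_vimage[OF S(1)]) (intro continuous_intros)
  have z: "(0::real) \<in> ?l -` S" using S(2) by simp
  have "((\<lambda>t. f (x + t *\<^sub>R \<xi>) \<bullet> w) has_derivative (\<lambda>t. 0)) (at 0)"
  proof (rule has_derivative_transform_within_open[OF has_derivative_const o z])
    fix t assume "t \<in> ?l -` S"
    then have "f (x + t *\<^sub>R \<xi>) \<in> E"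
      using inE E \<xi> by (simp add: subspace_add subspace_scale)
    then show "0 = f (x + t *\<^sub>R \<xi>) \<bullet> w" using w by (simp add: inner_commute[of _ w])
  qed
  from has_derivative_unique[OF 1 this] have "dder f x (1 *\<^sub>R \<xi>) \<bullet> w = 0" by metis
  then show "dder f x \<xi> \<bullet> w = 0" by simp
qed

text \<open>In a slice chart the coordinates of both fields take values in the subspace \<open>E\<close> along \<open>E\<close>. So do
  their derivatives in directions of \<open>E\<close>, of which the bracket consists.\<close>

lemma bracket_in_integrable_distribution:
  fixes M :: "('m::{t2_space,second_countable_topology}, 'e::euclidean_space) atlas"
  assumes M: "smooth_manifold M" and int: "integrable_distribution M D"
    and X: "X \<in> sections M D" and Y: "Y \<in> sections M D"
    and br: "lie_bracket M X Y p \<in> tangent_space M p"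
  shows "lie_bracket M X Y p \<in> D p"
proof -
  obtain L where L: "p \<in> L" "integral_manifold M D L"
    using int unfolding integrable_distribution_def by blast
  from bspec[OF L(2)[unfolded integral_manifold_def] L(1)]
  obtain U \<phi> E where c: "(U, \<phi>) \<in> max_atlas M" and p: "p \<in> U" and E: "subspace E"
    and LE: "\<phi> ` (L \<inter> U) = \<phi> ` U \<inter> E"
    and D': "\<forall>r\<in>L \<inter> U. D r = {v \<in> tangent_space M r. coord_vec \<phi> v \<in> E}"
    by blast
  have D: "D r = {v \<in> tangent_space M r. coord_vec \<phi> v \<in> E}" if "r \<in> L \<inter> U" for r
    using D' that by (rule bspec)
  have in_E: "field_rep U \<phi> Z x \<in> E" if "Z \<in> sections M D" "x \<in> \<phi> ` U" "x \<in> E" for Z x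
  proof -
    have "x \<in> \<phi> ` (L \<inter> U)" unfolding LE using that(2,3) by (rule IntI)
    then obtain r where r: "r \<in> L \<inter> U" "x = \<phi> r" by (elim imageE)
    have "Z r \<in> D r" using that(1) by (simp add: sections_def)
    then show ?thesis using D[OF r(1)] r by (simp add: field_rep_at[OF M c])
  qed
  have "\<phi> p \<in> \<phi> ` (L \<inter> U)" using L(1) p by (intro imageI IntI)
  then have pE: "\<phi> p \<in> E" unfolding LE by (rule IntD2)
  have der: "dder (field_rep U \<phi> Z) (\<phi> p) (coord_vec \<phi> (W p)) \<in> E"
    if Z: "Z \<in> sections M D" and W: "W \<in> sections M D" for Z W
  proof (rule dder_in_subspace[OF _ max_chartD(2)[OF M c] _ E pE])
    have "vector_field M Z" using Z by (simp add: sections_def)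
    from smooth_on_imp_differentiable[OF smooth_on_field_rep[OF M c this] imageI[OF p]]
    show "field_rep U \<phi> Z differentiable at (\<phi> p)" .
    show "coord_vec \<phi> (W p) \<in> E"
      using in_E[OF W imageI[OF p] pE] by (simp add: field_rep_at[OF M c p])
  qed (use p in_E[OF Z] in auto)
  have "coord_vec \<phi> (lie_bracket M X Y p) \<in> E"
    using lie_bracket_coord[OF M c p, of X Y] X Y der[OF Y X] der[OF X Y] subspace_diff[OF E]
    by (simp add: sections_def)
  with br D[of p] L(1) p show ?thesis by simp
qed

section \<open>Involutive horizontal distributions are integrable\<close>

text \<open>A smooth frame of the distribution \<open>x \<mapsto> ker (\<beta> x)\<close>, normalised by a fixed projection \<open>pr\<close> onto
  \<open>ker (\<beta> x0)\<close>. With a right inverse \<open>s\<close> of \<open>\<beta> x0\<close>, the operators \<open>A x = pr + s \<circ> \<beta> x\<close> equal the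
  identity at \<open>x0\<close> and are invertible near \<open>x0\<close>; \<open>F x e\<close> is the solution of \<open>A x v = pr e\<close>. For
  convenience the frame is indexed by all vectors \<open>e\<close> and depends on \<open>pr e\<close> only.\<close>

lemma kernel_frame:
  fixes \<beta> :: "'a::euclidean_space \<Rightarrow> 'a \<Rightarrow> 'b::euclidean_space"
  assumes \<Omega>: "open \<Omega>" "x0 \<in> \<Omega>" and lin: "\<And>x. x \<in> \<Omega> \<Longrightarrow> linear (\<beta> x)"
    and smooth: "\<And>v. smooth_on \<Omega> (\<lambda>x. \<beta> x v)" and surj: "surj (\<beta> x0)"
  obtains \<rho> pr F where "\<rho> > 0" "ball x0 \<rho> \<subseteq> \<Omega>" "linear pr" "\<And>v. pr (pr v) = pr v"
    "\<And>x. x \<in> ball x0 \<rho> \<Longrightarrow> linear (F x)" "\<And>e. smooth_on (ball x0 \<rho>) (\<lambda>x. F x e)"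
    "\<And>x e. x \<in> ball x0 \<rho> \<Longrightarrow> pr (F x e) = pr e" "\<And>x e. x \<in> ball x0 \<rho> \<Longrightarrow> F x (pr e) = F x e"
    "\<And>x v. x \<in> ball x0 \<rho> \<Longrightarrow> \<beta> x v = 0 \<longleftrightarrow> F x v = v"
proof -
  note l0 = lin[OF \<Omega>(2)]
  obtain s where s: "linear s" "\<And>y. \<beta> x0 (s y) = y"
    using linear_surjective_right_inverse[OF l0 surj] by (metis comp_apply id_apply)
  define pr where "pr v = v - s (\<beta> x0 v)" for v
  have lpr: "linear pr"
    unfolding pr_def using linear_compose[OF l0 s(1)] by (intro linear_compose_sub) (auto simp: o_def linear_id[unfolded id_def])
  have \<beta>pr: "\<beta> x0 (pr v) = 0" for v by (simp add: pr_def linear_diff[OF l0] s)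
  have prpr: "pr (pr v) = pr v" for v using \<beta>pr by (simp add: pr_def[of "pr v"] linear_0[OF s(1)])
  have prs: "pr (s y) = 0" for y by (simp add: pr_def s)
  define A where "A x v = pr v + s (\<beta> x v)" for x v
  have lA: "linear (A x)" if "x \<in> \<Omega>" for x
    unfolding A_def using linear_compose[OF lin[OF that] s(1)] lpr by (intro linear_compose_add) (auto simp: o_def)
  have bs: "bounded_linear s" using s(1) linear_conv_bounded_linear by blast
  have sA: "smooth_on \<Omega> (\<lambda>x. A x v)" for v
    unfolding A_def by (intro smooth_on_add smooth_on_linear[OF bs] \<Omega>(1) smooth) simp
  have A0: "A x0 v = v" for v by (simp add: A_def pr_def)
  \<comment> \<open>With one summand \<open>\<epsilon>\<close> for each basis vector, \<open>A x\<close> differs from the identity by at most 1/2.\<close>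
  define \<epsilon> where "\<epsilon> = 1 / (2 * real DIM('a))"
  have "\<exists>r>0. \<forall>x\<in>ball x0 r. norm (A x b - b) < \<epsilon>" for b
  proof -
    have "isCont (\<lambda>x. A x b) x0"
      using smooth_on_imp_continuous[OF sA] \<Omega> continuous_on_eq_continuous_at by blast
    then obtain r where "r > 0" "\<And>x. dist x x0 < r \<Longrightarrow> dist (A x b) (A x0 b) < \<epsilon>"
      unfolding continuous_at_eps_delta by (metis \<epsilon>_def DIM_positive of_nat_0_less_iff zero_less_divide_1_iff zero_less_mult_iff zero_less_numeral)
    then show ?thesis by (auto simp: A0 dist_norm norm_minus_commute)
  qed
  then obtain r where r: "\<And>b. r b > 0" "\<And>b x. x \<in> ball x0 (r b) \<Longrightarrow> norm (A x b - b) < \<epsilon>" by metis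
  obtain r1 where r1: "r1 > 0" "ball x0 r1 \<subseteq> \<Omega>" using \<Omega> open_contains_ball by blast
  define \<rho> where "\<rho> = Min (insert r1 (r ` Basis))"
  have \<rho>: "\<rho> > 0" "\<rho> \<le> r1" "\<And>b. b \<in> Basis \<Longrightarrow> \<rho> \<le> r b"
    unfolding \<rho>_def using r(1) r1(1) by (auto simp del: Min_insert simp: Min_gr_iff intro: Min_le)
  have sub: "ball x0 \<rho> \<subseteq> \<Omega>" using \<rho>(2) r1(2) by auto
  have bound: "norm v \<le> 2 * norm (A x v)" if x: "x \<in> ball x0 \<rho>" for x v
  proof -
    have "linear (\<lambda>v. A x v - v)"
      using lA x sub by (intro linear_compose_sub) (auto simp: linear_id[unfolded id_def])
    then have "norm (A x v - v) = norm (\<Sum>b\<in>Basis. (v \<bullet> b) *\<^sub>R (A x b - b))"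
      using linear_eq_sum_Basis[of "\<lambda>v. A x v - v" v] by simp
    also have "\<dots> \<le> (\<Sum>b\<in>(Basis::'a set). norm v * \<epsilon>)"
    proof (rule sum_norm_le)
      fix b :: 'a assume b: "b \<in> Basis"
      have "norm (A x b - b) \<le> \<epsilon>" using r(2)[of x b] x \<rho>(3)[OF b] by force
      then show "norm ((v \<bullet> b) *\<^sub>R (A x b - b)) \<le> norm v * \<epsilon>"
        using Basis_le_norm[OF b, of v] by (simp add: mult_mono)
    qed
    also have "\<dots> = norm v / 2" by (simp add: \<epsilon>_def)
    finally show ?thesis using norm_triangle_ineq4[of "A x v" "A x v - v"] by simp
  qed
  have inj: "inj (A x)" if x: "x \<in> ball x0 \<rho>" for x
    unfolding linear_injective_0[OF lA[OF subsetD[OF sub x]]]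
  proof (intro allI impI)
    fix v assume "A x v = 0"
    with bound[OF x, of v] show "v = 0" by simp
  qed
  have surjA: "surj (A x)" if x: "x \<in> ball x0 \<rho>" for x
    using linear_injective_imp_surjective[OF lA[OF subsetD[OF sub x]] inj[OF x]] by blast
  define F where "F x e = inv (A x) (pr e)" for x e
  have AF: "A x (F x e) = pr e" if "x \<in> ball x0 \<rho>" for x e
    unfolding F_def by (rule surj_f_inv_f[OF surjA[OF that]])
  have F_eqI: "F x e = v" if "x \<in> ball x0 \<rho>" "A x v = pr e" for x e v
    by (rule injD[OF inj[OF that(1)]]) (simp add: AF[OF that(1)] that(2))
  have prF: "pr (F x e) = pr e" if "x \<in> ball x0 \<rho>" for x e
  proof -
    have "pr (A x (F x e)) = pr (F x e)" unfolding A_def by (simp add: linear_add[OF lpr] prpr prs)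
    then show ?thesis by (simp add: AF[OF that] prpr)
  qed
  show thesis
  proof (rule that[of \<rho> pr F])
    show "linear (F x)" if x: "x \<in> ball x0 \<rho>" for x
    proof
      note l = lA[OF subsetD[OF sub x]]
      show "F x (a + b) = F x a + F x b" for a b
        by (rule F_eqI[OF x]) (simp add: linear_add[OF l] AF[OF x] linear_add[OF lpr])
      show "F x (k *\<^sub>R b) = k *\<^sub>R F x b" for k b
        by (rule F_eqI[OF x]) (simp add: linear_cmul[OF l] AF[OF x] linear_cmul[OF lpr])
    qed
    show "smooth_on (ball x0 \<rho>) (\<lambda>x. F x e)" for e
      by (rule smooth_on_solution[OF open_ball lA[OF subsetD[OF sub]] smooth_on_subset[OF sA sub] _ bound smooth_on_const AF])
        auto
    show "\<beta> x v = 0 \<longleftrightarrow> F x v = v" if x: "x \<in> ball x0 \<rho>" for x v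
    proof
      assume "\<beta> x v = 0"
      then show "F x v = v" by (intro F_eqI[OF x]) (simp add: A_def linear_0[OF s(1)])
    next
      assume "F x v = v"
      then have "A x v = pr v" using AF[OF x, of v] by simp
      then have "s (\<beta> x v) = 0" by (simp add: A_def)
      then show "\<beta> x v = 0" using s(2)[of "\<beta> x v"] by (simp add: linear_0[OF l0])
    qed
    show "F x (pr e) = F x e" for x e by (simp add: F_def prpr)
  qed (use \<rho> sub lpr prpr prF in auto)
qed

text \<open>The shear that straightens an integral manifold comes with an explicit inverse, which is why \<open>\<tau>\<close>
  is given as a map.\<close>

lemma max_atlas_compose_diffeo:
  fixes M :: "('m::{t2_space,second_countable_topology}, 'e::euclidean_space) atlas"
  assumes M: "smooth_manifold M" and c: "(U, \<phi>) \<in> max_atlas M"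
    and D: "open D" "D \<subseteq> \<phi> ` U" and \<sigma>: "smooth_on D \<sigma>" and o: "open (\<sigma> ` D)"
    and \<tau>: "smooth_on (\<sigma> ` D) \<tau>" "\<And>x. x \<in> D \<Longrightarrow> \<tau> (\<sigma> x) = x"
  defines "U' \<equiv> {q \<in> U. \<phi> q \<in> D}"
  shows "(U', \<sigma> \<circ> \<phi>) \<in> max_atlas M"
proof -
  note inj = max_chartD(3)[OF M c]
  have oU': "open U'" unfolding U'_def by (rule max_chart_open_vimage[OF M c D(1)])
  have img: "\<phi> ` U' = D" using D(2) by (auto simp: U'_def)
  then have img': "(\<sigma> \<circ> \<phi>) ` U' = \<sigma> ` D" by (metis image_comp)
  have inv: "inv_into U \<phi> (\<tau> ((\<sigma> \<circ> \<phi>) q)) = q" if "q \<in> U'" for q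
    using that \<tau>(2) inj by (simp add: U'_def)
  have injc: "inj_on (\<sigma> \<circ> \<phi>) U'" by (rule inj_on_inverseI[of _ "\<lambda>y. inv_into U \<phi> (\<tau> y)"]) (rule inv)
  have inv_eq: "inv_into U' (\<sigma> \<circ> \<phi>) y = inv_into U \<phi> (\<tau> y)" if "y \<in> \<sigma> ` D" for y
  proof -
    obtain q where q: "q \<in> U'" "y = (\<sigma> \<circ> \<phi>) q" using \<open>y \<in> \<sigma> ` D\<close> img' by blast
    show ?thesis unfolding q(2) inv[OF q(1)] by (rule inv_into_f_f[OF injc q(1)])
  qed
  have \<tau>D: "\<tau> ` \<sigma> ` D = D" using \<tau>(2) by force
  have "homeomorphism U' ((\<sigma> \<circ> \<phi>) ` U') (\<sigma> \<circ> \<phi>) (\<lambda>y. inv_into U \<phi> (\<tau> y))"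
    unfolding homeomorphism_def
  proof (intro conjI ballI)
    show "continuous_on U' (\<sigma> \<circ> \<phi>)"
    proof (rule continuous_on_compose)
      show "continuous_on U' \<phi>" using max_chartD(4)[OF M c] by (rule continuous_on_subset) (auto simp: U'_def)
      show "continuous_on (\<phi> ` U') \<sigma>" unfolding img by (rule smooth_on_imp_continuous[OF \<sigma>])
    qed
    show "continuous_on ((\<sigma> \<circ> \<phi>) ` U') (\<lambda>y. inv_into U \<phi> (\<tau> y))"
      unfolding img'
      by (rule continuous_on_compose2[OF max_chartD(5)[OF M c] smooth_on_imp_continuous[OF \<tau>(1)]])
        (use \<tau>D D(2) in auto)
    show "(\<lambda>y. inv_into U \<phi> (\<tau> y)) ` (\<sigma> \<circ> \<phi>) ` U' = U'" using inv by (force simp: image_iff)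
    show "(\<sigma> \<circ> \<phi>) (inv_into U \<phi> (\<tau> y)) = y" if y: "y \<in> (\<sigma> \<circ> \<phi>) ` U'" for y
    proof -
      from y obtain q where "q \<in> U'" "y = (\<sigma> \<circ> \<phi>) q" by blast
      then show ?thesis by (simp only: inv)
    qed
  qed (simp_all only: inv)
  then have chart: "is_chart (U', \<sigma> \<circ> \<phi>)" unfolding is_chart_def using oU' o img' by auto
  have "smooth_compatible (U', \<sigma> \<circ> \<phi>) (V, \<psi>)" if d: "(V, \<psi>) \<in> M" for V \<psi>
  proof -
    have d': "(V, \<psi>) \<in> max_atlas M" using d by (rule max_atlas_memI[OF M])
    have o1: "open ((\<sigma> \<circ> \<phi>) ` (U' \<inter> V))" by (rule chart_open_image[OF chart max_chartD(1)[OF M d']])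
    have o2: "open (\<psi> ` (U' \<inter> V))" using max_chart_open_image[OF M d' oU'] by (simp add: Int_commute)
    have o3: "open (\<phi> ` (U \<inter> V))" by (rule max_chart_open_image[OF M c max_chartD(1)[OF M d']])
    have "smooth_on ((\<sigma> \<circ> \<phi>) ` (U' \<inter> V)) (\<psi> \<circ> inv_into U' (\<sigma> \<circ> \<phi>))"
    proof (rule smooth_on_eqI[OF o1])
      show "smooth_on ((\<sigma> \<circ> \<phi>) ` (U' \<inter> V)) (\<lambda>y. (\<psi> \<circ> inv_into U \<phi>) (\<tau> y))"
        by (rule smooth_on_compose[OF max_atlas_compat[OF M c d'] smooth_on_subset[OF \<tau>(1)] _ o1 o3])
          (use \<tau>(2) in \<open>auto simp: U'_def\<close>)
      show "(\<psi> \<circ> inv_into U' (\<sigma> \<circ> \<phi>)) y = (\<psi> \<circ> inv_into U \<phi>) (\<tau> y)" if "y \<in> (\<sigma> \<circ> \<phi>) ` (U' \<inter> V)" for y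
        using that img' inv_eq by (metis comp_apply image_mono inf_le1 subsetD)
    qed
    moreover have "smooth_on (\<psi> ` (U' \<inter> V)) ((\<sigma> \<circ> \<phi>) \<circ> inv_into V \<psi>)"
    proof (rule smooth_on_eqI[OF o2])
      have "smooth_on (\<psi> ` (U' \<inter> V)) (\<phi> \<circ> inv_into V \<psi>)"
        by (rule smooth_on_subset[OF max_atlas_compat[OF M d' c]]) (auto simp: U'_def)
      then show "smooth_on (\<psi> ` (U' \<inter> V)) (\<lambda>y. \<sigma> ((\<phi> \<circ> inv_into V \<psi>) y))"
        by (rule smooth_on_compose[OF \<sigma> _ _ o2 D(1)]) (use max_chartD(3)[OF M d'] in \<open>auto simp: U'_def\<close>)
    qed simp
    ultimately show ?thesis by (simp add: smooth_compatible_def)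
  qed
  then show ?thesis using chart by (auto simp: max_atlas_def)
qed

lemma coord_vec_compose:
  fixes M :: "('m::{t2_space,second_countable_topology}, 'e::euclidean_space) atlas"
  assumes M: "smooth_manifold M" and c: "(U, \<phi>) \<in> max_atlas M" and p: "p \<in> U"
    and D: "open D" "\<phi> p \<in> D" and \<sigma>: "smooth_on D (\<sigma> :: 'e \<Rightarrow> 'e)" and v: "v \<in> tangent_space M p"
  shows "coord_vec (\<sigma> \<circ> \<phi>) v = dder \<sigma> (\<phi> p) (coord_vec \<phi> v)"
proof (rule euclidean_eqI)
  fix b :: 'e assume b: "b \<in> Basis"
  have sn: "smooth_near M p (\<lambda>q. \<sigma> (\<phi> q) \<bullet> b)"
    by (rule smooth_near_chart_fun[OF M c p D smooth_on_inner_left[OF D(1) \<sigma>]])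
  have "((\<lambda>x. \<sigma> x \<bullet> b) has_derivative (\<lambda>v. dder \<sigma> (\<phi> p) v \<bullet> b)) (at (\<phi> p))"
    by (rule bounded_linear.has_derivative[OF bounded_linear_inner_left smooth_on_imp_has_derivative[OF \<sigma> D(2)]])
  then have "(((\<lambda>q. \<sigma> (\<phi> q) \<bullet> b) \<circ> inv_into U \<phi>) has_derivative (\<lambda>v. dder \<sigma> (\<phi> p) v \<bullet> b)) (at (\<phi> p))"
    by (rule has_derivative_transform_within_open[OF _ max_chartD(2)[OF M c] imageI[OF p]]) (simp add: f_inv_into_f)
  then show "coord_vec (\<sigma> \<circ> \<phi>) v \<bullet> b = dder \<sigma> (\<phi> p) (coord_vec \<phi> v) \<bullet> b"
    using tangent_vector_eq_dder[OF M c p v sn] dder_unique by (simp add: coord_vec_inner[OF b])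
qed

context lck_lagrangian
begin

text \<open>In a holomorphic chart around \<open>p\<close>, where \<open>J\<close> is a constant \<open>J0\<close>, the horizontal space at \<open>x\<close> is
  the kernel of \<open>\<beta> x = d\<Psi>\<^sub>x \<circ> J0\<close>, with \<open>\<Psi>\<close> the map \<open>\<pi>\<close> in charts, because \<open>J\<close> interchanges
  horizontal and vertical vectors. Take the normalised frame \<open>F\<close> of this kernel. The bracket of two
  of its members is horizontal by assumption and killed by \<open>pr\<close> because \<open>pr (F x e) = pr e\<close> is
  constant; hence it is 0, and the Frobenius theorem yields \<open>z\<close> with derivative \<open>F (z s)\<close>. The image
  of \<open>z\<close> is a graph over the image of \<open>pr\<close>, and the shear \<open>\<sigma>\<close> straightens it.\<close>

lemma involutive_imp_integral_manifold:
  assumes inv: horizontal_involutive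
  shows "\<exists>L. p \<in> L \<and> integral_manifold M Hor L"
proof -
  obtain U \<phi> J0 where c: "(U, \<phi>) \<in> max_atlas M" and p: "p \<in> U" and J0: "linear J0" "\<And>x. J0 (J0 x) = - x"
    and J: "\<And>q v. q \<in> U \<Longrightarrow> v \<in> tangent_space M q \<Longrightarrow> coord_vec \<phi> (J q v) = J0 (coord_vec \<phi> v)"
    using complex unfolding complex_structure_def by blast
  obtain V \<psi> where d: "(V, \<psi>) \<in> N" and V: "\<pi> p \<in> V" by (rule chart_at[OF smooth_N])
  have d': "(V, \<psi>) \<in> max_atlas N" by (rule max_atlas_memI[OF smooth_N d])
  note injU = max_chartD(3)[OF smooth_M c]
  define \<Omega>0 where "\<Omega>0 = \<phi> ` (U \<inter> \<pi> -` V)"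
  define \<Psi> where "\<Psi> = \<psi> \<circ> \<pi> \<circ> inv_into U \<phi>"
  have o0: "open \<Omega>0"
    unfolding \<Omega>0_def
    by (rule max_chart_open_image[OF smooth_M c open_vimage_smooth_map[OF smooth_M smooth_N smooth_\<pi> max_chartD(1)[OF smooth_N d']]])
  have s\<Psi>: "smooth_on \<Omega>0 \<Psi>"
    unfolding \<Omega>0_def \<Psi>_def by (rule smooth_map_chart[OF smooth_M smooth_N smooth_\<pi> c d])
  define \<beta> where "\<beta> x v = dder \<Psi> x (J0 v)" for x v
  have l\<beta>: "linear (\<beta> x)" if "x \<in> \<Omega>0" for x
    unfolding \<beta>_def
    using linear_compose[OF J0(1) dder_linear(1)[OF smooth_on_imp_differentiable[OF s\<Psi> that]]] by (simp add: o_def)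
  have s\<beta>: "smooth_on \<Omega>0 (\<lambda>x. \<beta> x v)" for v
    unfolding \<beta>_def by (rule smooth_on_dder[OF s\<Psi>])
  have x0: "\<phi> p \<in> \<Omega>0" using p V by (auto simp: \<Omega>0_def)
  have d\<pi>\<Psi>: "coord_vec \<psi> (d\<pi> q v) = dder \<Psi> (\<phi> q) (coord_vec \<phi> v)"
    if "q \<in> U" "\<pi> q \<in> V" "v \<in> tangent_space M q" for q v
    unfolding \<Psi>_def by (rule coord_vec_differential[OF smooth_M smooth_N smooth_\<pi> c d that])
  have hor: "v \<in> Hor q \<longleftrightarrow> \<beta> (\<phi> q) (coord_vec \<phi> v) = 0"
    if q: "q \<in> U" "\<pi> q \<in> V" and v: "v \<in> tangent_space M q" for q v
  proof -
    have "d\<pi> q (J q v) \<in> d\<pi> q ` tangent_space M q" by (rule imageI[OF J_T[OF v]])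
    then have N: "d\<pi> q (J q v) \<in> tangent_space N (\<pi> q)" unfolding d\<pi>_onto .
    have "d\<pi> q (J q v) = 0 \<longleftrightarrow> coord_vec \<psi> (d\<pi> q (J q v)) = coord_vec \<psi> 0"
    proof
      assume "coord_vec \<psi> (d\<pi> q (J q v)) = coord_vec \<psi> 0"
      then show "d\<pi> q (J q v) = 0"
        by (rule coord_vec_inj[OF smooth_N d' q(2) N zero_in_tangent_space[OF smooth_N]])
    qed simp
    then show ?thesis
      using v by (simp add: Hor_iff_J_Ver Ver_iff J_T d\<pi>\<Psi>[OF q] J[OF q(1)] \<beta>_def linear_0[OF coord_vec_linear])
  qed
  have surj: "surj (\<beta> (\<phi> p))"
  proof (rule surjI)
    fix y
    obtain v where v: "v \<in> tangent_space M p" "d\<pi> p v = chart_vec N V \<psi> (\<pi> p) y"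
      using chart_vec_in_tangent_space[OF smooth_N d' V] d\<pi>_onto by (metis imageE)
    have "dder \<Psi> (\<phi> p) (coord_vec \<phi> v) = y"
      using d\<pi>\<Psi>[OF p V v(1)] coord_vec_chart_vec[OF smooth_N d' V] v(2) by simp
    then have "\<beta> (\<phi> p) (- J0 (coord_vec \<phi> v)) = y"
      by (simp add: \<beta>_def linear_neg[OF J0(1)] J0(2))
    then show "\<beta> (\<phi> p) (SOME u. \<beta> (\<phi> p) u = y) = y" by (rule someI)
  qed
  obtain \<rho> pr F where \<rho>: "\<rho> > 0" "ball (\<phi> p) \<rho> \<subseteq> \<Omega>0" and pr: "linear pr" "\<And>v. pr (pr v) = pr v"
    and linF: "\<And>x. x \<in> ball (\<phi> p) \<rho> \<Longrightarrow> linear (F x)" and sF: "\<And>e. smooth_on (ball (\<phi> p) \<rho>) (\<lambda>x. F x e)"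
    and prF: "\<And>x e. x \<in> ball (\<phi> p) \<rho> \<Longrightarrow> pr (F x e) = pr e"
    and Fpr: "\<And>x e. x \<in> ball (\<phi> p) \<rho> \<Longrightarrow> F x (pr e) = F x e"
    and ker: "\<And>x v. x \<in> ball (\<phi> p) \<rho> \<Longrightarrow> \<beta> x v = 0 \<longleftrightarrow> F x v = v"
  proof (rule kernel_frame[OF o0 x0 l\<beta> s\<beta> surj], assumption, goal_cases)
    case (1 \<rho> pr F)
    show ?case by (rule 1(1)[OF 1(2-10)])
  qed
  define x0 where "x0 = \<phi> p"
  define \<Omega> where "\<Omega> = ball x0 \<rho>"
  note \<Omega> = \<rho>(2)[folded x0_def, folded \<Omega>_def]
    and linF = linF[folded x0_def, folded \<Omega>_def] and sF = sF[folded x0_def, folded \<Omega>_def]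
    and prF = prF[folded x0_def, folded \<Omega>_def] and Fpr = Fpr[folded x0_def, folded \<Omega>_def] and ker = ker[folded x0_def, folded \<Omega>_def]
  have o\<Omega>: "open \<Omega>" "x0 \<in> \<Omega>" using \<rho>(1) by (auto simp: \<Omega>_def)
  have \<Omega>U: "\<Omega> \<subseteq> \<phi> ` U" using \<Omega> by (auto simp: \<Omega>0_def)
  have \<beta>F: "\<beta> x (F x e) = 0" if x: "x \<in> \<Omega>" for x e
    using ker[OF x, of "F x e"] Fpr[OF x, of "F x e"] prF[OF x, of e] Fpr[OF x, of e] by simp
  have bpr: "bounded_linear pr" using pr(1) linear_conv_bounded_linear by blast
  have chart_pt: "q \<in> U" "\<pi> q \<in> V" "\<phi> q = x" if "x \<in> \<Omega>" "q = inv_into U \<phi> x" for q x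
  proof -
    from that(1) \<Omega> obtain q' where "q' \<in> U" "\<pi> q' \<in> V" "x = \<phi> q'" unfolding \<Omega>0_def by blast
    then show "q \<in> U" "\<pi> q \<in> V" "\<phi> q = x" using that(2) injU by auto
  qed
  have comm: "dder (\<lambda>x. F x e') x (F x e) = dder (\<lambda>x. F x e) x (F x e')" if x: "x \<in> \<Omega>" for x e e'
  proof -
    define q where "q = inv_into U \<phi> x"
    note q = chart_pt[OF x q_def]
    obtain r where r: "r > 0" "cball x r \<subseteq> \<Omega>" using o\<Omega>(1) x open_contains_cball by blast
    \<comment> \<open>Involutivity speaks about global sections, so the frame is multiplied by a bump function. The
      derivatives of the latter contribute horizontal terms only, which \<open>\<beta> x\<close> does not see.\<close>
    obtain h :: "'e \<Rightarrow> real" where h: "smooth_on UNIV h" "\<And>y. y \<in> ball x r \<Longrightarrow> h y > 0"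
      "\<And>y. y \<notin> ball x r \<Longrightarrow> h y = 0"
      using bump_function[OF r(1)] by metis
    define X where "X e = cutoff_field M U \<phi> h (\<lambda>x. F x e)" for e
    have XF: "vector_field M (X e)" for e
      unfolding X_def
      by (rule vector_field_cutoff_field[OF smooth_M c h(1) _ compact_cball r(2) o\<Omega>(1) \<Omega>U sF]) (use h(3) in auto)
    have Xc: "coord_vec \<phi> (X e s) = h (\<phi> s) *\<^sub>R F (\<phi> s) e" if "s \<in> U" for s e
      unfolding X_def by (rule coord_vec_cutoff_field[OF smooth_M c that])
    have XH: "X e s \<in> Hor s" for e s
    proof (cases "s \<in> U \<and> \<phi> s \<in> \<Omega>")
      case True
      then have "\<pi> s \<in> V" using chart_pt(2)[of "\<phi> s" s] injU by simp
      moreover have "\<beta> (\<phi> s) (h (\<phi> s) *\<^sub>R F (\<phi> s) e) = 0"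
        using True \<beta>F \<Omega> by (simp add: linear_cmul[OF l\<beta>] subset_iff)
      ultimately show ?thesis using True hor[of s "X e s"] field_T[OF XF] by (simp add: Xc)
    next
      case False
      have "X e s = 0"
      proof (cases "s \<in> U")
        case True
        with False r have "\<phi> s \<notin> ball x r" using ball_subset_cball by blast
        then have "coord_vec \<phi> (X e s) = coord_vec \<phi> 0"
          by (simp add: Xc[OF True] h(3) linear_0[OF coord_vec_linear])
        then show ?thesis by (rule coord_vec_inj[OF smooth_M c True field_T[OF XF] zero_in_tangent_space[OF smooth_M]])
      qed (simp add: X_def cutoff_field_def[OF smooth_M])
      then show ?thesis using subspace_0[OF subspace_Hor] by simp
    qed
    have rep: "field_rep U \<phi> (X e) y = h y *\<^sub>R F y e" if "y \<in> \<Omega>" for y e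
      using chart_pt[OF that refl] by (simp add: field_rep_def Xc)
    have dF: "((\<lambda>x. F x e) has_derivative dder (\<lambda>x. F x e) x) (at x)" for e
      by (rule smooth_on_imp_has_derivative[OF sF x])
    have dh: "(h has_derivative dder h x) (at x)"
      by (rule smooth_on_imp_has_derivative[OF h(1)]) simp
    have drep: "dder (field_rep U \<phi> (X e)) x v = h x *\<^sub>R dder (\<lambda>x. F x e) x v + dder h x v *\<^sub>R F x e" for e v
    proof (rule dder_unique)
      show "(field_rep U \<phi> (X e) has_derivative (\<lambda>v. h x *\<^sub>R dder (\<lambda>x. F x e) x v + dder h x v *\<^sub>R F x e)) (at x)"
        by (rule has_derivative_transform_within_open[OF has_derivative_scaleR[OF dh dF] o\<Omega>(1) x]) (simp add: rep)
    qed
    define \<delta> where "\<delta> = dder (\<lambda>x. F x e') x (F x e) - dder (\<lambda>x. F x e) x (F x e')"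
    have lD: "linear (dder (\<lambda>x. F x e) x)" "linear (dder h x)" for e
      using dF dh has_derivative_linear by blast+
    have "lie_bracket M (X e) (X e') q \<in> Hor q"
      using inv XF XH by (auto simp: horizontal_involutive_def sections_Hor)
    then have "\<beta> x (coord_vec \<phi> (lie_bracket M (X e) (X e') q)) = 0"
      using hor[OF q(1,2) bracket_T[OF XF XF]] q(3) by simp
    moreover have "coord_vec \<phi> (lie_bracket M (X e) (X e') q) = (h x * h x) *\<^sub>R \<delta>
        + (h x * dder h x (F x e)) *\<^sub>R F x e' - (h x * dder h x (F x e')) *\<^sub>R F x e"
      unfolding lie_bracket_coord[OF smooth_M c q(1) XF XF] Xc[OF q(1)] q(3) drep \<delta>_def
      by (simp add: linear_cmul[OF lD(1)] linear_cmul[OF lD(2)] algebra_simps)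
    moreover have "\<beta> x ((h x * h x) *\<^sub>R \<delta> + (h x * dder h x (F x e)) *\<^sub>R F x e' - (h x * dder h x (F x e')) *\<^sub>R F x e)
        = (h x * h x) *\<^sub>R \<beta> x \<delta>"
    proof -
      have "linear (\<beta> x)" using l\<beta> x \<Omega> by blast
      then show ?thesis by (simp add: linear_add linear_diff linear_cmul \<beta>F[OF x])
    qed
    moreover have "h x \<noteq> 0" using h(2)[of x] r(1) by simp
    ultimately have "\<beta> x \<delta> = 0" by simp
    then have F\<delta>: "F x \<delta> = \<delta>" using ker[OF x] by blast
    have "pr (dder (\<lambda>x. F x e) x v) = 0" for e v
    proof -
      have 1: "((\<lambda>y. pr (F y e)) has_derivative (\<lambda>v. pr (dder (\<lambda>x. F x e) x v))) (at x)"
        by (rule bounded_linear.has_derivative[OF bpr dF])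
      have "((\<lambda>y. pr (F y e)) has_derivative (\<lambda>v. 0)) (at x)"
        by (rule has_derivative_transform_within_open[OF has_derivative_const o\<Omega>(1) x]) (simp add: prF)
      from has_derivative_unique[OF 1 this] show ?thesis by metis
    qed
    then have "pr \<delta> = 0" by (simp add: \<delta>_def linear_diff[OF pr(1)])
    then have "F x \<delta> = 0" using Fpr[OF x, of \<delta>] linear_0[OF linF[OF x]] by simp
    with F\<delta> show ?thesis by (simp add: \<delta>_def)
  qed
  obtain r z where r: "r > 0" and z: "z 0 = x0" "z ` ball 0 r \<subseteq> \<Omega>" "smooth_on (ball 0 r) z"
    "\<And>s. s \<in> ball 0 r \<Longrightarrow> (z has_derivative F (z s)) (at s)"
  proof (rule frobenius[OF o\<Omega> linF sF comm], assumption, assumption, goal_cases)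
    case (1 r z)
    show ?case by (rule 1(1)[OF 1(2-6)])
  qed
  have prz: "pr (z s) = pr x0 + pr s" if s: "s \<in> ball 0 r" for s
  proof -
    have "((\<lambda>s. pr (z s) - pr s) has_derivative (\<lambda>h. 0)) (at t within ball 0 r)" if t: "t \<in> ball 0 r" for t
    proof -
      have "((\<lambda>s. pr (z s) - pr s) has_derivative (\<lambda>h. pr (F (z t) h) - pr h)) (at t)"
        by (intro has_derivative_diff bounded_linear.has_derivative[OF bpr] z(4) t bounded_linear_imp_has_derivative[OF bpr])
      moreover have "z t \<in> \<Omega>" using z(2) t by blast
      ultimately show ?thesis by (simp add: prF has_derivative_at_withinI)
    qed
    from has_derivative_zero_constant[OF convex_ball this] obtain k where k: "\<And>t. t \<in> ball 0 r \<Longrightarrow> pr (z t) - pr t = k"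
      by blast
    from k[OF s] k[of 0] r show ?thesis by (simp add: z(1) linear_0[OF pr(1)] algebra_simps)
  qed
  \<comment> \<open>By \<open>prz\<close>, \<open>pr (\<sigma> x) = pr (x - x0)\<close>. So \<open>\<sigma>\<close> is inverted by \<open>\<tau>\<close>, and \<open>x\<close> lies on the graph iff
    \<open>\<sigma> x\<close> lies in the image of \<open>pr\<close>.\<close>
  define \<sigma> where "\<sigma> x = x - z (pr (x - x0)) + pr (x - x0)" for x
  define \<tau> where "\<tau> y = y - pr y + z (pr y)" for y
  define D where "D = {x \<in> \<Omega>. pr (x - x0) \<in> ball 0 r}"
  have cont_pr: "continuous_on UNIV pr" by (rule bounded_linear.continuous_on[OF bpr continuous_on_id])
  have oD: "open D"
  proof -
    have "open ((\<lambda>x. pr (x - x0)) -` ball 0 r)"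
      by (rule open_vimage[OF open_ball]) (intro continuous_on_compose2[OF cont_pr] continuous_intros, auto)
    moreover have "D = \<Omega> \<inter> (\<lambda>x. pr (x - x0)) -` ball 0 r" by (auto simp: D_def)
    ultimately show ?thesis using o\<Omega>(1) by (simp only: open_Int)
  qed
  define Y where "Y = pr -` ball 0 r"
  have oY: "open Y" unfolding Y_def by (rule open_vimage[OF open_ball cont_pr])
  have smz: "smooth_on S (\<lambda>x. z (f x))" if "open S" "smooth_on S f" "f ` S \<subseteq> ball 0 r" for f S
    by (rule smooth_on_compose[OF z(3) that(2,3,1) open_ball])
  have s\<sigma>: "smooth_on D \<sigma>"
    unfolding \<sigma>_def
    by (intro smooth_on_add smooth_on_diff smz smooth_on_linear[OF bpr] oD smooth_on_ident smooth_on_const)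
      (auto simp: D_def)
  have s\<tau>: "smooth_on Y \<tau>"
    unfolding \<tau>_def
    by (intro smooth_on_add smooth_on_diff smz smooth_on_linear[OF bpr] oY smooth_on_ident) (auto simp: Y_def)
  have pr\<sigma>: "pr (\<sigma> x) = pr (x - x0)" if "x \<in> D" for x
    using that prz[of "pr (x - x0)"] by (simp add: D_def \<sigma>_def linear_add[OF pr(1)] linear_diff[OF pr(1)] pr(2))
  have \<tau>\<sigma>: "\<tau> (\<sigma> x) = x" if "x \<in> D" for x
    unfolding \<tau>_def pr\<sigma>[OF that] by (simp add: \<sigma>_def)
  have img: "\<sigma> ` D = {y \<in> Y. \<tau> y \<in> D}"
  proof safe
    fix x assume "x \<in> D"
    then show "\<sigma> x \<in> Y" "\<tau> (\<sigma> x) \<in> D" using pr\<sigma> \<tau>\<sigma> by (auto simp: Y_def D_def)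
  next
    fix y assume y: "y \<in> Y" "\<tau> y \<in> D"
    have "pr (\<tau> y - x0) = pr y"
      using y prz[of "pr y"] by (simp add: \<tau>_def Y_def linear_add[OF pr(1)] linear_diff[OF pr(1)] pr(2))
    then have "\<sigma> (\<tau> y) = y" by (simp add: \<sigma>_def, simp add: \<tau>_def)
    then show "y \<in> \<sigma> ` D" using y by (metis imageI)
  qed
  have o\<sigma>: "open (\<sigma> ` D)"
  proof -
    have "{y \<in> Y. \<tau> y \<in> D} = Y \<inter> \<tau> -` D" by auto
    then show ?thesis
      unfolding img using continuous_open_preimage[OF smooth_on_imp_continuous[OF s\<tau>] oY oD] by simp
  qed
  define U' where "U' = {q \<in> U. \<phi> q \<in> D}"
  have c': "(U', \<sigma> \<circ> \<phi>) \<in> max_atlas M"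
    unfolding U'_def
    by (rule max_atlas_compose_diffeo[OF smooth_M c oD _ s\<sigma> o\<sigma> smooth_on_subset[OF s\<tau>] \<tau>\<sigma>])
      (use \<Omega>U img in \<open>auto simp: D_def\<close>)
  define P where "P = {x. pr x = x}"
  have subP: "subspace P" unfolding P_def subspace_def using pr(1) by (simp add: linear_0 linear_add linear_cmul)
  define L where "L = {q \<in> U'. \<sigma> (\<phi> q) \<in> P}"
  have tangent: "Hor q = {v \<in> tangent_space M q. coord_vec (\<sigma> \<circ> \<phi>) v \<in> P}" if q: "q \<in> L" for q
  proof -
    define x where "x = \<phi> q"
    have qU: "q \<in> U" and xD: "x \<in> D" and xP: "pr (\<sigma> x) = \<sigma> x" using q by (auto simp: L_def U'_def P_def x_def)
    have x\<Omega>: "x \<in> \<Omega>" and xr: "pr (x - x0) \<in> ball 0 r" using xD by (auto simp: D_def)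
    have qV: "\<pi> q \<in> V" using chart_pt(2)[OF x\<Omega>, of q] qU injU by (simp add: x_def)
    have zx: "z (pr (x - x0)) = x" using xP pr\<sigma>[OF xD] by (simp add: \<sigma>_def)
    have dz: "((\<lambda>x. z (pr (x - x0))) has_derivative (\<lambda>u. F x (pr u))) (at x)"
    proof -
      have "((\<lambda>x. pr (x - x0)) has_derivative (\<lambda>u. pr u)) (at x)"
        by (rule bounded_linear.has_derivative[OF bpr]) (auto intro!: derivative_eq_intros)
      from diff_chain_at[OF this z(4)[OF xr]] show ?thesis by (simp add: o_def zx)
    qed
    have d\<sigma>: "dder \<sigma> x u = u - F x u + pr u" for u
    proof (rule dder_unique)
      have "(\<sigma> has_derivative (\<lambda>u. u - F x (pr u) + pr (u - 0))) (at x)"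
        unfolding \<sigma>_def
        by (intro has_derivative_add has_derivative_diff has_derivative_ident dz has_derivative_const
            bounded_linear.has_derivative[OF bpr])
      then show "(\<sigma> has_derivative (\<lambda>u. u - F x u + pr u)) (at x)" by (simp add: Fpr[OF x\<Omega>])
    qed
    have "v \<in> Hor q \<longleftrightarrow> coord_vec (\<sigma> \<circ> \<phi>) v \<in> P" if v: "v \<in> tangent_space M q" for v
    proof -
      let ?u = "coord_vec \<phi> v"
      have "coord_vec (\<sigma> \<circ> \<phi>) v = ?u - F x ?u + pr ?u"
        using coord_vec_compose[OF smooth_M c qU oD _ s\<sigma> v] xD d\<sigma> by (simp add: x_def)
      moreover have "pr (?u - F x ?u + pr ?u) = pr ?u"
        by (simp add: linear_add[OF pr(1)] linear_diff[OF pr(1)] pr(2) prF[OF x\<Omega>])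
      ultimately have "coord_vec (\<sigma> \<circ> \<phi>) v \<in> P \<longleftrightarrow> F x ?u = ?u" by (auto simp: P_def)
      also have "\<dots> \<longleftrightarrow> v \<in> Hor q" using ker[OF x\<Omega>, of ?u] hor[OF qU qV v] by (simp add: x_def)
      finally show ?thesis by blast
    qed
    then show ?thesis using Hor_T by blast
  qed
  have "integral_manifold M Hor L"
    unfolding integral_manifold_def
  proof (intro ballI bexI[OF _ c'], clarify, intro exI conjI)
    show "q \<in> U'" if "q \<in> L" for q using that by (simp add: L_def)
    show "subspace P" by (rule subP)
    show "(\<sigma> \<circ> \<phi>) ` (L \<inter> U') = (\<sigma> \<circ> \<phi>) ` U' \<inter> P" by (auto simp: L_def)
    show "\<forall>r\<in>L \<inter> U'. Hor r = {v \<in> tangent_space M r. coord_vec (\<sigma> \<circ> \<phi>) v \<in> P}"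
      using tangent by blast
  qed
  moreover have "p \<in> L"
    using p o\<Omega>(2) r by (simp add: L_def U'_def D_def P_def x0_def[symmetric] \<sigma>_def z(1) linear_0[OF pr(1)])
  ultimately show ?thesis by blast
qed

lemma integrable_iff_involutive: "integrable_distribution M Hor \<longleftrightarrow> horizontal_involutive"
proof
  assume int: "integrable_distribution M Hor"
  show horizontal_involutive
    unfolding horizontal_involutive_def
    using bracket_in_integrable_distribution[OF smooth_M int] bracket_T by (simp add: sections_Hor)
next
  assume horizontal_involutive
  then show "integrable_distribution M Hor"
    unfolding integrable_distribution_def using involutive_imp_integral_manifold by blast
qed

end

section \<open>The equivalence\<close>

theorem corollary3p5:
  fixes M :: "('m::{t2_space,second_countable_topology}, 'e::euclidean_space) atlas"
    and N :: "('n::{t2_space,second_countable_topology}, 'f::euclidean_space) atlas"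
    and g :: "'m metric" and gN :: "'n metric"
    and J :: "'m \<Rightarrow> 'm tvec \<Rightarrow> 'm tvec"
    and \<omega> :: "'m \<Rightarrow> 'm tvec \<Rightarrow> real" and B1 :: "'m vfield"
    and \<pi> :: "'m \<Rightarrow> 'n"
    and nabla :: "('m, 'm) connection" and nablaN :: "('n, 'n) connection"
    and nabla_\<pi> :: "('m, 'n) connection"
  defines "\<H> \<equiv> horizontal_space M g N \<pi>"
    and "d\<pi> \<equiv> differential N \<pi>"
    and "B \<equiv> B_op M g J N \<pi>"
    and "\<A> \<equiv> oneill_A M g N \<pi> nabla"
    and "II \<equiv> second_fundamental_form N \<pi> nabla nabla_\<pi>"
  assumes "lck_manifold M g J \<omega>"
    and "lee_vector_field M g \<omega> B1"
    and "riemannian_manifold N gN"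
    and "lagrangian_submersion M g J N gN \<pi>"
    and "levi_civita M g nabla"
    and "levi_civita N gN nablaN"
    and "pullback_connection M N \<pi> nablaN nabla_\<pi>"
    and "B1 \<in> sections M (vertical_space M N \<pi>)"
  shows "(integrable_distribution M \<H> \<longleftrightarrow>
           (\<forall>X\<in>sections M \<H>. \<forall>Y\<in>sections M \<H>. \<forall>p.
              II X (\<lambda>q. J q (Y q)) p =
                II Y (\<lambda>q. J q (X q)) p
                - ((1/2) * g p (B Y p) (B1 p)) *\<^sub>R d\<pi> p (X p)
                + ((1/2) * g p (B X p) (B1 p)) *\<^sub>R d\<pi> p (Y p)))
       \<and> (integrable_distribution M \<H> \<longleftrightarrow>
           (\<forall>X\<in>sections M \<H>. \<forall>Y\<in>sections M \<H>. \<forall>p.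
              d\<pi> p (\<A> X (\<lambda>q. J q (Y q)) p - \<A> Y (\<lambda>q. J q (X q)) p) =
                ((1/2) * g p (B Y p) (B1 p)) *\<^sub>R d\<pi> p (X p)
                - ((1/2) * g p (B X p) (B1 p)) *\<^sub>R d\<pi> p (Y p)))"
proof -
  interpret lck_lagrangian M g J \<omega> nabla N gN \<pi>
    using assms by unfold_locales (auto simp: riemannian_manifold_def)
  have D: "connection_along M N \<pi> nabla_\<pi>"
    using \<open>pullback_connection M N \<pi> nablaN nabla_\<pi>\<close> by (simp add: pullback_connection_def)
  have B1: "B1 p \<in> vertical_space M N \<pi> p" for p
    using \<open>B1 \<in> sections M (vertical_space M N \<pi>)\<close> by (simp add: sections_def)
  have B: "B X p = J p (X p)" if "X \<in> sections M \<H>" for X p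
    unfolding B_def B_op_def using that
    by (intro vertical_part_Ver J_Hor_Ver) (simp add: sections_Hor \<H>_def)
  let ?r = "\<lambda>X Y p. ((1/2) * g p (J p (Y p)) (B1 p)) *\<^sub>R d\<pi> p (X p)
      - ((1/2) * g p (J p (X p)) (B1 p)) *\<^sub>R d\<pi> p (Y p)"
  have inv: "integrable_distribution M \<H> \<longleftrightarrow>
    (\<forall>X\<in>sections M \<H>. \<forall>Y\<in>sections M \<H>. \<forall>p.
      d\<pi> p (nabla p (X p) (JF Y)) - d\<pi> p (nabla p (Y p) (JF X)) = ?r X Y p)"
    unfolding \<H>_def d\<pi>_def integrable_iff_involutive horizontal_involutive_def
    using bracket_horizontal_iff[OF \<open>lee_vector_field M g \<omega> B1\<close> B1]
    by (simp add: linear_diff[OF differential_linear])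
  have b: "II X (\<lambda>q. J q (Y q)) p = II Y (\<lambda>q. J q (X q)) p
        - ((1/2) * g p (B Y p) (B1 p)) *\<^sub>R d\<pi> p (X p) + ((1/2) * g p (B X p) (B1 p)) *\<^sub>R d\<pi> p (Y p)
      \<longleftrightarrow> d\<pi> p (nabla p (X p) (JF Y)) - d\<pi> p (nabla p (Y p) (JF X)) = ?r X Y p"
    if X: "X \<in> sections M \<H>" and Y: "Y \<in> sections M \<H>" for X Y p
  proof -
    have "II X (\<lambda>q. J q (Y q)) p = - d\<pi> p (nabla p (X p) (JF Y))"
      "II Y (\<lambda>q. J q (X q)) p = - d\<pi> p (nabla p (Y p) (JF X))"
      using second_fundamental_form_JF[OF D] X Y by (simp_all add: II_def d\<pi>_def \<H>_def JF_def)
    then show ?thesis unfolding B[OF X] B[OF Y] by (auto simp: algebra_simps)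
  qed
  have c: "d\<pi> p (\<A> X (\<lambda>q. J q (Y q)) p - \<A> Y (\<lambda>q. J q (X q)) p) =
        ((1/2) * g p (B Y p) (B1 p)) *\<^sub>R d\<pi> p (X p) - ((1/2) * g p (B X p) (B1 p)) *\<^sub>R d\<pi> p (Y p)
      \<longleftrightarrow> d\<pi> p (nabla p (X p) (JF Y)) - d\<pi> p (nabla p (Y p) (JF X)) = ?r X Y p"
    if X: "X \<in> sections M \<H>" and Y: "Y \<in> sections M \<H>" for X Y p
    using d\<pi>_oneill_A X Y
    by (simp add: \<A>_def d\<pi>_def \<H>_def JF_def linear_diff[OF differential_linear] B[unfolded \<H>_def])
  show ?thesis using inv b c by simp
qed

end
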